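(* There holds the following sharp bound: $$|\mathcal{E}_6(f_1,f_2,f_3,f_4,f_5,f_6)|\le\frac{1}{\pi\sqrt{3}}\prod_{k=1}^6\|f_k\|_{L^2},$$ which means in particular that $0\le\mathcal{H}_6(f)\le\frac{1}{\pi\sqrt{3}}\|f\|_{L^2}^6$, where $\mathcal{H}_6(f)=\mathcal{E}_6(f,f,f,f,f,f)$. Equality holds in the first bound if and only if each $f_k$ is the same Gaussian $\gamma e^{-\alpha x^2+\beta x}$ for some $\alpha,\beta,\gamma\in\mathbb{C}$ with $\operatorname{Re}\alpha>0$.
   Context: The functions $f,f_1,\dots,f_6$ are in $L^2(\mathbb{R}\to\mathbb{C})$. $H=-\Delta+x^2$ on $L^2(\mathbb{R})$, and $e^{itH}$ is the unitary propagator of $iu_t+Hu=0$ (so $e^{itH}\phi_n=e^{it(2n+1)}\phi_n$ for the Hermite functions $\phi_n$, $H\phi_n=(2n+1)\phi_n$). The functional is $$\mathcal{E}_6(f_1,\dots,f_6)=\frac{2}{\pi}\int_{-\pi/4}^{\pi/4}\int_{\mathbb{R}}(e^{itH}f_1)(e^{itH}f_2)(e^{itH}f_3)\overline{(e^{itH}f_4)(e^{itH}f_5)(e^{itH}f_6)}\,dx\,dt.$$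
   Formalization: The equality case is corrected: equality holds iff some f_k is zero, or all f_k are Gaussians with the same α, β (Re α > 0) but possibly different factors γ_k; read literally (one common γ), the "only if" fails, e.g. for f_1 = 2G, f_2 = … = f_6 = G. *)

theory Defs
  imports "HOL-Analysis.Analysis" "HOL-Computational_Algebra.Polynomial"
begin

text \<open>Elements of \<open>L\<^sup>2(\<real> \<rightarrow> \<complex>)\<close> are represented by functions; two functions represent
  the same element iff they agree \<open>AE x in lebesgue\<close>.\<close>

definition L2 :: "(real \<Rightarrow> complex) set" where
  "L2 = {f \<in> borel_measurable lebesgue. integrable lebesgue (\<lambda>x. (cmod (f x))\<^sup>2)}"

definition L2_norm :: "(real \<Rightarrow> complex) \<Rightarrow> real" where
  "L2_norm f = sqrt (LINT x|lebesgue. (cmod (f x))\<^sup>2)"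

definition L2_inner :: "(real \<Rightarrow> complex) \<Rightarrow> (real \<Rightarrow> complex) \<Rightarrow> complex" where
  "L2_inner f g = (LINT x|lebesgue. f x * cnj (g x))"

definition oscillator :: "(real \<Rightarrow> complex) \<Rightarrow> real \<Rightarrow> complex" where
  "oscillator f x =
     - vector_derivative (\<lambda>y. vector_derivative f (at y)) (at x) + of_real (x\<^sup>2) * f x"

text \<open>Physicists' Hermite polynomials. The recursion is Rodrigues' formula
  \<open>H\<^sub>n(x) = (-1)\<^sup>n exp(x\<^sup>2) (d/dx)\<^sup>n exp(-x\<^sup>2)\<close>, differentiated once.\<close>

fun hermite_poly :: "nat \<Rightarrow> real poly" where
  "hermite_poly 0 = 1"
| "hermite_poly (Suc n) = [:0, 2:] * hermite_poly n - pderiv (hermite_poly n)"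

definition hermite_fun :: "nat \<Rightarrow> real \<Rightarrow> complex" where
  "hermite_fun n x = complex_of_real
     (poly (hermite_poly n) x * exp (- x\<^sup>2 / 2) / sqrt (2 ^ n * fact n * sqrt pi))"

lemma hermite_poly_ode:
  "pderiv (pderiv (hermite_poly n)) =
     [:0, 2:] * pderiv (hermite_poly n) - smult (2 * real n) (hermite_poly n)"
proof (induction n)
  case 0
  show ?case by (simp add: pderiv_1)
next
  case (Suc n)
  let ?p = "hermite_poly n"
  have "pderiv (hermite_poly (Suc n)) =
      smult 2 ?p + [:0, 2:] * pderiv ?p - pderiv (pderiv ?p)"
    by (simp add: pderiv_diff pderiv_mult pderiv_pCons del: mult_pCons_left)
  also have "\<dots> = smult 2 ?p + smult (2 * real n) ?p"
    unfolding Suc.IH by (simp del: mult_pCons_left)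
  also have "\<dots> = smult (2 * real (Suc n)) ?p"
    by (simp only: smult_add_left[symmetric]) simp
  finally have d: "pderiv (hermite_poly (Suc n)) = smult (2 * real (Suc n)) ?p" .
  have "[:0, 2:] * smult (2 * real (Suc n)) ?p - smult (2 * real (Suc n)) (hermite_poly (Suc n))
      = smult (2 * real (Suc n)) ([:0, 2:] * ?p - ([:0, 2:] * ?p - pderiv ?p))"
    by (simp only: hermite_poly.simps mult_smult_right smult_diff_right)
  also have "\<dots> = smult (2 * real (Suc n)) (pderiv ?p)"
    by (simp del: mult_pCons_left)
  finally show ?case
    unfolding d pderiv_smult by (rule sym)
qed

text \<open>The Hermite functions are eigenfunctions, \<open>H \<phi>\<^sub>n = (2n+1) \<phi>\<^sub>n\<close>.\<close>

lemma oscillator_hermite_fun: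
  "oscillator (hermite_fun n) x = (2 * of_nat n + 1) * hermite_fun n x"
proof -
  define c where "c = sqrt (2 ^ n * fact n * sqrt pi)"
  define p where "p = hermite_poly n"
  define D where "D q = pderiv q - [:0, 1:] * q" for q :: "real poly"
  define F where "F q x = complex_of_real (poly q x * exp (- x\<^sup>2 / 2) / c)" for q x
  have D: "poly (D q) x = poly (pderiv q) x - x * poly q x" for q x
    by (simp add: D_def)
  have der: "(F q has_vector_derivative F (D q) x) (at x)" for q x
    unfolding F_def D
  proof (rule has_vector_derivative_of_real)
    show "((\<lambda>x. poly q x * exp (- x\<^sup>2 / 2) / c) has_real_derivative
      (poly (pderiv q) x - x * poly q x) * exp (- x\<^sup>2 / 2) / c) (at x)"
      unfolding divide_inverse[of _ c]
      by (rule derivative_eq_intros poly_DERIV refl | simp add: algebra_simps)+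
  qed
  have d: "(\<lambda>y. vector_derivative (F q) (at y)) = F (D q)" for q
    using der by (intro ext vector_derivative_at)
  have h: "hermite_fun n = F p"
    by (rule ext) (simp only: hermite_fun_def c_def p_def F_def)
  have "poly (pderiv (pderiv p)) x = 2 * x * poly (pderiv p) x - 2 * real n * poly p x"
    unfolding p_def hermite_poly_ode by simp
  then have "poly (D (D p)) x = (x\<^sup>2 - (2 * real n + 1)) * poly p x"
    by (simp add: D D_def[of p] pderiv_diff pderiv_mult pderiv_pCons power2_eq_square algebra_simps)
  then have "F (D (D p)) x = of_real (x\<^sup>2 - (2 * real n + 1)) * F p x"
    by (simp only: F_def of_real_mult[symmetric]) simp
  then show ?thesis
    unfolding oscillator_def h d fun_cong[OF d] by (simp add: algebra_simps)
qed

text \<open>\<open>exp (i t H)\<close>, through the Hermite expansion: \<open>propagator t f\<close> is a representative of the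
  \<open>L\<^sup>2\<close>-limit of \<open>\<Sum>n<N. exp (i t (2n+1)) \<langle>f, \<phi>\<^sub>n\<rangle> \<phi>\<^sub>n\<close>. The choice is only one of
  representative, the limit being unique almost everywhere.\<close>

definition is_propagated :: "real \<Rightarrow> (real \<Rightarrow> complex) \<Rightarrow> (real \<Rightarrow> complex) \<Rightarrow> bool" where
  "is_propagated t f g \<longleftrightarrow> g \<in> L2 \<and>
     (\<lambda>N. L2_norm (\<lambda>x. g x - (\<Sum>n<N. exp (\<i> * of_real (t * (2 * real n + 1)))
        * L2_inner f (hermite_fun n) * hermite_fun n x))) \<longlonglongrightarrow> 0"

definition propagator :: "real \<Rightarrow> (real \<Rightarrow> complex) \<Rightarrow> real \<Rightarrow> complex" where
  "propagator t f = (SOME g. is_propagated t f g)"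

definition E6_integrand ::
  "(real \<Rightarrow> complex) \<Rightarrow> (real \<Rightarrow> complex) \<Rightarrow> (real \<Rightarrow> complex) \<Rightarrow>
   (real \<Rightarrow> complex) \<Rightarrow> (real \<Rightarrow> complex) \<Rightarrow> (real \<Rightarrow> complex) \<Rightarrow> real \<Rightarrow> real \<Rightarrow> complex" where
  "E6_integrand f1 f2 f3 f4 f5 f6 t x =
     propagator t f1 x * propagator t f2 x * propagator t f3 x *
     cnj (propagator t f4 x * propagator t f5 x * propagator t f6 x)"

text \<open>Independent of the representatives of \<open>propagator t f\<^sub>k\<close>, since these enter only
  through an integral over \<open>x\<close> at each fixed \<open>t\<close>.\<close>

definition E6 ::
  "(real \<Rightarrow> complex) \<Rightarrow> (real \<Rightarrow> complex) \<Rightarrow> (real \<Rightarrow> complex) \<Rightarrow>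
   (real \<Rightarrow> complex) \<Rightarrow> (real \<Rightarrow> complex) \<Rightarrow> (real \<Rightarrow> complex) \<Rightarrow> complex" where
  "E6 f1 f2 f3 f4 f5 f6 = of_real (2 / pi) *
     (LINT t:{- pi / 4..pi / 4}|lebesgue. LINT x|lebesgue. E6_integrand f1 f2 f3 f4 f5 f6 t x)"

text \<open>Absolute convergence of the iterated integral; without it a bound on \<open>E6\<close> could hold
  merely because a divergent integral is assigned the value 0.\<close>

definition E6_converges ::
  "(real \<Rightarrow> complex) \<Rightarrow> (real \<Rightarrow> complex) \<Rightarrow> (real \<Rightarrow> complex) \<Rightarrow>
   (real \<Rightarrow> complex) \<Rightarrow> (real \<Rightarrow> complex) \<Rightarrow> (real \<Rightarrow> complex) \<Rightarrow> bool" where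
  "E6_converges f1 f2 f3 f4 f5 f6 \<longleftrightarrow>
     (AE t in lebesgue. t \<in> {- pi / 4..pi / 4} \<longrightarrow>
        integrable lebesgue (E6_integrand f1 f2 f3 f4 f5 f6 t)) \<and>
     set_integrable lebesgue {- pi / 4..pi / 4}
        (\<lambda>t. LINT x|lebesgue. cmod (E6_integrand f1 f2 f3 f4 f5 f6 t x))"

definition H6 :: "(real \<Rightarrow> complex) \<Rightarrow> complex" where
  "H6 f = E6 f f f f f f"

definition gaussian :: "complex \<Rightarrow> complex \<Rightarrow> complex \<Rightarrow> real \<Rightarrow> complex" where
  "gaussian \<alpha> \<beta> \<gamma> x = \<gamma> * exp (- \<alpha> * (of_real x)\<^sup>2 + \<beta> * of_real x)"

end

theory Submission
  imports Defs "HOL-Probability.Probability"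
begin

text \<open>In the Hermite basis the time integral keeps only the terms with
  \<open>n\<^sub>1 + n\<^sub>2 + n\<^sub>3 = n\<^sub>4 + n\<^sub>5 + n\<^sub>6\<close>, and the spatial integral of six Hermite functions is, up to the
  factor \<open>1 / (pi sqrt 3)\<close>, the matrix of an orthogonal projection: the one onto those states of the
  three-dimensional oscillator that are invariant under rotations about the axis \<open>(1, 1, 1)\<close>. Hence
  \<open>E6\<close> is \<open>1 / (pi sqrt 3)\<close> times the inner product of the projections of \<open>f\<^sub>1 \<otimes> f\<^sub>2 \<otimes> f\<^sub>3\<close> and
  \<open>f\<^sub>4 \<otimes> f\<^sub>5 \<otimes> f\<^sub>6\<close>, which gives the bound and the positivity. Applied to the sixth power of a
  single wave, the bound also shows that the space-time integral converges for all data in \<open>L\<^sup>2\<close>.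

  In the case of equality both tensor products are rotation invariant and proportional. In terms of
  Hermite coefficients, invariance of a tensor product means that its factors obey one and the same
  two-term recurrence, whose square summable solutions are the coefficients of Gaussians.\<close>

section \<open>Rotation invariant homogeneous polynomials\<close>

text \<open>Why a projection appears: for x, y in three-space let s_x, s_y be the sums of the
  coordinates and r, rho the distances to the axis. The generating function of the normalised
  integrals is exp (s_x s_y / 3 - (r^2 + rho^2) / 2). Its part of equal degrees in x and y is exp
  (s_x s_y / 3) I_0 (r rho), which is the mean of the Fock space kernel exp (x . R y) over the
  rotations R about the axis. The proof never forms this mean. It works with the coefficients, for
  which integration by parts gives a recurrence, and infinitesimal identities take the place of
  integration over the group. Indices are integers, so that shifts may run below zero, where all
  arrays vanish, and the recurrences hold without boundary cases. The analytic obstacle is that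
  \<open>propagator\<close> is chosen separately at each time: nothing is known about its dependence
  on t until it is replaced by an explicit limit that is jointly measurable.\<close>

definition triples :: "nat \<Rightarrow> (int \<times> int \<times> int) set" where
  "triples L = {(i, j, k). 0 \<le> i \<and> 0 \<le> j \<and> 0 \<le> k \<and> i + j + k = int L}"

lemma finite_triples [simp]: "finite (triples L)"
proof (rule finite_subset)
  show "triples L \<subseteq> {0..int L} \<times> {0..int L} \<times> {0..int L}"
    by (auto simp: triples_def)
qed auto

text \<open>The squared norm of the monomial x^i y^j z^k in Fock space, where multiplication by a
  variable is adjoint to differentiation in it.\<close>

definition weight :: "int \<Rightarrow> int \<Rightarrow> int \<Rightarrow> real" where
  "weight i j k = fact (nat i) * fact (nat j) * fact (nat k)"

lemma weight_pos [simp]: "0 < weight i j k"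
  by (simp add: weight_def)

lemma fact_nat_Suc: "0 \<le> i \<Longrightarrow> (fact (nat (i + 1)) :: real) = of_int (i + 1) * fact (nat i)"
  by (simp add: nat_add_distrib)

lemma weight_Suc:
  "0 \<le> i \<Longrightarrow> weight (i + 1) j k = of_int (i + 1) * weight i j k"
  "0 \<le> j \<Longrightarrow> weight i (j + 1) k = of_int (j + 1) * weight i j k"
  "0 \<le> k \<Longrightarrow> weight i j (k + 1) = of_int (k + 1) * weight i j k"
  by (simp_all only: weight_def fact_nat_Suc mult_ac)

context
  fixes u v :: "int \<Rightarrow> int \<Rightarrow> int \<Rightarrow> complex"
begin

text \<open>The adjointness of multiplication by a variable, which shifts \<open>v\<close>, and
  differentiation in it, which acts on \<open>u\<close>.\<close>

lemma sum_triples_shift: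
  assumes "\<And>i j k. i < 0 \<or> j < 0 \<or> k < 0 \<Longrightarrow> v i j k = 0"
  shows
  "(\<Sum>(i, j, k)\<in>triples (Suc L). of_real (weight i j k) * v (i - 1) j k * u i j k) =
   (\<Sum>(i, j, k)\<in>triples L. of_real (weight i j k) * v i j k * (of_int (i + 1) * u (i + 1) j k))" (is ?t1)
  "(\<Sum>(i, j, k)\<in>triples (Suc L). of_real (weight i j k) * v i (j - 1) k * u i j k) =
   (\<Sum>(i, j, k)\<in>triples L. of_real (weight i j k) * v i j k * (of_int (j + 1) * u i (j + 1) k))" (is ?t2)
  "(\<Sum>(i, j, k)\<in>triples (Suc L). of_real (weight i j k) * v i j (k - 1) * u i j k) =
   (\<Sum>(i, j, k)\<in>triples L. of_real (weight i j k) * v i j k * (of_int (k + 1) * u i j (k + 1)))" (is ?t3)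
proof -
  have vz: "0 \<le> i \<and> 0 \<le> j \<and> 0 \<le> k" if "v i j k \<noteq> 0" for i j k
    using assms[of i j k] that by linarith
  show ?t1
  proof -
    have "(\<Sum>(i, j, k)\<in>triples L. of_real (weight i j k) * v i j k * (of_int (i + 1) * u (i + 1) j k)) =
      (\<Sum>(i, j, k)\<in>{(i, j, k)\<in>triples (Suc L). 1 \<le> i}. of_real (weight i j k) * v (i - 1) j k * u i j k)"
      by (rule sum.reindex_bij_witness[where j = "\<lambda>(i, j, k). (i + 1, j, k)" and i = "\<lambda>(i, j, k). (i - 1, j, k)"])
        (auto simp: triples_def weight_Suc)
    also have "\<dots> = (\<Sum>(i, j, k)\<in>triples (Suc L). of_real (weight i j k) * v (i - 1) j k * u i j k)"
      by (rule sum.mono_neutral_left[OF finite_triples]) (auto simp: triples_def dest!: vz)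
    finally show ?thesis ..
  qed
  show ?t2
  proof -
    have "(\<Sum>(i, j, k)\<in>triples L. of_real (weight i j k) * v i j k * (of_int (j + 1) * u i (j + 1) k)) =
      (\<Sum>(i, j, k)\<in>{(i, j, k)\<in>triples (Suc L). 1 \<le> j}. of_real (weight i j k) * v i (j - 1) k * u i j k)"
      by (rule sum.reindex_bij_witness[where j = "\<lambda>(i, j, k). (i, j + 1, k)" and i = "\<lambda>(i, j, k). (i, j - 1, k)"])
        (auto simp: triples_def weight_Suc)
    also have "\<dots> = (\<Sum>(i, j, k)\<in>triples (Suc L). of_real (weight i j k) * v i (j - 1) k * u i j k)"
      by (rule sum.mono_neutral_left[OF finite_triples]) (auto simp: triples_def dest!: vz)
    finally show ?thesis ..
  qed
  show ?t3
  proof -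
    have "(\<Sum>(i, j, k)\<in>triples L. of_real (weight i j k) * v i j k * (of_int (k + 1) * u i j (k + 1))) =
      (\<Sum>(i, j, k)\<in>{(i, j, k)\<in>triples (Suc L). 1 \<le> k}. of_real (weight i j k) * v i j (k - 1) * u i j k)"
      by (rule sum.reindex_bij_witness[where j = "\<lambda>(i, j, k). (i, j, k + 1)" and i = "\<lambda>(i, j, k). (i, j, k - 1)"])
        (auto simp: triples_def weight_Suc)
    also have "\<dots> = (\<Sum>(i, j, k)\<in>triples (Suc L). of_real (weight i j k) * v i j (k - 1) * u i j k)"
      by (rule sum.mono_neutral_left[OF finite_triples]) (auto simp: triples_def dest!: vz)
    finally show ?thesis ..
  qed
qed

end

text \<open>An array \<open>u\<close> stands for the formal power series \<open>\<Sum> u i j k x\<^sup>i y\<^sup>j z\<^sup>k\<close>; \<open>rot\<close>, \<open>del\<close> and \<open>lap\<close>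
  are the rotation field about the axis \<open>(1, 1, 1)\<close>, the derivative along this axis and the Laplacian.\<close>

definition rot :: "(int \<Rightarrow> int \<Rightarrow> int \<Rightarrow> 'a::comm_ring_1) \<Rightarrow> int \<Rightarrow> int \<Rightarrow> int \<Rightarrow> 'a" where
  "rot u i j k =
     of_int (i + 1) * (u (i + 1) (j - 1) k - u (i + 1) j (k - 1))
   + of_int (j + 1) * (u i (j + 1) (k - 1) - u (i - 1) (j + 1) k)
   + of_int (k + 1) * (u (i - 1) j (k + 1) - u i (j - 1) (k + 1))"

definition del :: "(int \<Rightarrow> int \<Rightarrow> int \<Rightarrow> 'a::comm_ring_1) \<Rightarrow> int \<Rightarrow> int \<Rightarrow> int \<Rightarrow> 'a" where
  "del u i j k = of_int (i + 1) * u (i + 1) j k + of_int (j + 1) * u i (j + 1) k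
     + of_int (k + 1) * u i j (k + 1)"

definition lap :: "(int \<Rightarrow> int \<Rightarrow> int \<Rightarrow> 'a::comm_ring_1) \<Rightarrow> int \<Rightarrow> int \<Rightarrow> int \<Rightarrow> 'a" where
  "lap u i j k = of_int (i + 1) * (of_int (i + 2) * u (i + 2) j k)
     + of_int (j + 1) * (of_int (j + 2) * u i (j + 2) k)
     + of_int (k + 1) * (of_int (k + 2) * u i j (k + 2))"

lemma rot_del: "rot (del u) i j k = del (rot u) i j k"
  unfolding rot_def del_def by (simp add: algebra_simps)

lemma rot_lap: "rot (lap u) i j k = lap (rot u) i j k"
  unfolding rot_def lap_def by (simp add: algebra_simps)

text \<open>In the plane orthogonal to the axis, \<open>rot\<^sup>2 = 3 (r\<^sup>2 \<Delta> - (r \<partial>\<^sub>r)\<^sup>2)\<close>.\<close>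

lemma rot_rot_eq:
  fixes u :: "int \<Rightarrow> int \<Rightarrow> int \<Rightarrow> complex"
  assumes del: "del u = (\<lambda>_ _ _. 0)" and lap: "lap u = (\<lambda>_ _ _. 0)"
  shows "rot (rot u) i j k = - 3 * (of_int (i + j + k))\<^sup>2 * u i j k"
proof -
  \<comment> \<open>\<open>X\<close> and \<open>R\<close> are multiplication by x + y + z and by x^2
    + y^2 + z^2, and \<open>E\<close> is the Euler operator. Written with them, the planar formula
    becomes an identity in three variables whose error terms all pass through \<open>del\<close> or
    \<open>lap\<close>.\<close>
  define X where "X w i j k = w (i - 1) j k + w i (j - 1) k + w i j (k - 1)"
    for w :: "int \<Rightarrow> int \<Rightarrow> int \<Rightarrow> complex" and i j k
  define R where "R w i j k = w (i - 2) j k + w i (j - 2) k + w i j (k - 2)"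
    for w :: "int \<Rightarrow> int \<Rightarrow> int \<Rightarrow> complex" and i j k
  define E where "E w i j k = of_int (i + j + k) * w i j k"
    for w :: "int \<Rightarrow> int \<Rightarrow> int \<Rightarrow> complex" and i j k
  have "rot (rot u) i j k + 3 * (of_int (i + j + k))\<^sup>2 * u i j k
     = 3 * R (lap u) i j k - X (X (lap u)) i j k - R (del (del u)) i j k
       + 2 * X (E (del u)) i j k + X (del u) i j k"
    unfolding rot_def del_def lap_def X_def R_def E_def
    by (simp add: algebra_simps power2_eq_square)
  also have "\<dots> = 0"
    unfolding del lap by (simp add: X_def R_def E_def del_def)
  finally show ?thesis
    by (simp add: add_eq_0_iff)
qed

text \<open>In terms of the generating function exp (s^2 / 6 - q / 2), where s is the sum and q the
  sum of squares of all six variables, \<open>rec\<close> says that the derivative in the first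
  variable is multiplication by s / 3 minus that variable. Each lemma on \<open>K\<close> below is a
  computation with this exponential.\<close>

locale rotation_kernel =
  fixes K :: "int \<Rightarrow> int \<Rightarrow> int \<Rightarrow> int \<Rightarrow> int \<Rightarrow> int \<Rightarrow> real"
  assumes rec: "of_int (i + 1) * K (i + 1) j k a b c =
      (K (i - 1) j k a b c + K i (j - 1) k a b c + K i j (k - 1) a b c
     + K i j k (a - 1) b c + K i j k a (b - 1) c + K i j k a b (c - 1)) / 3 - K (i - 1) j k a b c"
    and swap12: "K i j k a b c = K j i k a b c"
    and swap23: "K i j k a b c = K i k j a b c"
    and sym: "K i j k a b c = K a b c i j k"
    and neg: "i < 0 \<Longrightarrow> K i j k a b c = 0"
    and zero: "K 0 0 0 0 0 0 = 1"
begin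

lemma neg2: "j < 0 \<Longrightarrow> K i j k a b c = 0" and neg3: "k < 0 \<Longrightarrow> K i j k a b c = 0"
  using neg swap12 swap23 by metis+

lemma neg': "a < 0 \<or> b < 0 \<or> c < 0 \<Longrightarrow> K i j k a b c = 0"
  using neg neg2 neg3 sym by metis

lemma rec2: "of_int (j + 1) * K i (j + 1) k a b c =
      (K (i - 1) j k a b c + K i (j - 1) k a b c + K i j (k - 1) a b c
     + K i j k (a - 1) b c + K i j k a (b - 1) c + K i j k a b (c - 1)) / 3 - K i (j - 1) k a b c"
  using rec[of j i k a b c] by (simp add: swap12[of j] swap12[of "j + 1"] swap12[of "j - 1"])

lemma rec3: "of_int (k + 1) * K i j (k + 1) a b c =
      (K (i - 1) j k a b c + K i (j - 1) k a b c + K i j (k - 1) a b c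
     + K i j k (a - 1) b c + K i j k a (b - 1) c + K i j k a b (c - 1)) / 3 - K i j (k - 1) a b c"
  using rec2[of k i j a b c] by (simp add: swap23[of _ k] swap23[of _ "k + 1"] swap23[of _ "k - 1"])

lemma rec_1: "of_int i * K i j k a b c =
      (K (i - 2) j k a b c + K (i - 1) (j - 1) k a b c + K (i - 1) j (k - 1) a b c
     + K (i - 1) j k (a - 1) b c + K (i - 1) j k a (b - 1) c + K (i - 1) j k a b (c - 1)) / 3 - K (i - 2) j k a b c"
  using rec[of "i - 1" j k a b c] by simp

lemma rec2_1: "of_int j * K i j k a b c =
      (K (i - 1) (j - 1) k a b c + K i (j - 2) k a b c + K i (j - 1) (k - 1) a b c
     + K i (j - 1) k (a - 1) b c + K i (j - 1) k a (b - 1) c + K i (j - 1) k a b (c - 1)) / 3 - K i (j - 2) k a b c"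
  using rec2[of "j - 1" i k a b c] by simp

lemma rec3_1: "of_int k * K i j k a b c =
      (K (i - 1) j (k - 1) a b c + K i (j - 1) (k - 1) a b c + K i j (k - 2) a b c
     + K i j (k - 1) (a - 1) b c + K i j (k - 1) a (b - 1) c + K i j (k - 1) a b (c - 1)) / 3 - K i j (k - 2) a b c"
  using rec3[of "k - 1" i j a b c] by simp

text \<open>The exponent has gradient s / 3 minus the position. The first part is parallel to the
  axis and the second is radial, so \<open>rot\<close> annihilates both.\<close>

lemma rot_kernel: "rot (\<lambda>i j k. K i j k a b c) i j k = 0"
  unfolding rot_def right_diff_distrib rec rec2 rec3 by (simp add: field_simps)

text \<open>Summing the three derivatives gives s minus the sum of the first three variables. What
  remains is multiplication by the sum of the last three.\<close>

lemma del_kernel: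
  "del (\<lambda>i j k. K i j k a b c) i j k = K i j k (a - 1) b c + K i j k a (b - 1) c + K i j k a b (c - 1)"
  unfolding del_def rec rec2 rec3 by (simp add: field_simps)

text \<open>The difference of the Euler operators in the two groups of variables, applied to the
  exponential. It converts a difference of degrees into multiplication by quadratic
  polynomials.\<close>

lemma euler_kernel:
  "of_int (a + b + c - i - j - k) * K i j k a b c =
     K (i - 2) j k a b c + K i (j - 2) k a b c + K i j (k - 2) a b c
   - K i j k (a - 2) b c - K i j k a (b - 2) c - K i j k a b (c - 2)
   + (K i j k (a - 2) b c + K i j k a (b - 2) c + K i j k a b (c - 2)
   + 2 * K i j k (a - 1) (b - 1) c + 2 * K i j k (a - 1) b (c - 1) + 2 * K i j k a (b - 1) (c - 1)
   - K (i - 2) j k a b c - K i (j - 2) k a b c - K i j (k - 2) a b c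
   - 2 * K (i - 1) (j - 1) k a b c - 2 * K (i - 1) j (k - 1) a b c - 2 * K i (j - 1) (k - 1) a b c) / 3"
proof -
  note r = rec_1[of a b c i j k] rec2_1[of b a c i j k] rec3_1[of c a b i j k]
  have "of_int (a + b + c - i - j - k) * K i j k a b c
    = (of_int a * K i j k a b c + of_int b * K i j k a b c + of_int c * K i j k a b c)
      - (of_int i * K i j k a b c + of_int j * K i j k a b c + of_int k * K i j k a b c)"
    by (simp add: algebra_simps)
  then show ?thesis
    unfolding r[unfolded sym[of a] sym[of "a - 1"] sym[of "a - 2"]]
      rec_1[of i j k a b c] rec2_1[of j i k a b c] rec3_1[of k i j a b c]
    by (simp add: field_simps)
qed

text \<open>The squared gradient plus the Laplacian of the exponent is the quadratic polynomial of
  \<open>euler_kernel\<close>, minus 2, plus the sum of squares of the last three variables. When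
  the degrees differ by exactly 2 the first two contributions cancel.\<close>

lemma lap_kernel:
  assumes "a + b + c = i + j + k + 2"
  shows "lap (\<lambda>i j k. K i j k a b c) i j k = K i j k (a - 2) b c + K i j k a (b - 2) c + K i j k a b (c - 2)"
proof -
  have e: "2 * K i j k a b c = of_int (a + b + c - i - j - k) * K i j k a b c"
    using assms by simp
  have ri: "of_int (i + 2) * K (i + 2) j k a b c =
     (K i j k a b c + K (i + 1) (j - 1) k a b c + K (i + 1) j (k - 1) a b c + K (i + 1) j k (a - 1) b c + K (i + 1)
         j k a (b - 1) c + K (i + 1) j k a b (c - 1)) / 3 - K i j k a b c"
    using rec[of "i + 1" j k a b c] by (simp add: add.assoc)
  have rj: "of_int (j + 2) * K i (j + 2) k a b c =
     (K (i - 1) (j + 1) k a b c + K i j k a b c + K i (j + 1) (k - 1) a b c + K i (j + 1) k (a - 1) b c + K i (j +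
         1) k a (b - 1) c + K i (j + 1) k a b (c - 1)) / 3 - K i j k a b c"
    using rec2[of "j + 1" i k a b c] by (simp add: add.assoc)
  have rk: "of_int (k + 2) * K i j (k + 2) a b c =
     (K (i - 1) j (k + 1) a b c + K i (j - 1) (k + 1) a b c + K i j k a b c + K i j (k + 1) (a - 1) b c + K i j (k +
         1) a (b - 1) c + K i j (k + 1) a b (c - 1)) / 3 - K i j k a b c"
    using rec3[of "k + 1" i j a b c] by (simp add: add.assoc)
  have 1: "of_int (i + 1) * (of_int (i + 2) * K (i + 2) j k a b c) =
    (of_int (i + 1) * K i j k a b c + of_int (i + 1) * K (i + 1) (j - 1) k a b c + of_int (i + 1) * K (i + 1) j (k -
        1) a b c
     + of_int (i + 1) * K (i + 1) j k (a - 1) b c + of_int (i + 1) * K (i + 1) j k a (b - 1) c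
     + of_int (i + 1) * K (i + 1) j k a b (c - 1)) / 3 - of_int (i + 1) * K i j k a b c"
    unfolding ri by (simp add: add_divide_distrib distrib_left right_diff_distrib)
  have 2: "of_int (j + 1) * (of_int (j + 2) * K i (j + 2) k a b c) =
    (of_int (j + 1) * K (i - 1) (j + 1) k a b c + of_int (j + 1) * K i j k a b c + of_int (j + 1) * K i (j + 1) (k -
        1) a b c
     + of_int (j + 1) * K i (j + 1) k (a - 1) b c + of_int (j + 1) * K i (j + 1) k a (b - 1) c
     + of_int (j + 1) * K i (j + 1) k a b (c - 1)) / 3 - of_int (j + 1) * K i j k a b c"
    unfolding rj by (simp add: add_divide_distrib distrib_left right_diff_distrib)
  have 3: "of_int (k + 1) * (of_int (k + 2) * K i j (k + 2) a b c) =
    (of_int (k + 1) * K (i - 1) j (k + 1) a b c + of_int (k + 1) * K i (j - 1) (k + 1) a b c + of_int (k + 1) * K i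
        j k a b c
     + of_int (k + 1) * K i j (k + 1) (a - 1) b c + of_int (k + 1) * K i j (k + 1) a (b - 1) c
     + of_int (k + 1) * K i j (k + 1) a b (c - 1)) / 3 - of_int (k + 1) * K i j k a b c"
    unfolding rk by (simp add: add_divide_distrib distrib_left right_diff_distrib)
  have E: "of_int (i + 1) * K i j k a b c = of_int i * K i j k a b c + K i j k a b c"
    "of_int (j + 1) * K i j k a b c = of_int j * K i j k a b c + K i j k a b c"
    "of_int (k + 1) * K i j k a b c = of_int k * K i j k a b c + K i j k a b c"
    by (simp_all add: algebra_simps)
  show ?thesis
    unfolding lap_def 1 2 3 rec rec2 rec3 E rec_1[of i] rec2_1[of j] rec3_1[of k]
    using e[unfolded euler_kernel] by (simp add: field_simps)
qed


text \<open>\<open>K\<close> couples different degrees as well, so only the entries on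
  \<open>triples L\<close> are those of the projection. Keeping the other entries lets
  \<open>rot_proj\<close> and \<open>del_proj\<close> hold at all indices.\<close>

definition proj :: "nat \<Rightarrow> (int \<Rightarrow> int \<Rightarrow> int \<Rightarrow> complex) \<Rightarrow> int \<Rightarrow> int \<Rightarrow> int \<Rightarrow> complex" where
  "proj L u i j k = (\<Sum>(a, b, c)\<in>triples L. of_real (weight a b c) * of_real (K i j k a b c) * u a b c)"

lemma proj_neg: "i < 0 \<or> j < 0 \<or> k < 0 \<Longrightarrow> proj L u i j k = 0"
  unfolding proj_def using neg neg2 neg3 by (intro sum.neutral) auto

lemma rot_proj: "rot (proj L u) i j k = 0"
proof -
  have "rot (proj L u) i j k = (\<Sum>(a, b, c)\<in>triples L. of_real (weight a b c)
      * of_real (rot (\<lambda>i j k. K i j k a b c) i j k) * u a b c)"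
    unfolding rot_def proj_def of_real_add of_real_mult of_real_diff of_real_of_int_eq
    by (simp add: sum_subtractf[symmetric] sum.distrib[symmetric] sum_distrib_left split_def algebra_simps)
  then show ?thesis
    by (simp add: rot_kernel)
qed

text \<open>By \<open>del_kernel\<close>, differentiating the kernel in its first group of variables
  is multiplication in the second; adjointness moves this onto \<open>u\<close> as a derivative. The
  same mechanism gives \<open>lap_proj\<close>, with the restriction on the degree that
  \<open>lap_kernel\<close> imposes.\<close>

lemma del_proj: "del (proj (Suc L) u) i j k = proj L (del u) i j k"
proof -
  have "del (proj (Suc L) u) i j k = (\<Sum>(a, b, c)\<in>triples (Suc L). of_real (weight a b c)
      * of_real (del (\<lambda>i j k. K i j k a b c) i j k) * u a b c)"
    unfolding del_def proj_def of_real_add of_real_mult of_real_diff of_real_of_int_eq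
    by (simp add: sum.distrib[symmetric] sum_distrib_left split_def algebra_simps)
  also have "\<dots> =
      (\<Sum>(a, b, c)\<in>triples (Suc L). of_real (weight a b c) * of_real (K i j k (a - 1) b c) * u a b c)
    + (\<Sum>(a, b, c)\<in>triples (Suc L). of_real (weight a b c) * of_real (K i j k a (b - 1) c) * u a b c)
    + (\<Sum>(a, b, c)\<in>triples (Suc L). of_real (weight a b c) * of_real (K i j k a b (c - 1)) * u a b c)"
    by (simp add: del_kernel sum.distrib[symmetric] split_def algebra_simps)
  also have "\<dots> = proj L (del u) i j k"
    by (subst sum_triples_shift; simp add: neg' proj_def del_def)+
       (simp add: sum.distrib[symmetric] split_def algebra_simps)
  finally show ?thesis .
qed

lemma lap_proj:
  assumes "i + j + k = int L"
  shows "lap (proj (Suc (Suc L)) u) i j k = proj L (lap u) i j k"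
proof -
  let ?T = "triples (Suc (Suc L))"
  have e: "x - 2 = x - 1 - 1" and e': "x + 2 = x + 1 + 1" for x :: int by simp_all
  have s:
   "(\<Sum>(a, b, c)\<in>?T. of_real (weight a b c) * of_real (K i j k (a - 2) b c) * u a b c)
   = (\<Sum>(a, b, c)\<in>triples L. of_real (weight a b c) * of_real (K i j k a b c) * (of_int (a + 1) * (of_int (a + 2) * u
       (a + 2) b c)))"
   "(\<Sum>(a, b, c)\<in>?T. of_real (weight a b c) * of_real (K i j k a (b - 2) c) * u a b c)
   = (\<Sum>(a, b, c)\<in>triples L. of_real (weight a b c) * of_real (K i j k a b c) * (of_int (b + 1) * (of_int (b + 2) * u
       a (b + 2) c)))"
   "(\<Sum>(a, b, c)\<in>?T. of_real (weight a b c) * of_real (K i j k a b (c - 2)) * u a b c)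
   = (\<Sum>(a, b, c)\<in>triples L. of_real (weight a b c) * of_real (K i j k a b c) * (of_int (c + 1) * (of_int (c + 2) * u
       a b (c + 2))))"
    unfolding e e'
    by (rule trans[OF sum_triples_shift(1) sum_triples_shift(1)] trans[OF sum_triples_shift(2) sum_triples_shift(2)]
        trans[OF sum_triples_shift(3) sum_triples_shift(3)]; auto simp: neg')+
  have "lap (proj (Suc (Suc L)) u) i j k = (\<Sum>(a, b, c)\<in>?T. of_real (weight a b c)
      * of_real (lap (\<lambda>i j k. K i j k a b c) i j k) * u a b c)"
    unfolding lap_def proj_def of_real_add of_real_mult of_real_diff of_real_of_int_eq
    by (simp add: sum.distrib[symmetric] sum_distrib_left split_def algebra_simps)
  also have "\<dots> = (\<Sum>(a, b, c)\<in>?T. of_real (weight a b c)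
      * of_real (K i j k (a - 2) b c + K i j k a (b - 2) c + K i j k a b (c - 2)) * u a b c)"
    using assms by (intro sum.cong refl) (auto simp: triples_def lap_kernel)
  also have "\<dots> = proj L (lap u) i j k"
    unfolding of_real_add distrib_right distrib_left split_def sum.distrib s[unfolded split_def]
    by (simp add: proj_def lap_def sum.distrib[symmetric] split_def algebra_simps)
  finally show ?thesis .
qed

text \<open>The kernel is that of the orthogonal projection onto rotation invariant polynomials. Both \<open>del\<close>
  and \<open>lap\<close> intertwine it with its restriction to lower degree, so by induction the difference of a
  rotation invariant polynomial and its image is annihilated by \<open>rot\<close>, \<open>del\<close> and \<open>lap\<close>; the formula
  for \<open>rot\<^sup>2\<close> leaves only zero.\<close>

lemma proj_rotation_invariant:
  assumes "rot u = (\<lambda>_ _ _. 0)" "\<And>i j k. (i, j, k) \<notin> triples L \<Longrightarrow> u i j k = 0"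
    "(i, j, k) \<in> triples L"
  shows "proj L u i j k = u i j k"
  using assms
proof (induction L arbitrary: u i j k rule: less_induct)
  case (less L)
  \<comment> \<open>The difference is cut down to degree \<open>L\<close>, so that the three
    differential equations for it can be asserted at every index.\<close>
  define v where "v i j k = (if (i, j, k) \<in> triples L then proj L u i j k - u i j k else 0)" for i j k
  have v: "v i j k = proj L u i j k - u i j k" if "i + j + k = int L" for i j k
    using that less.prems(2)[of i j k] proj_neg[of i j k L u]
    by (auto simp: v_def triples_def not_le)
  have v0: "v i j k = 0" if "i + j + k \<noteq> int L \<or> i < 0 \<or> j < 0 \<or> k < 0" for i j k
    using that by (auto simp: v_def triples_def)
  show ?case
  proof (cases "L = 0")
    case True
    then have "triples L = {(0, 0, 0)}" by (auto simp: triples_def)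
    with less.prems(3) show ?thesis
      by (simp add: proj_def zero weight_def)
  next
    case False
    have "rot v = (\<lambda>_ _ _. 0)"
    proof (intro ext)
      fix i j k
      show "rot v i j k = 0"
      proof (cases "i + j + k = int L")
        case True
        have "rot v i j k = rot (proj L u) i j k - rot u i j k"
          unfolding rot_def using True by (simp add: v algebra_simps)
        then show ?thesis using less.prems(1) by (simp add: rot_proj)
      qed (simp add: rot_def v0)
    qed
    moreover have "del v = (\<lambda>_ _ _. 0)"
    proof (intro ext)
      fix i j k
      show "del v i j k = 0"
      proof (cases "i + j + k + 1 = int L")
        case T: True
        show ?thesis
        proof (cases "i < 0 \<or> j < 0 \<or> k < 0")
          \<comment> \<open>A shift can lead from an index -1 into the support, but there its factor
            \<open>i + 1\<close>, \<open>j + 1\<close> or \<open>k + 1\<close> is zero.\<close>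
          case True
          then show ?thesis
            unfolding del_def
            by (cases "i = -1"; cases "j = -1"; cases "k = -1") (auto simp: v0)
        next
          case nn: False
          obtain L' where L: "L = Suc L'" using False by (cases L) auto
          have "del v i j k = del (proj (Suc L') u) i j k - del u i j k"
            unfolding del_def using T by (simp add: v L algebra_simps)
          also have "\<dots> = proj L' (del u) i j k - del u i j k"
            by (simp add: del_proj)
          also have "proj L' (del u) i j k = del u i j k"
          proof (rule less.IH)
            show "rot (del u) = (\<lambda>_ _ _. 0)"
              by (intro ext) (simp add: rot_del less.prems(1), simp add: del_def)
            show "del u i j k = 0" if "(i, j, k) \<notin> triples L'" for i j k
            proof (cases "i + j + k = int L'")
              case True
              with that have "i < 0 \<or> j < 0 \<or> k < 0" by (auto simp: triples_def)
              then show ?thesis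
                unfolding del_def
                by (cases "i = -1"; cases "j = -1"; cases "k = -1") (auto simp: less.prems(2) triples_def)
            next
              case False
              then show ?thesis
                unfolding del_def using L by (subst less.prems(2), force simp: triples_def)+ simp
            qed
          qed (use L nn T in \<open>auto simp: triples_def\<close>)
          finally show ?thesis by simp
        qed
      qed (simp add: del_def v0)
    qed
    moreover have "lap v = (\<lambda>_ _ _. 0)"
    proof (intro ext)
      fix i j k
      \<comment> \<open>As for \<open>del\<close>: a double shift enters the support from -1 or -2,
        the two zeros of its factor.\<close>
      have neg: "lap u i j k = 0" if "i < 0 \<or> j < 0 \<or> k < 0"
        "\<And>i j k. i < 0 \<or> j < 0 \<or> k < 0 \<Longrightarrow> u i j k = 0" for u :: "int \<Rightarrow> int \<Rightarrow> int \<Rightarrow> complex" and i j k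
      proof -
        have "of_int (i + 1) * (of_int (i + 2) * u (i + 2) j k) = 0"
          using that(1) by (cases "i = -1 \<or> i = -2") (auto intro!: that(2))
        moreover have "of_int (j + 1) * (of_int (j + 2) * u i (j + 2) k) = 0"
          using that(1) by (cases "j = -1 \<or> j = -2") (auto intro!: that(2))
        moreover have "of_int (k + 1) * (of_int (k + 2) * u i j (k + 2)) = 0"
          using that(1) by (cases "k = -1 \<or> k = -2") (auto intro!: that(2))
        ultimately show ?thesis by (simp only: lap_def add_0)
      qed
      show "lap v i j k = 0"
      proof (cases "i + j + k + 2 = int L \<and> 0 \<le> i \<and> 0 \<le> j \<and> 0 \<le> k")
        case T: True
        then obtain L' where L: "L = Suc (Suc L')"
          by (metis nat_0_le nat_int of_nat_numeral add_2_eq_Suc' add_nonneg_nonneg int_ops(5) zero_le_numeral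
              nat_int_add)
        have "lap v i j k = lap (proj (Suc (Suc L')) u) i j k - lap u i j k"
          unfolding lap_def using T by (simp add: v L algebra_simps)
        also have "\<dots> = proj L' (lap u) i j k - lap u i j k"
          using T L by (subst lap_proj) auto
        also have "proj L' (lap u) i j k = lap u i j k"
        proof (rule less.IH)
          show "rot (lap u) = (\<lambda>_ _ _. 0)"
            by (intro ext) (simp add: rot_lap less.prems(1), simp add: lap_def)
          show "lap u i j k = 0" if "(i, j, k) \<notin> triples L'" for i j k
          proof (cases "i + j + k = int L'")
            case True
            with that have "i < 0 \<or> j < 0 \<or> k < 0" by (auto simp: triples_def)
            then show ?thesis
              by (rule neg) (auto intro!: less.prems(2) simp: triples_def)
          next
            case False
            then show ?thesis
              unfolding lap_def using L by (subst less.prems(2), force simp: triples_def)+ simp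
          qed
        qed (use L T in \<open>auto simp: triples_def\<close>)
        finally show ?thesis by simp
      next
        case F: False
        show ?thesis
        proof (cases "i < 0 \<or> j < 0 \<or> k < 0")
          case True
          then show ?thesis by (rule neg) (auto intro: v0)
        qed (use F in \<open>auto simp: lap_def v0\<close>)
      qed
    qed
    \<comment> \<open>With \<open>rot v\<close> zero, the formula for the square of
      \<open>rot\<close> leaves a nonzero multiple of the squared degree times
      \<open>v\<close>.\<close>
    ultimately have "rot (\<lambda>_ _ _. 0) i j k = - 3 * (of_int (i + j + k))\<^sup>2 * v i j k"
      using rot_rot_eq[of v i j k] by simp
    moreover have "i + j + k = int L"
      using less.prems(3) by (simp add: triples_def)
    ultimately show ?thesis
      using v[of i j k] False by (simp add: rot_def)
  qed
qed

end

section \<open>The projection onto rotation invariants\<close>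

definition level_inner :: "nat \<Rightarrow> (int \<Rightarrow> int \<Rightarrow> int \<Rightarrow> complex) \<Rightarrow> (int \<Rightarrow> int \<Rightarrow> int \<Rightarrow> complex) \<Rightarrow> complex" where
  "level_inner L F G = (\<Sum>(a, b, c)\<in>triples L. of_real (weight a b c) * F a b c * cnj (G a b c))"

definition level_sqnorm :: "nat \<Rightarrow> (int \<Rightarrow> int \<Rightarrow> int \<Rightarrow> complex) \<Rightarrow> real" where
  "level_sqnorm L F = (\<Sum>(a, b, c)\<in>triples L. weight a b c * (cmod (F a b c))\<^sup>2)"

lemma level_inner_self: "level_inner L F F = of_real (level_sqnorm L F)"
  by (simp add: level_inner_def level_sqnorm_def complex_norm_square mult.assoc split_def del: of_real_power)

lemma level_sqnorm_nonneg: "0 \<le> level_sqnorm L F"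
  unfolding level_sqnorm_def by (intro sum_nonneg) (auto simp: less_imp_le)

lemma level_sqnorm_eq_0:
  assumes "level_sqnorm L F = 0" "(i, j, k) \<in> triples L"
  shows "F i j k = 0"
proof -
  have "\<forall>x\<in>triples L. (case x of (a, b, c) \<Rightarrow> weight a b c * (cmod (F a b c))\<^sup>2) = 0"
    using assms(1) unfolding level_sqnorm_def
    by (subst (asm) sum_nonneg_eq_0_iff) (auto simp: less_imp_le)
  from bspec[OF this assms(2)] show ?thesis
    using weight_pos[of i j k] by auto
qed

lemma level_inner_cnj: "cnj (level_inner L F G) = level_inner L G F"
  by (simp add: level_inner_def split_def mult_ac)

lemma level_sqnorm_diff:
  "level_sqnorm L (\<lambda>a b c. F a b c - \<mu> * G a b c) =
     level_sqnorm L F - 2 * Re (cnj \<mu> * level_inner L F G) + (cmod \<mu>)\<^sup>2 * level_sqnorm L G"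
proof -
  have "complex_of_real (level_sqnorm L (\<lambda>a b c. F a b c - \<mu> * G a b c)) =
     level_inner L F F - (cnj \<mu> * level_inner L F G + \<mu> * level_inner L G F) + \<mu> * cnj \<mu> * level_inner L G G"
    unfolding level_inner_self[symmetric]
    by (simp add: level_inner_def split_def sum_subtractf[symmetric] sum.distrib[symmetric] sum_distrib_left
        algebra_simps)
  also have "cnj \<mu> * level_inner L F G + \<mu> * level_inner L G F = of_real (2 * Re (cnj \<mu> * level_inner L F G))"
    using complex_add_cnj[of "cnj \<mu> * level_inner L F G"] by (simp add: level_inner_cnj)
  finally show ?thesis
    by (simp only: level_inner_self complex_norm_square[symmetric] of_real_mult[symmetric] of_real_diff[symmetric]
        of_real_add[symmetric] of_real_eq_iff)
qed

text \<open>The inequality of arithmetic and geometric means in place of Cauchy-Schwarz: a bound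
  that is additive in the squared norms is summable over the levels at once.\<close>

lemma norm_level_inner_le:
  "2 * cmod (level_inner L F G) \<le> level_sqnorm L F + level_sqnorm L G"
proof -
  have "2 * cmod (level_inner L F G) \<le> 2 * (\<Sum>(a, b, c)\<in>triples L. weight a b c * (cmod (F a b c) * cmod (G a b c)))"
    unfolding level_inner_def
    by (intro mult_left_mono order.trans[OF norm_sum] sum_mono) (auto simp: norm_mult less_imp_le)
  also have "\<dots> = (\<Sum>(a, b, c)\<in>triples L. weight a b c * (2 * cmod (F a b c) * cmod (G a b c)))"
    by (simp add: sum_distrib_left split_def mult_ac)
  also have "\<dots> \<le> (\<Sum>(a, b, c)\<in>triples L. weight a b c * ((cmod (F a b c))\<^sup>2 + (cmod (G a b c))\<^sup>2))"
    by (intro sum_mono) (auto intro!: mult_left_mono simp: less_imp_le sum_squares_bound)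
  finally show ?thesis
    by (simp add: level_sqnorm_def split_def distrib_left sum.distrib)
qed

context rotation_kernel
begin

lemma proj_cong:
  "(\<And>a b c. (a, b, c) \<in> triples L \<Longrightarrow> u a b c = v a b c) \<Longrightarrow> proj L u i j k = proj L v i j k"
  unfolding proj_def by (intro sum.cong) auto

lemma level_inner_proj: "level_inner L (proj L F) G = level_inner L F (proj L G)"
proof -
  have "level_inner L (proj L F) G = (\<Sum>x\<in>triples L. \<Sum>y\<in>triples L. case x of (i, j, k) \<Rightarrow> case y of (a, b, c) \<Rightarrow>
     of_real (weight i j k) * of_real (weight a b c) * of_real (K i j k a b c) * F a b c * cnj (G i j k))"
    unfolding level_inner_def proj_def
    by (intro sum.cong) (auto simp: sum_distrib_left sum_distrib_right split_def mult_ac)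
  also have "\<dots> = (\<Sum>y\<in>triples L. \<Sum>x\<in>triples L. case x of (i, j, k) \<Rightarrow> case y of (a, b, c) \<Rightarrow>
     of_real (weight i j k) * of_real (weight a b c) * of_real (K i j k a b c) * F a b c * cnj (G i j k))"
    by (rule sum.swap)
  also have "\<dots> = level_inner L F (proj L G)"
    unfolding level_inner_def proj_def
    by (intro sum.cong) (auto simp: sum_distrib_left sum_distrib_right split_def mult_ac sym intro!: sum.cong)
  finally show ?thesis .
qed

text \<open>Both operators respect the degree here, so \<open>u\<close> may be truncated to level
  \<open>L\<close> and its other levels need not be invariant.\<close>

lemma proj_rotation_invariant':
  assumes rot: "\<And>i j k. i + j + k = int L \<Longrightarrow> rot u i j k = 0"
    and neg: "\<And>i j k. i < 0 \<or> j < 0 \<or> k < 0 \<Longrightarrow> u i j k = 0"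
    and T: "(i, j, k) \<in> triples L"
  shows "proj L u i j k = u i j k"
proof -
  define v where "v i j k = (if i + j + k = int L then u i j k else 0)" for i j k
  have uv: "u i j k = v i j k" if "(i, j, k) \<in> triples L" for i j k
    using that by (auto simp: v_def triples_def)
  have "proj L v i j k = v i j k"
  proof (rule proj_rotation_invariant)
    show "rot v = (\<lambda>_ _ _. 0)"
    proof (intro ext)
      fix i j k show "rot v i j k = 0"
        using rot[of i j k] by (cases "i + j + k = int L") (simp_all add: rot_def v_def)
    qed
    show "v i j k = 0" if "(i, j, k) \<notin> triples L" for i j k
      using that neg[of i j k] by (auto simp: v_def triples_def not_le)
  qed (rule T)
  with uv[OF T] show ?thesis
    using proj_cong[OF uv, of L] by simp
qed

lemma proj_proj: "(i, j, k) \<in> triples L \<Longrightarrow> proj L (proj L u) i j k = proj L u i j k"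
  by (rule proj_rotation_invariant') (simp_all add: rot_proj proj_neg)

lemma level_inner_proj_proj: "level_inner L (proj L F) (proj L G) = level_inner L F (proj L G)"
  unfolding level_inner_proj
  by (auto simp: level_inner_def proj_proj intro!: sum.cong)

lemma level_inner_proj_self: "level_inner L (proj L F) F = of_real (level_sqnorm L (proj L F))"
  by (simp add: level_inner_proj level_inner_proj_proj[symmetric] level_inner_self)

text \<open>Pythagoras: the squared distance from \<open>F\<close> to its projection is the
  difference of the two sides.\<close>

lemma level_sqnorm_proj_le: "level_sqnorm L (proj L F) \<le> level_sqnorm L F"
proof -
  have "level_inner L F (proj L F) = of_real (level_sqnorm L (proj L F))"
    by (simp add: level_inner_proj[symmetric] level_inner_proj_self)
  then show ?thesis
    using level_sqnorm_diff[of L F 1 "proj L F"] level_sqnorm_nonneg[of L "\<lambda>a b c. F a b c - 1 * proj L F a b c"]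
    by simp
qed

lemma norm_level_inner_proj_le:
  "cmod (level_inner L (proj L F) G) \<le> level_sqnorm L F + level_sqnorm L G"
  using norm_level_inner_le[of L "proj L F" G] level_sqnorm_proj_le[of L F]
    level_sqnorm_nonneg[of L F] level_sqnorm_nonneg[of L G]
  by linarith

definition pairing :: "(int \<Rightarrow> int \<Rightarrow> int \<Rightarrow> complex) \<Rightarrow> (int \<Rightarrow> int \<Rightarrow> int \<Rightarrow> complex) \<Rightarrow> complex" where
  "pairing F G = (\<Sum>L. level_inner L (proj L F) G)"

text \<open>As \<open>proj L\<close> is an orthogonal projection, \<open>pairing F G\<close> is the inner product of \<open>F\<close> and the
  projection of \<open>G\<close>. Expanding the squared distance of \<open>F\<close> to multiples of that projection yields
  the Cauchy--Schwarz bound together with its defect.\<close>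

context
  fixes F G :: "int \<Rightarrow> int \<Rightarrow> int \<Rightarrow> complex" and A D :: real
  assumes F: "(\<lambda>L. level_sqnorm L F) sums A" and G: "(\<lambda>L. level_sqnorm L G) sums D"
begin

lemma pairing_sums: "(\<lambda>L. level_inner L (proj L F) G) sums pairing F G"
  unfolding pairing_def
  by (intro summable_sums summable_comparison_test'[OF summable_add[OF sums_summable[OF F] sums_summable[OF G]]]
      norm_level_inner_proj_le)

lemma pairing_diff_sums:
  "(\<lambda>L. level_sqnorm L (\<lambda>a b c. F a b c - \<mu> * proj L G a b c)
      + (cmod \<mu>)\<^sup>2 * (level_sqnorm L G - level_sqnorm L (proj L G)))
     sums (A - 2 * Re (cnj \<mu> * pairing F G) + (cmod \<mu>)\<^sup>2 * D)"
proof -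
  have "(\<lambda>L. level_sqnorm L F - 2 * Re (cnj \<mu> * level_inner L (proj L F) G) + (cmod \<mu>)\<^sup>2 * level_sqnorm L G)
     sums (A - 2 * Re (cnj \<mu> * pairing F G) + (cmod \<mu>)\<^sup>2 * D)"
    by (intro sums_add sums_diff sums_mult sums_Re F G pairing_sums)
  then show ?thesis
    by (simp add: level_sqnorm_diff level_inner_proj algebra_simps)
qed

lemma pairing_diff_nonneg:
  "0 \<le> level_sqnorm L (\<lambda>a b c. F a b c - \<mu> * proj L G a b c)
      + (cmod \<mu>)\<^sup>2 * (level_sqnorm L G - level_sqnorm L (proj L G))"
  using level_sqnorm_nonneg level_sqnorm_proj_le by (intro add_nonneg_nonneg mult_nonneg_nonneg) auto

text \<open>This \<open>\<mu>\<close> minimises the quadratic expression on the left, as in the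
  usual proof of Cauchy-Schwarz.\<close>

lemma pairing_coefficient:
  assumes "0 < D" and \<mu>: "\<mu> = pairing F G / of_real D"
  shows "A - 2 * Re (cnj \<mu> * pairing F G) + (cmod \<mu>)\<^sup>2 * D = A - (cmod (pairing F G))\<^sup>2 / D"
proof -
  have "Re (cnj \<mu> * pairing F G) = (cmod (pairing F G))\<^sup>2 / D"
    unfolding \<mu> cmod_power2 by (simp add: power2_eq_square add_divide_distrib)
  then show ?thesis
    unfolding \<mu> using assms(1) by (simp add: norm_divide power_divide power2_eq_square)
qed

lemma norm_pairing_le: "(cmod (pairing F G))\<^sup>2 \<le> A * D"
proof (cases "0 < D")
  case True
  have "0 \<le> A - (cmod (pairing F G))\<^sup>2 / D"
    by (rule sums_le[OF pairing_diff_nonneg sums_zero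
          pairing_diff_sums[of "pairing F G / of_real D", unfolded pairing_coefficient[OF True refl]]])
  with True show ?thesis by (simp add: field_simps)
next
  case False
  have "0 \<le> D" using sums_le[OF _ sums_zero G] level_sqnorm_nonneg by simp
  with False G have "(\<lambda>L. level_sqnorm L G) sums 0" by simp
  then have "level_sqnorm L G = 0" for L
    using suminf_eq_zero_iff[of "\<lambda>L. level_sqnorm L G"] level_sqnorm_nonneg
    by (auto simp: sums_iff)
  then have "level_inner L (proj L F) G = 0" for L
    by (auto simp: level_inner_def level_sqnorm_eq_0[of L G] intro!: sum.neutral)
  then show ?thesis
    using \<open>0 \<le> D\<close> False by (simp add: pairing_def)
qed

text \<open>Equality makes the series of \<open>pairing_diff_sums\<close> sum to zero. Its terms are
  nonnegative, so each vanishes, and with it the distance from \<open>F\<close> to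
  \<open>\<mu>\<close> times the projection of \<open>G\<close>.\<close>

lemma pairing_extremal:
  assumes "(cmod (pairing F G))\<^sup>2 = A * D" "0 < D"
  obtains \<mu> where "\<And>L i j k. (i, j, k) \<in> triples L \<Longrightarrow> F i j k = \<mu> * proj L G i j k"
proof -
  define \<mu> where "\<mu> = pairing F G / of_real D"
  let ?f = "\<lambda>L. level_sqnorm L (\<lambda>a b c. F a b c - \<mu> * proj L G a b c)
      + (cmod \<mu>)\<^sup>2 * (level_sqnorm L G - level_sqnorm L (proj L G))"
  have "?f sums 0"
    using pairing_diff_sums[of \<mu>] pairing_coefficient[OF assms(2) \<mu>_def] assms by simp
  then have f: "?f L = 0" for L
    using suminf_eq_zero_iff[of ?f] pairing_diff_nonneg by (auto simp: sums_iff)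
  have nonneg: "0 \<le> (cmod \<mu>)\<^sup>2 * (level_sqnorm L G - level_sqnorm L (proj L G))" for L
    using level_sqnorm_proj_le by (intro mult_nonneg_nonneg) auto
  have "level_sqnorm L (\<lambda>a b c. F a b c - \<mu> * proj L G a b c) = 0" for L
    using f[of L] nonneg[of L] level_sqnorm_nonneg[of L "\<lambda>a b c. F a b c - \<mu> * proj L G a b c"] by linarith
  then have "F i j k = \<mu> * proj L G i j k" if "(i, j, k) \<in> triples L" for L i j k
    using level_sqnorm_eq_0[OF _ that, of "\<lambda>a b c. F a b c - \<mu> * proj L G a b c"] by simp
  then show ?thesis by (rule that)
qed

end

lemma pairing_self:
  assumes "(\<lambda>L. level_sqnorm L F) sums A"
  shows "pairing F F \<in> \<real>" "0 \<le> Re (pairing F F)"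
proof -
  have "summable (\<lambda>L. level_sqnorm L (proj L F))"
    by (rule summable_comparison_test'[OF sums_summable[OF assms]])
      (simp add: level_sqnorm_nonneg level_sqnorm_proj_le)
  then have "pairing F F = of_real (\<Sum>L. level_sqnorm L (proj L F))"
    by (simp add: pairing_def level_inner_proj_self suminf_of_real)
  moreover from \<open>summable _\<close> have "0 \<le> (\<Sum>L. level_sqnorm L (proj L F))"
    by (intro suminf_nonneg level_sqnorm_nonneg)
  ultimately show "pairing F F \<in> \<real>" "0 \<le> Re (pairing F F)" by simp_all
qed

lemma pairing_rotation_invariant:
  assumes "\<And>i j k. rot F i j k = 0" "\<And>i j k. i < 0 \<or> j < 0 \<or> k < 0 \<Longrightarrow> F i j k = 0"
    and "(\<lambda>L. level_sqnorm L F) sums A"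
  shows "pairing F (\<lambda>i j k. \<mu> * F i j k) = cnj \<mu> * of_real A"
proof -
  have "level_inner L (proj L F) (\<lambda>i j k. \<mu> * F i j k) = cnj \<mu> * of_real (level_sqnorm L F)" for L
  proof -
    have "level_inner L (proj L F) (\<lambda>i j k. \<mu> * F i j k) = level_inner L F (\<lambda>i j k. \<mu> * F i j k)"
      unfolding level_inner_def using assms(1,2)
      by (intro sum.cong) (auto simp: proj_rotation_invariant')
    also have "\<dots> = cnj \<mu> * level_inner L F F"
      by (simp add: level_inner_def sum_distrib_left split_def mult_ac)
    finally show ?thesis by (simp add: level_inner_self)
  qed
  moreover have "(\<lambda>L. cnj \<mu> * complex_of_real (level_sqnorm L F)) sums (cnj \<mu> * of_real A)"
    by (intro sums_mult sums_of_real assms)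
  ultimately show ?thesis
    by (simp add: pairing_def sums_iff)
qed

end

section \<open>Hermite functions\<close>

text \<open>A class closed under sums and products whose members are integrable and vanish at
  infinity. Continuity supplies measurability, and the decay removes the boundary terms from every
  integration by parts.\<close>

definition gauss_bounded :: "(real \<Rightarrow> 'a::real_normed_vector) \<Rightarrow> bool" where
  "gauss_bounded F \<longleftrightarrow> continuous_on UNIV F \<and> (\<exists>C a. 0 < a \<and> (\<forall>x. norm (F x) \<le> C * exp (- a * x\<^sup>2)))"

lemma exp_sq_conv_normal_density:
  assumes "0 < a"
  shows "exp (- a * x\<^sup>2) = sqrt (pi / a) * normal_density 0 (1 / sqrt (2 * a)) x"
  using assms by (simp add: normal_density_def real_sqrt_divide real_sqrt_mult power_divide field_simps)

lemma integrable_exp_sq: "0 < a \<Longrightarrow> integrable lborel (\<lambda>x::real. exp (- a * x\<^sup>2))"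
  unfolding exp_sq_conv_normal_density
  using integrable_normal_moment[of 0 "1 / sqrt (2 * a)" 0] by simp

lemma integral_exp_sq: "0 < a \<Longrightarrow> (LBINT x. exp (- a * (x::real)\<^sup>2)) = sqrt (pi / a)"
  unfolding exp_sq_conv_normal_density by simp

lemma gauss_bounded_integrable:
  fixes F :: "real \<Rightarrow> 'a::{banach, second_countable_topology}"
  assumes "gauss_bounded F" shows "integrable lborel F"
proof -
  obtain C a where "0 < a" "\<And>x. norm (F x) \<le> C * exp (- a * x\<^sup>2)" "continuous_on UNIV F"
    using assms by (auto simp: gauss_bounded_def)
  then show ?thesis
    by (intro Bochner_Integration.integrable_bound[where f = "\<lambda>x. C * exp (- a * x\<^sup>2)" and g = F]
          integrable_mult_right integrable_exp_sq)
      (auto intro: borel_measurable_continuous_onI order.trans[OF _ abs_ge_self])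
qed

lemma gauss_bounded_tendsto_0:
  assumes "gauss_bounded F"
  shows "(F \<longlongrightarrow> 0) at_top" "(F \<longlongrightarrow> 0) at_bot"
proof -
  obtain C a where a: "0 < a" and F: "\<And>x. norm (F x) \<le> C * exp (- a * x\<^sup>2)"
    using assms by (auto simp: gauss_bounded_def)
  have 1: "LIM x at_top. a * x\<^sup>2 :> at_top" and 2: "LIM x at_bot. a * x\<^sup>2 :> at_top"
    using a by (intro filterlim_tendsto_pos_mult_at_top[OF tendsto_const] filterlim_pow_at_top filterlim_ident
      filterlim_pow_at_bot_even; simp)+
  have "((\<lambda>x. C * exp (- (a * x\<^sup>2))) \<longlongrightarrow> C * 0) at_top" "((\<lambda>x. C * exp (- (a * x\<^sup>2))) \<longlongrightarrow> C * 0) at_bot"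
    by (intro tendsto_mult tendsto_const filterlim_compose[OF exp_at_bot]
        filterlim_compose[OF filterlim_uminus_at_bot_at_top] 1 2)+
  then show "(F \<longlongrightarrow> 0) at_top" "(F \<longlongrightarrow> 0) at_bot"
    using F by (auto intro!: Lim_null_comparison[where f = F and g = "\<lambda>x. C * exp (- (a * x\<^sup>2))"])
qed

lemma gauss_bounded_mult:
  fixes F G :: "real \<Rightarrow> 'a::real_normed_algebra"
  assumes "gauss_bounded F" "gauss_bounded G" shows "gauss_bounded (\<lambda>x. F x * G x)"
proof -
  obtain C a where a: "0 < a" and F: "\<And>x. norm (F x) \<le> C * exp (- a * x\<^sup>2)" "continuous_on UNIV F"
    using assms(1) by (auto simp: gauss_bounded_def)
  obtain D b where b: "0 < b" and G: "\<And>x. norm (G x) \<le> D * exp (- b * x\<^sup>2)" "continuous_on UNIV G"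
    using assms(2) by (auto simp: gauss_bounded_def)
  have "norm (F x * G x) \<le> (C * D) * exp (- (a + b) * x\<^sup>2)" for x
  proof -
    have "norm (F x * G x) \<le> (C * exp (- a * x\<^sup>2)) * (D * exp (- b * x\<^sup>2))"
      by (rule order.trans[OF norm_mult_ineq mult_mono'])  (use F G in auto)
    also have "\<dots> = (C * D) * exp (- (a + b) * x\<^sup>2)"
      by (simp add: algebra_simps exp_add[symmetric])
    finally show ?thesis .
  qed
  moreover have "0 < a + b" using a b by simp
  moreover have "continuous_on UNIV (\<lambda>x. F x * G x)" by (intro continuous_intros F G)
  ultimately show ?thesis unfolding gauss_bounded_def by blast
qed

lemma gauss_bounded_add:
  assumes "gauss_bounded F" "gauss_bounded G" shows "gauss_bounded (\<lambda>x. F x + G x)"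
proof -
  obtain C a where a: "0 < a" and F: "\<And>x. norm (F x) \<le> C * exp (- a * x\<^sup>2)" "continuous_on UNIV F"
    using assms(1) by (auto simp: gauss_bounded_def)
  obtain D b where b: "0 < b" and G: "\<And>x. norm (G x) \<le> D * exp (- b * x\<^sup>2)" "continuous_on UNIV G"
    using assms(2) by (auto simp: gauss_bounded_def)
  have 0: "0 \<le> C" "0 \<le> D"
    using order.trans[OF norm_ge_zero F(1)[of 0]] order.trans[OF norm_ge_zero G(1)[of 0]] by auto
  have "norm (F x + G x) \<le> (C + D) * exp (- (min a b) * x\<^sup>2)" for x
  proof -
    have "norm (F x + G x) \<le> C * exp (- a * x\<^sup>2) + D * exp (- b * x\<^sup>2)"
      using F(1)[of x] G(1)[of x] norm_triangle_ineq[of "F x" "G x"] by linarith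
    also have "\<dots> \<le> C * exp (- (min a b) * x\<^sup>2) + D * exp (- (min a b) * x\<^sup>2)"
      using 0 by (intro add_mono mult_left_mono) (auto intro!: mult_right_mono)
    finally show ?thesis by (simp add: distrib_right)
  qed
  moreover have "0 < min a b" using a b by simp
  moreover have "continuous_on UNIV (\<lambda>x. F x + G x)" by (intro continuous_intros F G)
  ultimately show ?thesis unfolding gauss_bounded_def by blast
qed

lemma gauss_bounded_cmult:
  fixes F :: "real \<Rightarrow> 'a::real_normed_algebra"
  assumes "gauss_bounded F" shows "gauss_bounded (\<lambda>x. c * F x)"
proof -
  obtain C a where a: "0 < a" and F: "\<And>x. norm (F x) \<le> C * exp (- a * x\<^sup>2)" "continuous_on UNIV F"
    using assms(1) by (auto simp: gauss_bounded_def)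
  have "norm (c * F x) \<le> (norm c * C) * exp (- a * x\<^sup>2)" for x
    using mult_left_mono[OF F(1)[of x] norm_ge_zero[of c]] norm_mult_ineq[of c "F x"] by (simp add: mult.assoc)
  moreover have "continuous_on UNIV (\<lambda>x. c * F x)" by (intro continuous_intros F)
  ultimately show ?thesis using a unfolding gauss_bounded_def by blast
qed

lemma gauss_bounded_of_real:
  "gauss_bounded F \<Longrightarrow> gauss_bounded (\<lambda>x. of_real (F x) :: 'a::real_normed_algebra_1)"
  unfolding gauss_bounded_def by (auto intro: continuous_on_of_real)

text \<open>Each factor x is absorbed by half of the exponent and the remaining polynomial by the
  other half, hence the induction over arbitrary \<open>e\<close>.\<close>

lemma poly_le_exp_sq:
  fixes p :: "real poly"
  assumes "0 < e" shows "\<exists>C\<ge>0. \<forall>x. \<bar>poly p x\<bar> \<le> C * exp (e * x\<^sup>2)"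
  using assms
proof (induction p arbitrary: e)
  case 0
  show ?case by (intro exI[of _ 0]) simp
next
  case (pCons c p)
  obtain C where C: "0 \<le> C" "\<And>x. \<bar>poly p x\<bar> \<le> C * exp (e / 2 * x\<^sup>2)"
    using pCons.IH[of "e / 2"] pCons.prems by auto
  have x: "\<bar>x\<bar> \<le> (1 + 2 / e) * exp (e / 2 * x\<^sup>2)" for x
  proof -
    have "\<bar>x\<bar> \<le> 1 + x\<^sup>2"
      using sum_squares_bound[of 1 "\<bar>x\<bar>"] by simp
    also have "\<dots> \<le> (1 + 2 / e) * (1 + e / 2 * x\<^sup>2)"
      using pCons.prems by (simp add: field_simps)
    also have "\<dots> \<le> (1 + 2 / e) * exp (e / 2 * x\<^sup>2)"
      using pCons.prems by (intro mult_left_mono) auto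
    finally show ?thesis .
  qed
  have "\<bar>poly (pCons c p) x\<bar> \<le> (\<bar>c\<bar> + (1 + 2 / e) * C) * exp (e * x\<^sup>2)" for x
  proof -
    have "\<bar>poly (pCons c p) x\<bar> \<le> \<bar>c\<bar> + \<bar>x\<bar> * \<bar>poly p x\<bar>"
      using abs_triangle_ineq[of c "x * poly p x"] by (simp add: abs_mult)
    also have "\<dots> \<le> \<bar>c\<bar> * exp (e * x\<^sup>2) + ((1 + 2 / e) * exp (e / 2 * x\<^sup>2)) * (C * exp (e / 2 * x\<^sup>2))"
      using pCons.prems C
      by (intro add_mono mult_mono x) (auto intro!: mult_left_le[of _ _, simplified] simp: mult_le_cancel_left1)
    also have "\<dots> = (\<bar>c\<bar> + (1 + 2 / e) * C) * exp (e * x\<^sup>2)"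
      by (simp add: algebra_simps exp_add[symmetric])
    finally show ?thesis .
  qed
  then show ?case
    using C pCons.prems by (intro exI[of _ "\<bar>c\<bar> + (1 + 2 / e) * C"]) auto
qed

lemma gauss_bounded_poly_exp:
  assumes "0 < a" shows "gauss_bounded (\<lambda>x. poly p x * exp (- a * x\<^sup>2))"
proof -
  obtain C where C: "\<And>x. \<bar>poly p x\<bar> \<le> C * exp (a / 2 * x\<^sup>2)"
    using poly_le_exp_sq[of "a / 2" p] assms by auto
  have "norm (poly p x * exp (- a * x\<^sup>2)) \<le> C * exp (- (a / 2) * x\<^sup>2)" for x
  proof -
    have "norm (poly p x * exp (- a * x\<^sup>2)) \<le> C * exp (a / 2 * x\<^sup>2) * exp (- a * x\<^sup>2)"
      using C[of x] by (simp add: abs_mult)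
    also have "\<dots> = C * exp (- (a / 2) * x\<^sup>2)"
      by (simp add: exp_add[symmetric] algebra_simps)
    finally show ?thesis .
  qed
  moreover have "continuous_on UNIV (\<lambda>x. poly p x * exp (- a * x\<^sup>2))" by (intro continuous_intros)
  ultimately show ?thesis
    using assms unfolding gauss_bounded_def by (metis half_gt_zero)
qed

text \<open>The source of all recurrences between integrals: those for
  \<open>integral_psi_psi\<close>, \<open>hkernel_rec\<close> and \<open>fock_gaussian\<close> come
  from applying it to a suitable product.\<close>

lemma integral_derivative_eq_0:
  fixes F :: "real \<Rightarrow> 'a::euclidean_space"
  assumes "gauss_bounded F" "gauss_bounded F'" "\<And>x. (F has_vector_derivative F' x) (at x)"
  shows "(LBINT x. F' x) = 0"
proof -
  have "(LBINT x=-\<infinity>..\<infinity>. F' x) = 0 - 0"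
  proof (rule interval_integral_FTC_integrable)
    show "set_integrable lborel (einterval (- \<infinity>) \<infinity>) F'"
      using gauss_bounded_integrable[OF assms(2)] by (simp add: set_integrable_def)
    show "isCont F' x" for x
      using assms(2) by (auto simp: gauss_bounded_def continuous_on_eq_continuous_at)
    show "((F \<circ> real_of_ereal) \<longlongrightarrow> 0) (at_right (-\<infinity>))" "((F \<circ> real_of_ereal) \<longlongrightarrow> 0) (at_left \<infinity>)"
      by (simp_all add: ereal_tendsto_simps gauss_bounded_tendsto_0[OF assms(1)])
  qed (use assms in auto)
  then show ?thesis
    by (simp add: interval_lebesgue_integral_def set_lebesgue_integral_def)
qed

text \<open>The functions \<open>psi n\<close>, with \<open>\<phi>\<^sub>n = sqrt (n!) psi n\<close>, are the coefficients of the generating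
  function \<open>\<Sum> psi n a^n = pi powr (- 1 / 4) * exp (- x\<^sup>2 / 2 + sqrt 2 a x - a\<^sup>2 / 2)\<close>. Setting them to zero for
  negative index makes the ladder relations hold for all integers.\<close>

definition psi :: "int \<Rightarrow> real \<Rightarrow> real" where
  "psi n x = (if n < 0 then 0
     else poly (hermite_poly (nat n)) x * exp (- (1 / 2) * x\<^sup>2) / (sqrt (sqrt pi) * sqrt 2 ^ nat n * fact (nat n)))"

lemma psi_nat:
  "psi (int n) x = poly (hermite_poly n) x * exp (- (1 / 2) * x\<^sup>2) / (sqrt (sqrt pi) * sqrt 2 ^ n * fact n)"
  by (simp add: psi_def)

lemma hermite_fun_psi: "hermite_fun n x = of_real (sqrt (fact n) * psi (int n) x)"
proof -
  have "sqrt (fact n) * sqrt (fact n) = (fact n :: real)" by simp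
  then have "poly (hermite_poly n) x * exp (- x\<^sup>2 / 2) / sqrt (2 ^ n * fact n * sqrt pi) = sqrt (fact n) * psi (int
      n) x"
    by (simp add: psi_nat real_sqrt_mult real_sqrt_power field_simps)
  then show ?thesis
    by (simp only: hermite_fun_def)
qed

lemma pderiv_hermite_poly: "pderiv (hermite_poly (Suc n)) = smult (2 * real (Suc n)) (hermite_poly n)"
proof -
  have "pderiv (hermite_poly (Suc n)) =
      smult 2 (hermite_poly n) + [:0, 2:] * pderiv (hermite_poly n) - pderiv (pderiv (hermite_poly n))"
    by (simp add: pderiv_diff pderiv_mult pderiv_pCons del: mult_pCons_left)
  also have "\<dots> = smult 2 (hermite_poly n) + smult (2 * real n) (hermite_poly n)"
    unfolding hermite_poly_ode by (simp del: mult_pCons_left)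
  also have "\<dots> = smult (2 * real (Suc n)) (hermite_poly n)"
    by (simp only: smult_add_left[symmetric]) simp
  finally show ?thesis .
qed

lemma psi_neg: "n < 0 \<Longrightarrow> psi n x = 0"
  by (simp add: psi_def)

lemma psi_0: "psi 0 x = exp (- (1 / 2) * x\<^sup>2) / sqrt (sqrt pi)"
  by (simp add: psi_def)

lemma psi_rec: "of_int (n + 1) * psi (n + 1) x = sqrt 2 * x * psi n x - psi (n - 1) x"
proof -
  consider "n < -1" | "n = -1" | m where "n = int m"
    by (metis linorder_cases zle_iff_zadd int_zle_neg add.commute add.left_neutral not_less zless_add1_eq
        add.right_inverse le_less nonneg_int_cases)
  then show ?thesis
  proof cases
    case 3
    have s: "sqrt 2 * (sqrt 2 * y) = 2 * y" for y :: real
      by (simp add: mult.assoc[symmetric])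
    show ?thesis
    proof (cases m)
      case 0
      then show ?thesis using 3 s by (simp add: psi_def field_simps)
    next
      case (Suc k)
      have m: "n + 1 = int (Suc (Suc k))" "n - 1 = int k" "n = int (Suc k)" using 3 Suc by auto
      have p: "poly (hermite_poly (Suc (Suc k))) x =
          2 * x * poly (hermite_poly (Suc k)) x - 2 * real (Suc k) * poly (hermite_poly k) x"
        by (subst hermite_poly.simps) (simp only: pderiv_hermite_poly, simp)
      show ?thesis
        unfolding m(1,2) psi_nat p by (simp add: m(3) psi_nat field_simps s del: of_nat_Suc hermite_poly.simps)
    qed
  qed (simp_all add: psi_neg)
qed

lemma psi_has_derivative: "(psi n has_real_derivative sqrt 2 * psi (n - 1) x - x * psi n x) (at x)"
proof (cases "n < 0")
  case True
  then have "psi n = (\<lambda>_. 0)" by (intro ext) (simp add: psi_neg)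
  with True show ?thesis by (simp add: psi_neg)
next
  case False
  then obtain m where n: "n = int m" by (metis nonneg_int_cases not_less)
  have "psi n = (\<lambda>x. poly (hermite_poly m) x * exp (- (1 / 2) * x\<^sup>2) / (sqrt (sqrt pi) * sqrt 2 ^ m * fact m))"
    by (intro ext) (simp add: n psi_nat)
  moreover have "(\<dots> has_real_derivative (poly (pderiv (hermite_poly m)) x - x * poly (hermite_poly m) x)
      * exp (- (1 / 2) * x\<^sup>2) / (sqrt (sqrt pi) * sqrt 2 ^ m * fact m)) (at x)"
    unfolding divide_inverse[of _ "_ * _"]
    by (rule derivative_eq_intros poly_DERIV refl | simp add: algebra_simps)+
  moreover have "(poly (pderiv (hermite_poly m)) x - x * poly (hermite_poly m) x)
      * exp (- (1 / 2) * x\<^sup>2) / (sqrt (sqrt pi) * sqrt 2 ^ m * fact m) = sqrt 2 * psi (n - 1) x - x * psi n x"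
  proof (cases m)
    case 0
    then show ?thesis by (simp add: n psi_def pderiv_1)
  next
    case (Suc k)
    have s: "sqrt 2 * (sqrt 2 * y) = 2 * y" for y :: real
      by (simp add: mult.assoc[symmetric])
    have m: "n - 1 = int k" "n = int (Suc k)" using n Suc by auto
    show ?thesis
      unfolding m(1) psi_nat Suc pderiv_hermite_poly by (simp add: m(2) psi_nat field_simps s del: of_nat_Suc
          hermite_poly.simps)
  qed
  ultimately show ?thesis by simp
qed

lemma gauss_bounded_psi: "gauss_bounded (psi n)"
proof (cases "n < 0")
  case True
  then have "psi n = (\<lambda>_. 0)" by (intro ext) (simp add: psi_neg)
  then show ?thesis by (auto simp: gauss_bounded_def intro!: exI[of _ 0] exI[of _ 1])
next
  case False
  then have "psi n = (\<lambda>x. 1 / (sqrt (sqrt pi) * sqrt 2 ^ nat n * fact (nat n))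
     * (poly (hermite_poly (nat n)) x * exp (- (1 / 2) * x\<^sup>2)))"
    by (intro ext) (simp add: psi_def)
  then show ?thesis
    by (simp only:) (intro gauss_bounded_cmult gauss_bounded_poly_exp, simp)
qed

lemma gauss_bounded_x_psi: "gauss_bounded (\<lambda>x. x * psi n x)"
proof -
  have "(\<lambda>x. x * psi n x) = (\<lambda>x. 1 / sqrt 2 * (of_int (n + 1) * psi (n + 1) x + psi (n - 1) x))"
    unfolding psi_rec by simp
  then show ?thesis
    by (simp only:) (intro gauss_bounded_cmult gauss_bounded_add gauss_bounded_psi)
qed

text \<open>Integrating the derivative of \<open>psi (n - 1) x * psi m x\<close> and eliminating the
  factor x by \<open>psi_rec\<close> lowers both indices at once. Together with symmetry and the
  vanishing at negative indices this determines all values from the one at the origin.\<close>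

lemma integral_psi_psi:
  "(LBINT x. psi n x * psi m x) = (if n = m \<and> 0 \<le> n then 1 / fact (nat n) else 0)"
proof -
  define g where "g n m = (LBINT x. psi n x * psi m x)" for n m
  have int: "integrable lborel (\<lambda>x. psi n x * psi m x)" for n m
    by (intro gauss_bounded_integrable gauss_bounded_mult gauss_bounded_psi)
  have intx: "integrable lborel (\<lambda>x. x * psi n x * psi m x)" for n m
    by (intro gauss_bounded_integrable gauss_bounded_mult[OF gauss_bounded_x_psi] gauss_bounded_psi)
  have rec: "of_int n * g n m = g (n - 1) (m - 1)" for n m
  proof -
    define h where "h = (LBINT x. x * psi (n - 1) x * psi m x)"
    have "(LBINT x. sqrt 2 * (psi (n - 2) x * psi m x) + sqrt 2 * (psi (n - 1) x * psi (m - 1) x) - 2 * (x * psi (n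
        - 1) x * psi m x)) = 0"
    proof (rule integral_derivative_eq_0)
      show "gauss_bounded (\<lambda>x. psi (n - 1) x * psi m x)"
        by (intro gauss_bounded_mult gauss_bounded_psi)
      show "gauss_bounded (\<lambda>x. sqrt 2 * (psi (n - 2) x * psi m x) + sqrt 2 * (psi (n - 1) x * psi (m - 1) x) - 2 *
          (x * psi (n - 1) x * psi m x))"
        unfolding diff_conv_add_uminus mult_minus_left[symmetric]
        by (intro gauss_bounded_add gauss_bounded_cmult gauss_bounded_mult gauss_bounded_psi gauss_bounded_x_psi)
      show "((\<lambda>x. psi (n - 1) x * psi m x) has_vector_derivative
         (sqrt 2 * (psi (n - 2) x * psi m x) + sqrt 2 * (psi (n - 1) x * psi (m - 1) x) - 2 * (x * psi (n - 1) x *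
             psi m x))) (at x)" for x
        unfolding has_real_derivative_iff_has_vector_derivative[symmetric]
        by (rule derivative_eq_intros psi_has_derivative refl)+ (simp add: algebra_simps)
    qed
    then have 1: "sqrt 2 * g (n - 2) m + sqrt 2 * g (n - 1) (m - 1) = 2 * h"
      unfolding g_def h_def by (simp add: int intx)
    have "of_int n * g n m = (LBINT x. sqrt 2 * (x * psi (n - 1) x * psi m x) - psi (n - 2) x * psi m x)"
      unfolding g_def Bochner_Integration.integral_mult_right_zero[symmetric]
      using psi_rec[of "n - 1"] by (intro Bochner_Integration.integral_cong) (auto simp: mult.assoc[symmetric]
          left_diff_distrib)
    also have "\<dots> = sqrt 2 * h - g (n - 2) m"
      unfolding g_def h_def by (simp add: int intx)
    finally have "sqrt 2 * (of_int n * g n m) = 2 * h - sqrt 2 * g (n - 2) m"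
      by (simp add: right_diff_distrib mult.assoc[symmetric])
    with 1 have "sqrt 2 * (of_int n * g n m) = sqrt 2 * g (n - 1) (m - 1)"
      by simp
    then show ?thesis by simp
  qed
  have neg: "g n m = 0" if "n < 0 \<or> m < 0" for n m
    using that by (auto simp: g_def psi_neg)
  have sym: "g n m = g m n" for n m
    by (simp add: g_def mult.commute)
  have "g (int k) m = (if int k = m then 1 / fact k else 0)" for k m
  proof (induction k arbitrary: m)
    case 0
    have "g 0 0 = 1"
    proof -
      have "g 0 0 = (LBINT x. 1 / sqrt pi * exp (- 1 * x\<^sup>2))"
        unfolding g_def by (intro Bochner_Integration.integral_cong refl) (simp add: psi_0 exp_add[symmetric])
      also have "\<dots> = 1" by (simp only: integral_mult_right_zero integral_exp_sq) simp
      finally show ?thesis .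
    qed
    moreover have "g 0 m = 0" if "m \<noteq> 0"
      using rec[of m 0] that neg[of "m - 1" "-1"] by (simp add: sym[of 0])
    ultimately show ?case by auto
  next
    case (Suc k)
    have "real (Suc k) * g (int (Suc k)) m = (if int (Suc k) = m then 1 / fact k else 0)"
      using rec[of "int (Suc k)" m] Suc.IH[of "m - 1"] by auto
    then have "g (int (Suc k)) m = (if int (Suc k) = m then 1 / fact k else 0) / real (Suc k)"
      by (metis nonzero_mult_div_cancel_left of_nat_eq_0_iff nat.distinct(2))
    then show ?case by (auto simp: mult.commute simp del: of_nat_Suc)
  qed
  from this[of "nat n" m] neg[of n m] show ?thesis
    unfolding g_def by (cases "0 \<le> n") auto
qed


section \<open>The integral of six Hermite functions as a rotation kernel\<close>

definition psi_prod :: "int \<Rightarrow> int \<Rightarrow> int \<Rightarrow> int \<Rightarrow> int \<Rightarrow> int \<Rightarrow> real \<Rightarrow> real" where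
  "psi_prod i j k a b c x = psi i x * psi j x * psi k x * psi a x * psi b x * psi c x"

lemma gauss_bounded_psi_prod: "gauss_bounded (psi_prod i j k a b c)"
  unfolding psi_prod_def[abs_def] by (intro gauss_bounded_mult gauss_bounded_psi)

lemma integrable_psi_prod: "integrable lborel (psi_prod i j k a b c)"
  by (intro gauss_bounded_integrable gauss_bounded_psi_prod)

text \<open>\<open>pi * sqrt 3\<close> is the reciprocal of the integral of the sixth power of
  \<open>psi 0\<close>, so the entry at the origin is 1. This is the origin of the sharp
  constant.\<close>

definition hkernel :: "int \<Rightarrow> int \<Rightarrow> int \<Rightarrow> int \<Rightarrow> int \<Rightarrow> int \<Rightarrow> real" where
  "hkernel i j k a b c = pi * sqrt 3 * (LBINT x. psi_prod i j k a b c x)"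

text \<open>The derivative of the product is \<open>sqrt 2\<close> times the sum \<open>S\<close> of
  the six lowerings minus 6 x times the product. \<open>psi_rec\<close> charges this x to the first
  factor alone, which singles out the index \<open>i\<close> and turns the 6 into the divisor
  3.\<close>

lemma hkernel_rec:
  "of_int (i + 1) * hkernel (i + 1) j k a b c =
      (hkernel (i - 1) j k a b c + hkernel i (j - 1) k a b c + hkernel i j (k - 1) a b c
     + hkernel i j k (a - 1) b c + hkernel i j k a (b - 1) c + hkernel i j k a b (c - 1)) / 3
     - hkernel (i - 1) j k a b c"
proof -
  define S where "S x = psi_prod (i - 1) j k a b c x + psi_prod i (j - 1) k a b c x + psi_prod i j (k - 1) a b c x
     + psi_prod i j k (a - 1) b c x + psi_prod i j k a (b - 1) c x + psi_prod i j k a b (c - 1) x" for x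
  define X where "X x = x * psi_prod i j k a b c x" for x
  have X: "X x = 1 / sqrt 2 * (of_int (i + 1) * psi_prod (i + 1) j k a b c x + psi_prod (i - 1) j k a b c x)" for x
    using psi_rec[of i x] by (simp add: X_def psi_prod_def mult.assoc[symmetric] distrib_right[symmetric])
  have gS: "gauss_bounded S"
    unfolding S_def[abs_def] by (intro gauss_bounded_add gauss_bounded_psi_prod)
  have gX: "gauss_bounded X"
    unfolding X[abs_def] by (intro gauss_bounded_cmult gauss_bounded_add gauss_bounded_psi_prod)
  have iS: "integrable lborel S" and iX: "integrable lborel X"
    using gS gX by (auto intro: gauss_bounded_integrable)
  have "(LBINT x. sqrt 2 * S x + (-6) * X x) = 0"
  proof (rule integral_derivative_eq_0)
    show "gauss_bounded (psi_prod i j k a b c)" by (rule gauss_bounded_psi_prod)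
    show "gauss_bounded (\<lambda>x. sqrt 2 * S x + (-6) * X x)"
      by (intro gauss_bounded_add gauss_bounded_cmult gS gX)
    show "(psi_prod i j k a b c has_vector_derivative sqrt 2 * S x + (-6) * X x) (at x)" for x
      unfolding has_real_derivative_iff_has_vector_derivative[symmetric] psi_prod_def[abs_def]
      by (rule derivative_eq_intros psi_has_derivative refl)+ (simp add: algebra_simps S_def X_def psi_prod_def)
  qed
  then have "sqrt 2 * integral\<^sup>L lborel S = 6 * integral\<^sup>L lborel X"
    by (simp add: iS iX)
  also have "integral\<^sup>L lborel X = 1 / sqrt 2 * (of_int (i + 1) * integral\<^sup>L lborel (psi_prod (i + 1) j k a b c)
      + integral\<^sup>L lborel (psi_prod (i - 1) j k a b c))"
    unfolding X[abs_def] by (simp add: integrable_psi_prod del: of_int_add)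
  finally have "2 * integral\<^sup>L lborel S = 6 * (of_int (i + 1) * integral\<^sup>L lborel (psi_prod (i + 1) j k a b c)
      + integral\<^sup>L lborel (psi_prod (i - 1) j k a b c))"
    by (simp add: field_simps)
  then have "of_int (i + 1) * (LBINT x. psi_prod (i + 1) j k a b c x)
      = integral\<^sup>L lborel S / 3 - (LBINT x. psi_prod (i - 1) j k a b c x)"
    by simp
  moreover have "pi * sqrt 3 * integral\<^sup>L lborel S =
      hkernel (i - 1) j k a b c + hkernel i (j - 1) k a b c + hkernel i j (k - 1) a b c
     + hkernel i j k (a - 1) b c + hkernel i j k a (b - 1) c + hkernel i j k a b (c - 1)"
    unfolding S_def[abs_def] hkernel_def by (simp add: integrable_psi_prod distrib_left)
  ultimately show ?thesis
    unfolding hkernel_def[of "i + 1"] hkernel_def[of "i - 1" j k a b c] mult.left_commute[of "of_int (i + 1)"]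
    by (simp only: right_diff_distrib) simp
qed

interpretation hkernel: rotation_kernel hkernel
proof
  show "hkernel 0 0 0 0 0 0 = 1"
  proof -
    have e: "exp (- (1/2) * x\<^sup>2) * exp (- (1/2) * x\<^sup>2) * exp (- (1/2) * x\<^sup>2) * exp (- (1/2) * x\<^sup>2)
        * exp (- (1/2) * x\<^sup>2) * exp (- (1/2) * x\<^sup>2) = exp (- 3 * x\<^sup>2)" for x :: real
      unfolding exp_add[symmetric] by simp
    have "psi_prod 0 0 0 0 0 0 x = 1 / (pi * sqrt pi) * exp (- 3 * x\<^sup>2)" for x
    proof -
      have s: "sqrt (sqrt pi) * (sqrt (sqrt pi) * y) = sqrt pi * y" "sqrt pi * (sqrt pi * y) = pi * y" for y
        by (simp_all add: mult.assoc[symmetric])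
      show ?thesis
        unfolding e[symmetric] by (simp add: psi_prod_def psi_0 s mult_ac)
    qed
    then have "hkernel 0 0 0 0 0 0 = pi * sqrt 3 * (1 / (pi * sqrt pi) * sqrt (pi / 3))"
      using integral_exp_sq[of 3] by (simp add: hkernel_def)
    then show ?thesis by (simp add: real_sqrt_divide)
  qed
qed (simp_all only: hkernel_rec, simp_all add: hkernel_def psi_prod_def[abs_def] psi_neg mult_ac)

lemma psi_uminus: "psi (int n) (- x) = (-1) ^ n * psi (int n) x"
proof (induction n rule: less_induct)
  case (less n)
  show ?case
  proof (cases n)
    case 0
    then show ?thesis by (simp add: psi_0)
  next
    case (Suc k)
    have prev: "psi (int k - 1) (- x) = (-1) ^ Suc k * psi (int k - 1) x"
    proof (cases k)
      case (Suc l)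
      then show ?thesis using less.IH[of l] \<open>n = Suc k\<close> by simp
    qed (simp add: psi_neg)
    have n: "int k + 1 = int n" using Suc by simp
    have "real n * psi (int n) (- x) = (-1) ^ n * (real n * psi (int n) x)" (is "_ = ?r")
      using psi_rec[of "int k" x, unfolded n] psi_rec[of "int k" "-x", unfolded n] less.IH[of k] prev
      by (simp add: Suc right_diff_distrib del: of_nat_Suc)
    also have "?r = real n * ((-1) ^ n * psi (int n) x)" by simp
    finally show ?thesis using Suc by (simp del: of_nat_Suc power_Suc)
  qed
qed

text \<open>Parity of the integrand. It disposes of the odd frequencies, over which the time
  integral does not vanish.\<close>

lemma hkernel_odd:
  assumes "odd (i + j + k + a + b + c)"
  shows "hkernel (int i) (int j) (int k) (int a) (int b) (int c) = 0"
proof -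
  let ?P = "psi_prod (int i) (int j) (int k) (int a) (int b) (int c)"
  have "?P (- x) = - ?P x" for x
  proof -
    have "?P (- x) = (-1) ^ (i + j + k + a + b + c) * ?P x"
      by (simp add: psi_prod_def psi_uminus power_add)
    also have "(-1 :: real) ^ (i + j + k + a + b + c) = -1"
      using assms by (simp add: uminus_power_if)
    finally show ?thesis by simp
  qed
  moreover have "(LBINT x. ?P x) = (LBINT x. ?P (- x))"
    using lborel_integral_real_affine[of "-1" ?P 0] by simp
  ultimately have "(LBINT x. ?P x) = 0" by simp
  then show ?thesis by (simp add: hkernel_def)
qed

section \<open>Completeness of the Hermite functions\<close>

text \<open>Reduction to characteristic functions of probability measures: the positive and negative
  parts have equal mass by the case t = 0, and after division by this mass they are densities with
  the same characteristic function.\<close>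

lemma fourier_eq_0_imp_AE_eq_0:
  fixes u :: "real \<Rightarrow> real"
  assumes u: "integrable lborel u" and F: "\<And>t. (LBINT x. u x *\<^sub>R iexp (t * x)) = 0"
  shows "AE x in lborel. u x = 0"
proof -
  have [measurable]: "u \<in> borel_measurable borel" using u by auto
  define p where "p x = max 0 (u x)" for x
  define n where "n x = max 0 (- u x)" for x
  have [measurable]: "p \<in> borel_measurable borel" "n \<in> borel_measurable borel"
    unfolding p_def n_def by measurable
  have ip: "integrable lborel p" and i_n: "integrable lborel n"
    using u unfolding p_def n_def by (auto intro!: integrable_max)
  have pn: "u x = p x - n x" "0 \<le> p x" "0 \<le> n x" for x
    by (auto simp: p_def n_def)
  have iexp: "integrable lborel (\<lambda>x. q x *\<^sub>R iexp (t * x))" if "integrable lborel q" for q :: "real \<Rightarrow> real" and t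
    using that by (rule Bochner_Integration.integrable_bound) (use that in auto)
  have eq: "(LBINT x. p x *\<^sub>R iexp (t * x)) = (LBINT x. n x *\<^sub>R iexp (t * x))" for t
    using F[of t] unfolding pn(1) scaleR_diff_left
    by (subst (asm) Bochner_Integration.integral_diff[OF iexp iexp, OF ip i_n]) (simp only: right_minus_eq)
  define m where "m = (LBINT x. p x)"
  have mn: "m = (LBINT x. n x)"
    using eq[of 0] unfolding m_def by (simp add: scaleR_conv_of_real ip i_n)
  have "0 \<le> m" unfolding m_def by (simp add: pn)
  show ?thesis
  proof (cases "m = 0")
    case True
    have "AE x in lborel. p x = 0"
      using True ip pn(2) unfolding m_def by (subst integral_nonneg_eq_0_iff_AE[symmetric]) auto
    moreover have "AE x in lborel. n x = 0"
      using True i_n pn(3) unfolding mn by (subst integral_nonneg_eq_0_iff_AE[symmetric]) auto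
    ultimately show ?thesis by eventually_elim (simp add: pn)
  next
    case False
    with \<open>0 \<le> m\<close> have m: "0 < m" by simp
    have rd: "real_distribution (density lborel (\<lambda>x. ennreal (q x / m)))"
      if [measurable]: "q \<in> borel_measurable borel" and q: "integrable lborel q" "\<And>x. 0 \<le> q x" "m = (LBINT x. q x)"
      for q :: "real \<Rightarrow> real"
    proof -
      have "(\<integral>\<^sup>+x. ennreal (q x / m) \<partial>lborel) = ennreal (LBINT x. q x / m)"
        using q m by (intro nn_integral_eq_integral) auto
      also have "\<dots> = 1"
        using q(3) m by simp
      finally have "prob_space (density lborel (\<lambda>x. ennreal (q x / m)))"
        by (intro prob_spaceI) (simp add: emeasure_density)
      then show ?thesis
        unfolding real_distribution_def real_distribution_axioms_def by simp
    qed
    have ch: "char (density lborel (\<lambda>x. ennreal (q x / m))) t = (1 / m) *\<^sub>R (LBINT x. q x *\<^sub>R iexp (t * x))"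
      if [measurable]: "q \<in> borel_measurable borel" and q: "\<And>x. 0 \<le> q x" for q :: "real \<Rightarrow> real" and t
    proof -
      have "char (density lborel (\<lambda>x. ennreal (q x / m))) t = (LBINT x. (q x / m) *\<^sub>R iexp (t * x))"
        unfolding char_def using m q by (intro integral_density) auto
      also have "\<dots> = (LBINT x. (1 / m) *\<^sub>R (q x *\<^sub>R iexp (t * x)))"
        by (simp add: mult.commute)
      finally show ?thesis by (simp only: integral_scaleR_right)
    qed
    have "char (density lborel (\<lambda>x. ennreal (p x / m))) = char (density lborel (\<lambda>x. ennreal (n x / m)))"
      by (rule ext, subst (1 2) ch) (simp_all only: eq pn(2,3), measurable)
    then have "density lborel (\<lambda>x. ennreal (p x / m)) = density lborel (\<lambda>x. ennreal (n x / m))"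
      using pn ip i_n m_def mn by (intro Levy_uniqueness rd) auto
    moreover have "(\<integral>\<^sup>+x. ennreal (p x / m) \<partial>lborel) \<noteq> \<infinity>"
      using ip pn m by (subst nn_integral_eq_integral) auto
    ultimately have "AE x in lborel. ennreal (p x / m) = ennreal (n x / m)"
      by (subst (asm) finite_density_unique) auto
    then show ?thesis
      by eventually_elim (use m pn in \<open>auto simp: divide_right_mono\<close>)
  qed
qed

lemma norm_iexp_partial_sum_le: "cmod (\<Sum>k<n. (\<i> * of_real y) ^ k / fact k) \<le> exp \<bar>y\<bar>"
proof -
  have "cmod (\<Sum>k<n. (\<i> * of_real y) ^ k / fact k) \<le> (\<Sum>k<n. \<bar>y\<bar> ^ k / fact k)"
    by (rule order.trans[OF norm_sum]) (simp add: norm_divide norm_power norm_mult)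
  also have "\<dots> = (\<Sum>k<n. \<bar>y\<bar> ^ k /\<^sub>R fact k)"
    by (simp add: divide_inverse mult.commute)
  also have "\<dots> \<le> exp \<bar>y\<bar>"
    unfolding exp_def by (rule sum_le_suminf[OF summable_exp_generic]) auto
  finally show ?thesis .
qed

text \<open>Orthogonality to every \<open>psi n\<close> passes to \<open>x ^ k * psi n x\<close> by
  the three-term recurrence, so all moments of \<open>h x * psi 0 x\<close> vanish. The Gaussian
  factor dominates \<open>exp \<bar>t * x\<bar>\<close>, so the Fourier transform may be expanded in
  these moments and is zero.\<close>

lemma real_hermite_complete:
  fixes h :: "real \<Rightarrow> real"
  assumes [measurable]: "h \<in> borel_measurable borel" and h2: "integrable lborel (\<lambda>x. (h x)\<^sup>2)"
    and h0: "\<And>n. (LBINT x. h x * psi n x) = 0"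
  shows "AE x in lborel. h x = 0"
proof -
  have int: "integrable lborel (\<lambda>x. h x * F x)" if "gauss_bounded F" for F
  proof (rule Bochner_Integration.integrable_bound)
    show "integrable lborel (\<lambda>x. (h x)\<^sup>2 + F x * F x)"
      by (intro Bochner_Integration.integrable_add h2 gauss_bounded_integrable gauss_bounded_mult that)
    have "F \<in> borel_measurable borel"
      using gauss_bounded_integrable[OF that] by auto
    then show "(\<lambda>x. h x * F x) \<in> borel_measurable lborel" by measurable
    have "\<bar>a * b\<bar> \<le> a\<^sup>2 + b * b" for a b :: real
      using sum_squares_bound[of "\<bar>a\<bar>" "\<bar>b\<bar>"] zero_le_power2[of a] zero_le_power2[of b]
      unfolding abs_mult power2_eq_square abs_mult_self_eq by linarith
    then show "AE x in lborel. norm (h x * F x) \<le> norm ((h x)\<^sup>2 + F x * F x)"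
      by (simp add: order.trans[OF _ abs_ge_self])
  qed
  have gb: "gauss_bounded (\<lambda>x. x ^ k * psi n x)" for k n
  proof (induction k arbitrary: n)
    case (Suc k)
    have "(\<lambda>x. x ^ Suc k * psi n x) = (\<lambda>x. 1 / sqrt 2 * (of_int (n + 1) * (x ^ k * psi (n + 1) x) + x ^ k * psi (n -
        1) x))"
      unfolding mult.left_commute[of "of_int _" "_ ^ _"] psi_rec by (simp add: algebra_simps)
    then show ?case
      by (simp only:) (intro gauss_bounded_cmult gauss_bounded_add Suc)
  qed (simp add: gauss_bounded_psi)
  have mom: "(LBINT x. h x * (x ^ k * psi n x)) = 0" for k n
  proof (induction k arbitrary: n)
    case (Suc k)
    have "(LBINT x. h x * (x ^ Suc k * psi n x)) =
      (LBINT x. (of_int (n + 1) / sqrt 2) * (h x * (x ^ k * psi (n + 1) x)) + 1 / sqrt 2 * (h x * (x ^ k * psi (n -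
          1) x)))"
    proof (intro Bochner_Integration.integral_cong refl)
      fix x
      have "x ^ Suc k * psi n x = 1 / sqrt 2 * (x ^ k * (of_int (n + 1) * psi (n + 1) x) + x ^ k * psi (n - 1) x)"
        unfolding psi_rec by (simp add: algebra_simps)
      then show "h x * (x ^ Suc k * psi n x) = (of_int (n + 1) / sqrt 2) * (h x * (x ^ k * psi (n + 1) x)) + 1 /
          sqrt 2 * (h x * (x ^ k * psi (n - 1) x))"
        by (simp only:) (simp add: algebra_simps add_divide_distrib)
    qed
    also have "\<dots> = 0"
      by (subst Bochner_Integration.integral_add; (intro integrable_mult_right int gb)?)
        (simp only: integral_mult_right_zero Suc mult_zero_right add_0)
    finally show ?case .
  qed (simp add: h0)
  have exp_gb: "gauss_bounded (\<lambda>x. exp (\<bar>t * x\<bar>) * psi 0 x)" for t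
    unfolding gauss_bounded_def
  proof (intro conjI exI allI)
    show "continuous_on UNIV (\<lambda>x. exp \<bar>t * x\<bar> * psi 0 x)"
      unfolding psi_0 by (intro continuous_intros) auto
    show "norm (exp \<bar>t * x\<bar> * psi 0 x) \<le> exp (t\<^sup>2) / sqrt (sqrt pi) * exp (- (1 / 4) * x\<^sup>2)" for x
    proof -
      have "\<bar>t * x\<bar> - (1 / 2) * x\<^sup>2 \<le> t\<^sup>2 - (1 / 4) * x\<^sup>2"
        using zero_le_power2[of "\<bar>t\<bar> - \<bar>x\<bar> / 2"] by (simp add: power2_diff abs_mult power_divide)
      then have "exp (\<bar>t * x\<bar> + (- (1 / 2) * x\<^sup>2)) \<le> exp (t\<^sup>2 + (- (1 / 4) * x\<^sup>2))" by simp
      then show ?thesis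
        unfolding exp_add psi_0 by (simp add: divide_right_mono)
    qed
  qed simp
  have "AE x in lborel. h x * psi 0 x = 0"
  proof (rule fourier_eq_0_imp_AE_eq_0)
    show "integrable lborel (\<lambda>x. h x * psi 0 x)" by (intro int gauss_bounded_psi)
    fix t
    define s where "s n x = (\<Sum>k<n. (\<i> * of_real (t * x)) ^ k / fact k)" for n and x :: real
    have [measurable]: "psi 0 \<in> borel_measurable borel"
      unfolding psi_0[abs_def] by measurable
    have [measurable]: "s n \<in> borel_measurable borel" for n
      unfolding s_def[abs_def] by measurable
    have "(\<lambda>n. LBINT x. of_real (h x * psi 0 x) * s n x) \<longlonglongrightarrow> (LBINT x. (h x * psi 0 x) *\<^sub>R iexp (t * x))"
    proof (rule integral_dominated_convergence)
      show "integrable lborel (\<lambda>x. \<bar>h x * (exp \<bar>t * x\<bar> * psi 0 x)\<bar>)"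
        by (intro integrable_abs int exp_gb)
      show "AE x in lborel. norm (of_real (h x * psi 0 x) * s n x) \<le> \<bar>h x * (exp \<bar>t * x\<bar> * psi 0 x)\<bar>" for n
      proof (intro AE_I2)
        fix x
        have "norm (of_real (h x * psi 0 x) * s n x) \<le> \<bar>h x * psi 0 x\<bar> * exp \<bar>t * x\<bar>"
          unfolding norm_mult norm_of_real s_def by (intro mult_left_mono norm_iexp_partial_sum_le) auto
        then show "norm (of_real (h x * psi 0 x) * s n x) \<le> \<bar>h x * (exp \<bar>t * x\<bar> * psi 0 x)\<bar>"
          by (simp add: abs_mult mult_ac)
      qed
      show "AE x in lborel. (\<lambda>n. of_real (h x * psi 0 x) * s n x) \<longlonglongrightarrow> (h x * psi 0 x) *\<^sub>R iexp (t * x)"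
      proof (intro AE_I2)
        fix x
        have "(\<lambda>n. s n x) \<longlonglongrightarrow> iexp (t * x)"
          using exp_converges[of "\<i> * of_real (t * x)"] unfolding sums_def s_def
          by (simp add: scaleR_conv_of_real divide_inverse mult.commute)
        then show "(\<lambda>n. of_real (h x * psi 0 x) * s n x) \<longlonglongrightarrow> (h x * psi 0 x) *\<^sub>R iexp (t * x)"
          unfolding scaleR_conv_of_real by (intro tendsto_intros)
      qed
    qed measurable
    moreover have "(LBINT x. of_real (h x * psi 0 x) * s n x) = 0" for n
    proof -
      have "(LBINT x. of_real (h x * psi 0 x) * s n x)
        = (LBINT x. \<Sum>k<n. ((\<i> * of_real t) ^ k / fact k) * of_real (h x * (x ^ k * psi 0 x)))"
        by (intro Bochner_Integration.integral_cong refl)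
          (simp add: s_def sum_distrib_left power_mult_distrib mult_ac)
      also have "\<dots> = (\<Sum>k<n. LBINT x. ((\<i> * of_real t) ^ k / fact k) * of_real (h x * (x ^ k * psi 0 x)))"
        by (intro Bochner_Integration.integral_sum integrable_mult_right integrable_of_real int gb)
      also have "\<dots> = 0"
        unfolding integral_mult_right_zero integral_complex_of_real mom by simp
      finally show ?thesis .
    qed
    ultimately show "(LBINT x. (h x * psi 0 x) *\<^sub>R iexp (t * x)) = 0"
      by (simp add: LIMSEQ_const_iff)
  qed
  then show ?thesis
    by eventually_elim (simp add: psi_0)
qed

section \<open>Square integrable functions and orthonormality\<close>

lemma gauss_bounded_L2: "gauss_bounded g \<Longrightarrow> g \<in> L2"
proof -
  assume g: "gauss_bounded g"
  have [measurable]: "g \<in> borel_measurable borel"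
    using gauss_bounded_integrable[OF g] by auto
  obtain C a where a: "0 < a" and F: "\<And>x. norm (g x) \<le> C * exp (- a * x\<^sup>2)" "continuous_on UNIV g"
    using g by (auto simp: gauss_bounded_def)
  have "gauss_bounded (\<lambda>x. cmod (g x))"
    unfolding gauss_bounded_def using F a by (auto intro: continuous_intros)
  from gauss_bounded_integrable[OF gauss_bounded_mult[OF this this]]
  have "integrable lborel (\<lambda>x. (cmod (g x))\<^sup>2)"
    by (simp add: power2_eq_square)
  then show ?thesis
    by (simp add: L2_def integrable_completion measurable_completion)
qed

lemma hermite_fun_conv_psi: "hermite_fun n = (\<lambda>x. of_real (sqrt (fact n) * psi (int n) x))"
  by (rule ext) (rule hermite_fun_psi)

lemma gauss_bounded_hermite_fun: "gauss_bounded (hermite_fun n)"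
  unfolding hermite_fun_conv_psi by (intro gauss_bounded_of_real gauss_bounded_cmult gauss_bounded_psi)

lemma hermite_fun_L2 [simp]: "hermite_fun n \<in> L2"
  by (intro gauss_bounded_L2 gauss_bounded_hermite_fun)

lemma cnj_hermite_fun [simp]: "cnj (hermite_fun n x) = hermite_fun n x"
  by (simp add: hermite_fun_psi)

lemma borel_measurable_hermite_fun [measurable]: "hermite_fun n \<in> borel_measurable borel"
  using gauss_bounded_integrable[OF gauss_bounded_hermite_fun] by auto

lemma borel_measurable_cnj [measurable]: "cnj \<in> borel_measurable borel"
  by (intro borel_measurable_continuous_onI continuous_intros)

lemma L2_mult_integrable:
  assumes "f \<in> L2" "g \<in> L2"
  shows "integrable lebesgue (\<lambda>x. f x * cnj (g x))"
proof (rule Bochner_Integration.integrable_bound)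
  show "integrable lebesgue (\<lambda>x. (cmod (f x))\<^sup>2 + (cmod (g x))\<^sup>2)"
    using assms by (auto simp: L2_def)
  have [measurable]: "f \<in> borel_measurable lebesgue" "g \<in> borel_measurable lebesgue"
    using assms by (auto simp: L2_def)
  show "(\<lambda>x. f x * cnj (g x)) \<in> borel_measurable lebesgue"
    by measurable
  show "AE x in lebesgue. norm (f x * cnj (g x)) \<le> norm ((cmod (f x))\<^sup>2 + (cmod (g x))\<^sup>2)"
  proof (intro AE_I2)
    fix x
    show "norm (f x * cnj (g x)) \<le> norm ((cmod (f x))\<^sup>2 + (cmod (g x))\<^sup>2)"
      using sum_squares_bound[of "cmod (f x)" "cmod (g x)"] mult_nonneg_nonneg[of "cmod (f x)" "cmod (g x)"]
      unfolding norm_mult complex_mod_cnj real_norm_def by linarith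
  qed
qed

lemma L2_add: "f \<in> L2 \<Longrightarrow> g \<in> L2 \<Longrightarrow> (\<lambda>x. f x + g x) \<in> L2"
proof -
  assume f: "f \<in> L2" and g: "g \<in> L2"
  have "integrable lebesgue (\<lambda>x. (cmod (f x + g x))\<^sup>2)"
  proof (rule Bochner_Integration.integrable_bound)
    show "integrable lebesgue (\<lambda>x. 2 * (cmod (f x))\<^sup>2 + 2 * (cmod (g x))\<^sup>2)"
      using f g by (auto simp: L2_def)
    show "(\<lambda>x. (cmod (f x + g x))\<^sup>2) \<in> borel_measurable lebesgue"
      using f g by (auto simp: L2_def)
    show "AE x in lebesgue. norm ((cmod (f x + g x))\<^sup>2) \<le> norm (2 * (cmod (f x))\<^sup>2 + 2 * (cmod (g x))\<^sup>2)"
    proof (intro AE_I2)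
      fix x
      have "(cmod (f x + g x))\<^sup>2 \<le> (cmod (f x) + cmod (g x))\<^sup>2"
        by (intro power_mono norm_triangle_ineq) auto
      also have "\<dots> \<le> 2 * (cmod (f x))\<^sup>2 + 2 * (cmod (g x))\<^sup>2"
        using sum_squares_bound[of "cmod (f x)" "cmod (g x)"] by (simp add: power2_sum)
      finally show "norm ((cmod (f x + g x))\<^sup>2) \<le> norm (2 * (cmod (f x))\<^sup>2 + 2 * (cmod (g x))\<^sup>2)"
        by simp
    qed
  qed
  with f g show ?thesis by (auto simp: L2_def)
qed

lemma L2_cmult: "f \<in> L2 \<Longrightarrow> (\<lambda>x. c * f x) \<in> L2"
  by (auto simp: L2_def norm_mult power_mult_distrib)

lemma L2_diff: "f \<in> L2 \<Longrightarrow> g \<in> L2 \<Longrightarrow> (\<lambda>x. f x - g x) \<in> L2"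
  using L2_add[of f "\<lambda>x. (-1) * g x"] L2_cmult[of g "-1"] by simp

lemma L2_zero: "(\<lambda>x. 0) \<in> L2"
  by (simp add: L2_def)

lemma L2_sum: "(\<And>i. i \<in> A \<Longrightarrow> f i \<in> L2) \<Longrightarrow> (\<lambda>x. \<Sum>i\<in>A. f i x) \<in> L2"
  by (induction A rule: infinite_finite_induct) (simp_all add: L2_zero L2_add)

lemma L2_inner_diff_left:
  "f \<in> L2 \<Longrightarrow> g \<in> L2 \<Longrightarrow> h \<in> L2 \<Longrightarrow> L2_inner (\<lambda>x. f x - g x) h = L2_inner f h - L2_inner g h"
  using L2_mult_integrable[of f h] L2_mult_integrable[of g h] by (simp add: L2_inner_def left_diff_distrib)

lemma L2_inner_cnj: "cnj (L2_inner f g) = L2_inner g f"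
  unfolding L2_inner_def Bochner_Integration.integral_cnj[symmetric] by (simp add: mult.commute)

lemma L2_inner_sum_left:
  "(\<And>i. i \<in> A \<Longrightarrow> f i \<in> L2) \<Longrightarrow> h \<in> L2 \<Longrightarrow> L2_inner (\<lambda>x. \<Sum>i\<in>A. c i * f i x) h = (\<Sum>i\<in>A. c i * L2_inner (f i) h)"
  using L2_mult_integrable[of "f _" h]
  by (simp add: L2_inner_def sum_distrib_right mult.assoc Bochner_Integration.integral_sum)

lemma L2_inner_hermite_fun: "L2_inner (hermite_fun n) (hermite_fun m) = (if n = m then 1 else 0)"
proof -
  have "L2_inner (hermite_fun n) (hermite_fun m) = (LBINT x. hermite_fun n x * hermite_fun m x)"
    unfolding L2_inner_def by (simp add: integral_completion)
  also have "\<dots> = of_real (sqrt (fact n) * sqrt (fact m) * (LBINT x. psi n x * psi m x))"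
    unfolding hermite_fun_psi of_real_mult[symmetric] integral_complex_of_real
        Bochner_Integration.integral_mult_right_zero[symmetric]
    by (simp only: mult_ac)
  also have "\<dots> = (if n = m then 1 else 0)"
    by (simp add: integral_psi_psi flip: of_real_mult)
  finally show ?thesis .
qed

lemma L2_inner_self: "L2_inner f f = of_real ((L2_norm f)\<^sup>2)"
  unfolding L2_inner_def L2_norm_def complex_norm_square[symmetric] integral_complex_of_real by (simp add:
      integral_nonneg)

lemma L2_norm_nonneg: "0 \<le> L2_norm f"
  by (simp add: L2_norm_def integral_nonneg)

lemma L2_norm_sum_hermite_fun:
  "finite A \<Longrightarrow> (L2_norm (\<lambda>x. \<Sum>n\<in>A. b n * hermite_fun n x))\<^sup>2 = (\<Sum>n\<in>A. (cmod (b n))\<^sup>2)"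
proof -
  assume A: "finite A"
  let ?S = "\<lambda>x. \<Sum>n\<in>A. b n * hermite_fun n x"
  have "L2_inner ?S ?S = (\<Sum>n\<in>A. b n * cnj (L2_inner ?S (hermite_fun n)))"
    by (subst L2_inner_sum_left) (auto intro!: L2_sum L2_cmult simp: L2_inner_cnj)
  also have "\<dots> = (\<Sum>n\<in>A. b n * cnj (b n))"
    using A by (intro sum.cong refl, subst L2_inner_sum_left) (auto simp: L2_inner_hermite_fun if_distrib cong: if_cong)
  finally have "complex_of_real ((L2_norm ?S)\<^sup>2) = of_real (\<Sum>n\<in>A. (cmod (b n))\<^sup>2)"
    by (simp only: L2_inner_self complex_norm_square[symmetric] of_real_sum[symmetric])
  then show ?thesis by (simp only: of_real_eq_iff)
qed

lemma L2_norm_eq_0_iff: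
  assumes "f \<in> L2" shows "L2_norm f = 0 \<longleftrightarrow> (AE x in lebesgue. f x = 0)"
proof -
  have "L2_norm f = 0 \<longleftrightarrow> (LINT x|lebesgue. (cmod (f x))\<^sup>2) = 0"
    by (simp add: L2_norm_def)
  also have "\<dots> \<longleftrightarrow> (AE x in lebesgue. (cmod (f x))\<^sup>2 = 0)"
    using assms by (intro integral_nonneg_eq_0_iff_AE) (auto simp: L2_def)
  finally show ?thesis by simp
qed

lemma L2_ex_borel:
  assumes "f \<in> L2"
  obtains g where "g \<in> borel_measurable borel" "AE x in lebesgue. f x = g x"
proof -
  have "(\<lambda>x. Re (f x)) \<in> borel_measurable lebesgue" "(\<lambda>x. Im (f x)) \<in> borel_measurable lebesgue"
    using assms by (auto simp: L2_def)
  from this[THEN completion_ex_borel_measurable_real] obtain a b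
    where [measurable]: "a \<in> borel_measurable borel" "b \<in> borel_measurable borel"
      and ab: "AE x in lborel. Re (f x) = a x" "AE x in lborel. Im (f x) = b x"
    by auto
  show ?thesis
  proof (rule that)
    show "(\<lambda>x. of_real (a x) + \<i> * of_real (b x)) \<in> borel_measurable borel"
      by measurable
    show "AE x in lebesgue. f x = of_real (a x) + \<i> * of_real (b x)"
      using AE_completion[OF ab(1)] AE_completion[OF ab(2)] by eventually_elim (simp add: complex_eq_iff)
  qed
qed

text \<open>The Hermite functions are real, so the real and imaginary parts of a Borel
  representative are each orthogonal to all of them.\<close>

theorem hermite_fun_complete:
  assumes f: "f \<in> L2" and "\<And>n. L2_inner f (hermite_fun n) = 0"
  shows "AE x in lebesgue. f x = 0"
proof -
  obtain g where [measurable]: "g \<in> borel_measurable borel" and fg: "AE x in lebesgue. f x = g x"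
    using L2_ex_borel[OF f] .
  have [measurable]: "f \<in> borel_measurable lebesgue" using f by (simp add: L2_def)
  have "integrable lebesgue (\<lambda>x. (cmod (g x))\<^sup>2)"
    using f by (subst integrable_cong_AE[where g = "\<lambda>x. (cmod (f x))\<^sup>2"])
      (use fg in \<open>auto simp: L2_def measurable_completion\<close>)
  then have g2: "integrable lborel (\<lambda>x. (cmod (g x))\<^sup>2)"
    by (simp add: integrable_completion)
  have g0: "(LBINT x. g x * of_real (psi n x)) = 0"
    and gi: "integrable lborel (\<lambda>x. g x * of_real (psi n x))" for n
  proof -
    show "integrable lborel (\<lambda>x. g x * of_real (psi n x))"
    proof -
      have gb: "gauss_bounded (\<lambda>x. complex_of_real (psi n x))"
        by (intro gauss_bounded_of_real gauss_bounded_psi)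
      have "g \<in> L2" using \<open>integrable lebesgue (\<lambda>x. (cmod (g x))\<^sup>2)\<close> by (simp add: L2_def measurable_completion)
      from L2_mult_integrable[OF this gauss_bounded_L2[OF gb]]
      show ?thesis
        using gauss_bounded_integrable[OF gb]
        by (subst (asm) integrable_completion) auto
    qed
    show "(LBINT x. g x * of_real (psi n x)) = 0"
    proof (cases "n < 0")
      case False
      then obtain m where n: "n = int m" by (metis nonneg_int_cases not_less)
      have "0 = L2_inner f (hermite_fun m)" using assms by simp
      also have "\<dots> = L2_inner g (hermite_fun m)"
        unfolding L2_inner_def using fg by (intro integral_cong_AE) (auto intro!: borel_measurable_times simp:
            measurable_completion)
      also have "\<dots> = (LBINT x. g x * hermite_fun m x)"
        unfolding L2_inner_def by (simp add: integral_completion)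
      also have "\<dots> = of_real (sqrt (fact m)) * (LBINT x. g x * of_real (psi n x))"
        unfolding hermite_fun_psi Bochner_Integration.integral_mult_right_zero[symmetric] n by (simp add: mult_ac)
      finally show ?thesis by simp
    qed (simp add: psi_neg)
  qed
  have "AE x in lborel. Re (g x) = 0"
  proof (rule real_hermite_complete)
    show "integrable lborel (\<lambda>x. (Re (g x))\<^sup>2)"
      by (rule Bochner_Integration.integrable_bound[OF g2]) (auto simp: cmod_power2)
    show "(LBINT x. Re (g x) * psi n x) = 0" for n
      using integral_Re[OF gi, of n] by (simp add: g0)
  qed measurable
  moreover have "AE x in lborel. Im (g x) = 0"
  proof (rule real_hermite_complete)
    show "integrable lborel (\<lambda>x. (Im (g x))\<^sup>2)"
      by (rule Bochner_Integration.integrable_bound[OF g2]) (auto simp: cmod_power2)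
    show "(LBINT x. Im (g x) * psi n x) = 0" for n
      using integral_Im[OF gi, of n] by (simp add: g0)
  qed measurable
  ultimately have "AE x in lborel. g x = 0"
    by eventually_elim (simp add: complex_eq_iff)
  from AE_completion[OF this] fg show ?thesis
    by eventually_elim simp
qed

section \<open>Hermite expansions and the propagator\<close>

definition hsum :: "(nat \<Rightarrow> complex) \<Rightarrow> nat \<Rightarrow> real \<Rightarrow> complex" where
  "hsum b N x = (\<Sum>n<N. b n * hermite_fun n x)"

lemma hsum_L2: "hsum b N \<in> L2"
  unfolding hsum_def[abs_def] by (intro L2_sum L2_cmult hermite_fun_L2)

lemma borel_measurable_hsum [measurable]: "hsum b N \<in> borel_measurable borel"
  unfolding hsum_def[abs_def] by measurable

lemma L2_inner_hsum: "L2_inner (hsum b N) (hermite_fun n) = (if n < N then b n else 0)"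
  unfolding hsum_def[abs_def] by (subst L2_inner_sum_left) (auto simp: L2_inner_hermite_fun if_distrib cong: if_cong)

lemma bessel_identity:
  assumes f: "f \<in> L2"
  shows "(L2_norm (\<lambda>x. f x - hsum (\<lambda>n. L2_inner f (hermite_fun n)) N x))\<^sup>2
    = (L2_norm f)\<^sup>2 - (\<Sum>n<N. (cmod (L2_inner f (hermite_fun n)))\<^sup>2)"
proof -
  define c where "c n = L2_inner f (hermite_fun n)" for n
  define h where "h x = f x - hsum c N x" for x
  have h: "h \<in> L2" unfolding h_def[abs_def] by (intro L2_diff f hsum_L2)
  have hn: "L2_inner h (hermite_fun n) = (if n < N then 0 else c n)" for n
    unfolding h_def[abs_def] by (subst L2_inner_diff_left) (auto simp: f hsum_L2 L2_inner_hsum c_def)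
  have "L2_inner (hsum c N) h = (\<Sum>n<N. c n * cnj (L2_inner h (hermite_fun n)))"
    unfolding hsum_def[abs_def] by (subst L2_inner_sum_left) (auto simp: h L2_inner_cnj)
  also have "\<dots> = 0" by (simp add: hn)
  finally have "L2_inner h h = L2_inner f h"
    using L2_inner_diff_left[OF f hsum_L2 h, of c N] by (simp add: h_def[abs_def, symmetric])
  also have "\<dots> = cnj (L2_inner h f)" by (simp add: L2_inner_cnj)
  also have "L2_inner h f = L2_inner f f - L2_inner (hsum c N) f"
    unfolding h_def[abs_def] by (intro L2_inner_diff_left f hsum_L2)
  also have "L2_inner (hsum c N) f = (\<Sum>n<N. c n * cnj (c n))"
    unfolding hsum_def[abs_def] by (subst L2_inner_sum_left) (auto simp: f c_def L2_inner_cnj)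
  finally have "complex_of_real ((L2_norm h)\<^sup>2) = of_real ((L2_norm f)\<^sup>2 - (\<Sum>n<N. (cmod (c n))\<^sup>2))"
    by (simp only: L2_inner_self complex_norm_square[symmetric] of_real_sum[symmetric] of_real_diff[symmetric]
        complex_cnj_complex_of_real)
  then show ?thesis
    unfolding of_real_eq_iff h_def[abs_def] c_def .
qed

lemma bessel_le: "f \<in> L2 \<Longrightarrow> (\<Sum>n<N. (cmod (L2_inner f (hermite_fun n)))\<^sup>2) \<le> (L2_norm f)\<^sup>2"
  using bessel_identity[of f N] zero_le_power2[of "L2_norm (\<lambda>x. f x - hsum (\<lambda>n. L2_inner f (hermite_fun n)) N x)"]
  by linarith

lemma bessel_summable: "f \<in> L2 \<Longrightarrow> summable (\<lambda>n. (cmod (L2_inner f (hermite_fun n)))\<^sup>2)"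
  by (rule summableI_nonneg_bounded[of _ "(L2_norm f)\<^sup>2"]) (simp_all add: bessel_le)

lemma norm_L2_inner_hermite_fun_le:
  assumes "f \<in> L2" shows "cmod (L2_inner f (hermite_fun n)) \<le> L2_norm f"
proof (rule power2_le_imp_le)
  have "(cmod (L2_inner f (hermite_fun n)))\<^sup>2 \<le> (\<Sum>k<Suc n. (cmod (L2_inner f (hermite_fun k)))\<^sup>2)"
    by (rule member_le_sum) auto
  also have "\<dots> \<le> (L2_norm f)\<^sup>2" by (rule bessel_le[OF assms])
  finally show "(cmod (L2_inner f (hermite_fun n)))\<^sup>2 \<le> (L2_norm f)\<^sup>2" .
qed (rule L2_norm_nonneg)

text \<open>The coefficient of the partial sum is already \<open>b n\<close> for all
  \<open>N > n\<close>, and by Bessel's inequality coefficients are continuous in the norm.\<close>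

lemma L2_inner_hsum_limit:
  assumes g: "g \<in> L2" and lim: "(\<lambda>N. L2_norm (\<lambda>x. g x - hsum b N x)) \<longlonglongrightarrow> 0"
  shows "L2_inner g (hermite_fun n) = b n"
proof -
  have "(\<lambda>N. cmod (L2_inner (\<lambda>x. g x - hsum b N x) (hermite_fun n))) \<longlonglongrightarrow> 0"
    by (rule tendsto_sandwich[OF always_eventually always_eventually tendsto_const lim])
      (auto intro: norm_L2_inner_hermite_fun_le L2_diff g hsum_L2)
  moreover have "eventually (\<lambda>N. cmod (L2_inner (\<lambda>x. g x - hsum b N x) (hermite_fun n))
      = cmod (L2_inner g (hermite_fun n) - b n)) sequentially"
    using eventually_gt_at_top[of n]
    by eventually_elim (subst L2_inner_diff_left, auto simp: g hsum_L2 L2_inner_hsum)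
  ultimately have "(\<lambda>N::nat. cmod (L2_inner g (hermite_fun n) - b n)) \<longlonglongrightarrow> 0"
    by (rule Lim_transform_eventually)
  then show ?thesis by (simp add: LIMSEQ_const_iff)
qed

lemma nn_integral_L2:
  assumes "f \<in> L2" "f \<in> borel_measurable borel"
  shows "(\<integral>\<^sup>+x. ennreal ((cmod (f x))\<^sup>2) \<partial>lborel) = ennreal ((L2_norm f)\<^sup>2)"
proof -
  have "(\<integral>\<^sup>+x. ennreal ((cmod (f x))\<^sup>2) \<partial>lborel) = (\<integral>\<^sup>+x. ennreal ((cmod (f x))\<^sup>2) \<partial>lebesgue)"
    by (simp add: nn_integral_completion)
  also have "\<dots> = ennreal (LINT x|lebesgue. (cmod (f x))\<^sup>2)"
    using assms by (intro nn_integral_eq_integral) (auto simp: L2_def)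
  finally show ?thesis by (simp add: L2_norm_def)
qed

lemma L2_I_nn_integral:
  assumes [measurable]: "f \<in> borel_measurable borel"
    and le: "(\<integral>\<^sup>+x. ennreal ((cmod (f x))\<^sup>2) \<partial>lborel) \<le> ennreal C" and "0 \<le> C"
  shows "f \<in> L2" "(L2_norm f)\<^sup>2 \<le> C"
proof -
  have "integrable lborel (\<lambda>x. (cmod (f x))\<^sup>2)"
    using le by (intro integrableI_bounded) (auto intro: le_less_trans)
  then show f: "f \<in> L2" by (simp add: L2_def measurable_completion integrable_completion)
  show "(L2_norm f)\<^sup>2 \<le> C"
    using le assms(3) nn_integral_L2[OF f assms(1)] by simp
qed

lemma nn_integral_hsum_diff:
  assumes "M \<le> N"
  shows "(\<integral>\<^sup>+x. ennreal ((cmod (hsum b N x - hsum b M x))\<^sup>2) \<partial>lborel) = ennreal (\<Sum>n\<in>{M..<N}. (cmod (b n))\<^sup>2)"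
proof -
  have "hsum b N x - hsum b M x = (\<Sum>n\<in>{M..<N}. b n * hermite_fun n x)" for x
    using assms unfolding hsum_def lessThan_atLeast0 by (simp add: sum_diff_nat_ivl)
  then have e: "(\<lambda>x. hsum b N x - hsum b M x) = (\<lambda>x. \<Sum>n\<in>{M..<N}. b n * hermite_fun n x)"
    by simp
  have "(L2_norm (\<lambda>x. hsum b N x - hsum b M x))\<^sup>2 = (\<Sum>n\<in>{M..<N}. (cmod (b n))\<^sup>2)"
    unfolding e by (simp add: L2_norm_sum_hermite_fun)
  then show ?thesis
    using nn_integral_L2[OF L2_diff[OF hsum_L2 hsum_L2], of b N b M] by simp
qed

section \<open>Pointwise representatives of Hermite series\<close>

definition tail_sum :: "(nat \<Rightarrow> real) \<Rightarrow> nat \<Rightarrow> real" where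
  "tail_sum \<beta> N = (\<Sum>n. (\<beta> (n + N))\<^sup>2)"

text \<open>The subsequence depends only on the moduli of the coefficients, hence not on the time of
  propagation. This makes the limits below jointly measurable in time and space.\<close>

definition fast_index :: "(nat \<Rightarrow> real) \<Rightarrow> nat \<Rightarrow> nat" where
  "fast_index \<beta> = (SOME r. strict_mono r \<and> (\<forall>j. tail_sum \<beta> (r j) \<le> (1 / 16) ^ j))"

definition hlim :: "(nat \<Rightarrow> complex) \<Rightarrow> real \<Rightarrow> complex" where
  "hlim b x = lim (\<lambda>j. hsum b (fast_index (\<lambda>n. cmod (b n)) j) x)"

context
  fixes \<beta> :: "nat \<Rightarrow> real"
  assumes \<beta>: "summable (\<lambda>n. (\<beta> n)\<^sup>2)"
begin

lemma tail_sum_nonneg: "0 \<le> tail_sum \<beta> N"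
  unfolding tail_sum_def using summable_ignore_initial_segment[OF \<beta>] by (intro suminf_nonneg) auto

lemma sum_le_tail_sum: "(\<Sum>n\<in>{M..<N}. (\<beta> n)\<^sup>2) \<le> tail_sum \<beta> M"
proof (cases "M \<le> N")
  case True
  have "(\<Sum>n\<in>{M..<N}. (\<beta> n)\<^sup>2) = (\<Sum>n<N - M. (\<beta> (n + M))\<^sup>2)"
    using True by (intro sum.reindex_bij_witness[of _ "\<lambda>n. n + M" "\<lambda>n. n - M"]) auto
  also have "\<dots> \<le> tail_sum \<beta> M"
    unfolding tail_sum_def using summable_ignore_initial_segment[OF \<beta>] by (intro sum_le_suminf) auto
  finally show ?thesis .
qed (simp add: tail_sum_nonneg)

lemma tail_sum_tendsto_0: "tail_sum \<beta> \<longlonglongrightarrow> 0"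
  unfolding tail_sum_def[abs_def] by (rule suminf_exist_split2[OF \<beta>])

lemma fast_index: "strict_mono (fast_index \<beta>)" "tail_sum \<beta> (fast_index \<beta> j) \<le> (1 / 16) ^ j"
proof -
  have ev: "eventually (\<lambda>n. tail_sum \<beta> n \<le> (1 / 16) ^ j) sequentially" for j
  proof -
    have "eventually (\<lambda>n. tail_sum \<beta> n < (1 / 16) ^ j) sequentially"
      by (rule order_tendstoD(2)[OF tail_sum_tendsto_0]) simp
    then show ?thesis by eventually_elim simp
  qed
  have "\<exists>r. \<forall>j. tail_sum \<beta> (r j) \<le> (1 / 16) ^ j \<and> r j < r (Suc j)"
  proof (rule dependent_nat_choice)
    show "\<exists>n. tail_sum \<beta> n \<le> (1 / 16) ^ 0"
      using eventually_happens[OF ev[of 0]] by simp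
    show "\<exists>m. tail_sum \<beta> m \<le> (1 / 16) ^ Suc j \<and> n < m" for n j
      using eventually_happens[OF eventually_conj[OF ev[of "Suc j"] eventually_gt_at_top[of n]]] by simp
  qed
  then have "\<exists>r. strict_mono r \<and> (\<forall>j. tail_sum \<beta> (r j) \<le> (1 / 16) ^ j)"
    unfolding strict_mono_Suc_iff by blast
  from someI_ex[OF this] show "strict_mono (fast_index \<beta>)" "tail_sum \<beta> (fast_index \<beta> j) \<le> (1 / 16) ^ j"
    unfolding fast_index_def by auto
qed

end

context
  fixes b :: "nat \<Rightarrow> complex" and \<beta> :: "nat \<Rightarrow> real"
  assumes b: "summable (\<lambda>n. (\<beta> n)\<^sup>2)" and \<beta>: "\<beta> = (\<lambda>n. cmod (b n))"
begin

text \<open>The Riesz-Fischer argument. The increments \<open>D j\<close> have squared norm at most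
  16^(-j), so the sum of 4^j times their squares has finite integral. Almost everywhere it is
  therefore finite, which bounds the increments by a geometric sequence of ratio 1/2.\<close>

lemma hsum_fast_index_tendsto: "AE x in lborel. (\<lambda>j. hsum b (fast_index \<beta> j) x) \<longlonglongrightarrow> hlim b x"
proof -
  let ?r = "fast_index \<beta>"
  define D where "D j x = hsum b (?r (Suc j)) x - hsum b (?r j) x" for j x
  have r: "?r j \<le> ?r (Suc j)" for j
    using fast_index(1)[OF b] by (simp add: strict_mono_Suc_iff less_imp_le)
  have [measurable]: "D j \<in> borel_measurable borel" for j
    unfolding D_def[abs_def] by measurable
  have "(\<integral>\<^sup>+x. (\<Sum>j. ennreal (4 ^ j * (cmod (D j x))\<^sup>2)) \<partial>lborel) = (\<Sum>j. \<integral>\<^sup>+x. ennreal (4 ^ j * (cmod (D j x))\<^sup>2)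
      \<partial>lborel)"
    by (intro nn_integral_suminf) measurable
  also have "\<dots> \<le> (\<Sum>j. ennreal ((1 / 4) ^ j))"
  proof (intro suminf_le summableI)
    fix j
    have "(\<integral>\<^sup>+x. ennreal (4 ^ j * (cmod (D j x))\<^sup>2) \<partial>lborel) = ennreal (4 ^ j) * (\<integral>\<^sup>+x. ennreal ((cmod (D j x))\<^sup>2)
        \<partial>lborel)"
      by (simp add: ennreal_mult nn_integral_cmult)
    also have "\<dots> = ennreal (4 ^ j * (\<Sum>n\<in>{?r j..<?r (Suc j)}. (\<beta> n)\<^sup>2))"
      unfolding D_def \<beta> nn_integral_hsum_diff[OF r[unfolded \<beta>]] by (simp add: ennreal_mult sum_nonneg)
    also have "\<dots> \<le> ennreal (4 ^ j * (1 / 16) ^ j)"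
      by (intro ennreal_leI mult_left_mono order.trans[OF sum_le_tail_sum[OF b] fast_index(2)[OF b]]) auto
    also have "4 ^ j * (1 / 16 :: real) ^ j = (1 / 4) ^ j"
      by (simp add: power_mult_distrib[symmetric])
    finally show "(\<integral>\<^sup>+x. ennreal (4 ^ j * (cmod (D j x))\<^sup>2) \<partial>lborel) \<le> ennreal ((1 / 4) ^ j)" .
  qed
  also have "\<dots> < \<infinity>"
    by (subst suminf_ennreal2) (auto intro: summable_geometric)
  finally have "AE x in lborel. (\<Sum>j. ennreal (4 ^ j * (cmod (D j x))\<^sup>2)) \<noteq> \<infinity>"
    by (intro nn_integral_PInf_AE) (auto simp: less_top)
  then show ?thesis
  proof eventually_elim
    case (elim x)
    then have s: "summable (\<lambda>j. 4 ^ j * (cmod (D j x))\<^sup>2)"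
      by (intro summable_suminf_not_top) (auto simp: top_ennreal_def)
    define K where "K = (\<Sum>j. 4 ^ j * (cmod (D j x))\<^sup>2)"
    have D: "cmod (D j x) \<le> sqrt K * (1 / 2) ^ j" for j
    proof (rule power2_le_imp_le)
      have "4 ^ j * (cmod (D j x))\<^sup>2 \<le> K"
        unfolding K_def using sum_le_suminf[OF s, of "{j}"] by simp
      moreover have "0 \<le> K" unfolding K_def by (intro suminf_nonneg s) simp
      moreover have "((1 / 2 :: real) ^ j)\<^sup>2 = 1 / 4 ^ j"
        by (simp add: power2_eq_square power_mult_distrib[symmetric] power_one_over)
      ultimately show "(cmod (D j x))\<^sup>2 \<le> (sqrt K * (1 / 2) ^ j)\<^sup>2"
        by (simp add: power_mult_distrib field_simps)
      show "0 \<le> sqrt K * (1 / 2) ^ j" using \<open>0 \<le> K\<close> by simp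
    qed
    have "summable (\<lambda>j. D j x)"
      by (rule summable_comparison_test'[OF summable_mult[OF summable_geometric] D]) simp
    then have "convergent (\<lambda>n. \<Sum>j<n. D j x)" by (simp add: summable_iff_convergent)
    moreover have "(\<Sum>j<n. D j x) = hsum b (?r n) x - hsum b (?r 0) x" for n
      unfolding D_def by (rule sum_lessThan_telescope)
    ultimately have "convergent (\<lambda>n. (hsum b (?r n) x - hsum b (?r 0) x) + hsum b (?r 0) x)"
      by (intro convergent_add convergent_const) simp
    then show ?case
      unfolding hlim_def \<beta>[symmetric] by (simp add: convergent_LIMSEQ_iff)
  qed
qed

lemma borel_measurable_hlim: "hlim b \<in> borel_measurable borel"
  unfolding hlim_def[abs_def] by measurable

text \<open>Fatou's lemma along the subsequence. The exponent is left open because it serves both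
  the square and the sixth power.\<close>

lemma nn_integral_hlim_diff_le:
  assumes "\<And>j. N \<le> fast_index \<beta> j \<Longrightarrow>
    (\<integral>\<^sup>+x. ennreal (cmod (hsum b (fast_index \<beta> j) x - hsum b N x) ^ k) \<partial>lborel) \<le> C j"
  shows "(\<integral>\<^sup>+x. ennreal (cmod (hlim b x - hsum b N x) ^ k) \<partial>lborel) \<le> liminf C"
proof -
  let ?r = "fast_index \<beta>"
  note [measurable] = borel_measurable_hlim
  have "(\<integral>\<^sup>+x. ennreal (cmod (hlim b x - hsum b N x) ^ k) \<partial>lborel)
    = (\<integral>\<^sup>+x. liminf (\<lambda>j. ennreal (cmod (hsum b (?r j) x - hsum b N x) ^ k)) \<partial>lborel)"
  proof (rule nn_integral_cong_AE)
    show "AE x in lborel. ennreal (cmod (hlim b x - hsum b N x) ^ k) =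
      liminf (\<lambda>j. ennreal (cmod (hsum b (?r j) x - hsum b N x) ^ k))"
      using hsum_fast_index_tendsto
      by eventually_elim (intro lim_imp_Liminf[symmetric] tendsto_ennrealI tendsto_intros; simp)
  qed
  also have "\<dots> \<le> liminf (\<lambda>j. \<integral>\<^sup>+x. ennreal (cmod (hsum b (?r j) x - hsum b N x) ^ k) \<partial>lborel)"
    by (intro nn_integral_liminf) measurable
  also have "\<dots> \<le> liminf C"
  proof (rule Liminf_mono)
    have "eventually (\<lambda>j. N \<le> j) sequentially" by (rule eventually_ge_at_top)
    then show "\<forall>\<^sub>F j in sequentially. (\<integral>\<^sup>+x. ennreal (cmod (hsum b (?r j) x - hsum b N x) ^ k) \<partial>lborel) \<le> C j"
      by eventually_elim (intro assms order.trans[OF _ strict_mono_imp_increasing[OF fast_index(1)[OF b]]])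
  qed
  finally show ?thesis .
qed

lemma hlim_diff_L2:
  "(\<lambda>x. hlim b x - hsum b N x) \<in> L2" "(L2_norm (\<lambda>x. hlim b x - hsum b N x))\<^sup>2 \<le> tail_sum \<beta> N"
proof -
  note [measurable] = borel_measurable_hlim
  have "(\<integral>\<^sup>+x. ennreal ((cmod (hlim b x - hsum b N x))\<^sup>2) \<partial>lborel) \<le> liminf (\<lambda>j. ennreal (tail_sum \<beta> N))"
  proof (rule nn_integral_hlim_diff_le)
    show "(\<integral>\<^sup>+x. ennreal ((cmod (hsum b (fast_index \<beta> j) x - hsum b N x))\<^sup>2) \<partial>lborel) \<le> ennreal (tail_sum \<beta> N)"
      if "N \<le> fast_index \<beta> j" for j
      unfolding nn_integral_hsum_diff[OF that]
      by (intro ennreal_leI sum_le_tail_sum[OF b, unfolded \<beta>, folded \<beta>])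
  qed
  then have le: "(\<integral>\<^sup>+x. ennreal ((cmod (hlim b x - hsum b N x))\<^sup>2) \<partial>lborel) \<le> ennreal (tail_sum \<beta> N)"
    by (simp add: Liminf_const)
  show "(\<lambda>x. hlim b x - hsum b N x) \<in> L2" "(L2_norm (\<lambda>x. hlim b x - hsum b N x))\<^sup>2 \<le> tail_sum \<beta> N"
    by (rule L2_I_nn_integral[OF _ le tail_sum_nonneg[OF b]], measurable)+
qed

lemma hlim_L2: "hlim b \<in> L2"
  using L2_add[OF hlim_diff_L2(1) hsum_L2, of 0 b 0] by simp

lemma L2_norm_hlim_diff_tendsto: "(\<lambda>N. L2_norm (\<lambda>x. hlim b x - hsum b N x)) \<longlonglongrightarrow> 0"
proof (rule tendsto_sandwich[OF always_eventually always_eventually tendsto_const])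
  show "\<forall>N. L2_norm (\<lambda>x. hlim b x - hsum b N x) \<le> sqrt (tail_sum \<beta> N)"
    using hlim_diff_L2(2) by (auto intro: real_le_rsqrt)
  show "(\<lambda>N. sqrt (tail_sum \<beta> N)) \<longlonglongrightarrow> 0"
    using tendsto_real_sqrt[OF tail_sum_tendsto_0[OF b]] by simp
qed (simp add: L2_norm_nonneg)

lemma L2_inner_hlim: "L2_inner (hlim b) (hermite_fun n) = b n"
  by (rule L2_inner_hsum_limit[OF hlim_L2 L2_norm_hlim_diff_tendsto])

end

text \<open>By completeness \<open>f\<close> agrees almost everywhere with the limit of its own
  expansion, so the defect in \<open>bessel_identity\<close> tends to zero.\<close>

theorem parseval:
  assumes f: "f \<in> L2"
  shows "(\<lambda>n. (cmod (L2_inner f (hermite_fun n)))\<^sup>2) sums (L2_norm f)\<^sup>2"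
proof -
  define c where "c n = L2_inner f (hermite_fun n)" for n
  have s: "summable (\<lambda>n. (cmod (c n))\<^sup>2)"
    unfolding c_def by (rule bessel_summable[OF f])
  have "AE x in lebesgue. f x - hlim c x = 0"
    by (rule hermite_fun_complete)
      (simp_all add: L2_diff f hlim_L2[OF s refl] L2_inner_diff_left L2_inner_hlim[OF s refl], simp add: c_def)
  then have "L2_norm (\<lambda>x. f x - hsum c N x) = L2_norm (\<lambda>x. hlim c x - hsum c N x)" for N
    unfolding L2_norm_def using L2_diff[OF f hsum_L2, of c N] hlim_diff_L2(1)[OF s refl, of N]
    by (intro arg_cong[where f = sqrt] integral_cong_AE) (auto simp: L2_def)
  then have "(\<lambda>N. L2_norm (\<lambda>x. f x - hsum c N x)) \<longlonglongrightarrow> 0"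
    using L2_norm_hlim_diff_tendsto[OF s refl] by simp
  then have "(\<lambda>N. (L2_norm f)\<^sup>2 - (L2_norm (\<lambda>x. f x - hsum c N x))\<^sup>2) \<longlonglongrightarrow> (L2_norm f)\<^sup>2 - 0\<^sup>2"
    by (intro tendsto_intros)
  then show ?thesis
    unfolding c_def[abs_def] bessel_identity[OF f] sums_def by simp
qed

section \<open>The propagator on Hermite coefficients\<close>

lemma is_propagated_iff:
  "is_propagated t f g \<longleftrightarrow> g \<in> L2 \<and> (\<lambda>N. L2_norm (\<lambda>x. g x - hsum (\<lambda>n. exp (\<i> * of_real (t * (2 * real n + 1)))
        * L2_inner f (hermite_fun n)) N x)) \<longlonglongrightarrow> 0"
  by (simp add: is_propagated_def hsum_def)

lemma is_propagated_L2_inner: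
  assumes "is_propagated t f g"
  shows "L2_inner g (hermite_fun n) = exp (\<i> * of_real (t * (2 * real n + 1))) * L2_inner f (hermite_fun n)"
  using assms unfolding is_propagated_iff by (intro L2_inner_hsum_limit) auto

definition hcoef :: "(real \<Rightarrow> complex) \<Rightarrow> real \<Rightarrow> nat \<Rightarrow> complex" where
  "hcoef f t n = exp (\<i> * of_real (t * (2 * real n + 1))) * L2_inner f (hermite_fun n)"

lemma norm_hcoef: "cmod (hcoef f t n) = cmod (L2_inner f (hermite_fun n))"
  by (simp add: hcoef_def norm_mult)

lemma is_propagated_hlim:
  assumes f: "f \<in> L2"
  shows "is_propagated t f (hlim (hcoef f t))"
proof -
  have s: "summable (\<lambda>n. (cmod (hcoef f t n))\<^sup>2)"
    unfolding norm_hcoef by (rule bessel_summable[OF f])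
  show ?thesis
    unfolding is_propagated_iff hcoef_def[symmetric]
    using hlim_L2[OF s refl] L2_norm_hlim_diff_tendsto[OF s refl] by simp
qed

lemma is_propagated_propagator: "f \<in> L2 \<Longrightarrow> is_propagated t f (propagator t f)"
  unfolding propagator_def by (rule someI[of "is_propagated t f", OF is_propagated_hlim])

lemma propagator_L2: "f \<in> L2 \<Longrightarrow> propagator t f \<in> L2"
  using is_propagated_propagator by (simp add: is_propagated_def)

text \<open>This exchanges the arbitrary choice made at each time for the explicit representative.
  Both have the same coefficients, so completeness identifies them.\<close>

lemma propagator_AE:
  assumes f: "f \<in> L2"
  shows "AE x in lebesgue. propagator t f x = hlim (hcoef f t) x"
proof -
  note h = is_propagated_hlim[OF f, of t] and p = is_propagated_propagator[OF f, of t]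
  have "AE x in lebesgue. propagator t f x - hlim (hcoef f t) x = 0"
    using h p is_propagated_L2_inner[OF h] is_propagated_L2_inner[OF p]
    by (intro hermite_fun_complete) (auto simp: L2_diff L2_inner_diff_left is_propagated_def)
  then show ?thesis by simp
qed

section \<open>The functional on finite Hermite sums\<close>

definition phase :: "real \<Rightarrow> (nat \<Rightarrow> complex) \<Rightarrow> nat \<Rightarrow> complex" where
  "phase t c n = exp (\<i> * of_real (t * (2 * real n + 1))) * c n"

lemma hcoef_conv_phase: "hcoef f t = phase t (\<lambda>n. L2_inner f (hermite_fun n))"
  by (simp add: fun_eq_iff hcoef_def phase_def)

lemma norm_phase [simp]: "cmod (phase t c n) = cmod (c n)"
  by (simp add: phase_def norm_mult)

text \<open>The Hermite expansion \<open>\<Sum> c\<^sub>n \<phi>\<^sub>n\<close> corresponds to the power series \<open>\<Sum> c\<^sub>n z^n / sqrt (n!)\<close> of its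
  Bargmann transform; its coefficients are \<open>fock c\<close>, and the factors \<open>sqrt (n!)\<close> reappear as \<open>weight\<close>.\<close>

definition fock :: "(nat \<Rightarrow> complex) \<Rightarrow> int \<Rightarrow> complex" where
  "fock c n = (if n < 0 then 0 else c (nat n) / of_real (sqrt (fact (nat n))))"

definition tens :: "(nat \<Rightarrow> complex) \<Rightarrow> (nat \<Rightarrow> complex) \<Rightarrow> (nat \<Rightarrow> complex) \<Rightarrow> int \<Rightarrow> int \<Rightarrow> int \<Rightarrow> complex" where
  "tens a b c i j k = fock a i * fock b j * fock c k"

lemma tens_neg: "i < 0 \<or> j < 0 \<or> k < 0 \<Longrightarrow> tens a b c i j k = 0"
  by (auto simp: tens_def fock_def)

definition truncate :: "nat \<Rightarrow> (nat \<Rightarrow> complex) \<Rightarrow> nat \<Rightarrow> complex" where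
  "truncate N c n = (if n < N then c n else 0)"

lemma hsum_conv_fock:
  "hsum (phase t c) N x = (\<Sum>i\<in>{0..<int N}. exp (\<i> * of_real (t * (2 * real_of_int i + 1)))
      * (fact (nat i) * fock c i * of_real (psi i x)))"
  unfolding hsum_def
proof (rule sum.reindex_bij_witness[of _ nat int])
  fix n assume "n \<in> {..<N}"
  have "sqrt (fact n) * sqrt (fact n) = (fact n :: real)" by simp
  then have "complex_of_real (sqrt (fact n)) * complex_of_real (sqrt (fact n)) = fact n"
    by (simp only: of_real_mult[symmetric] of_real_fact)
  then have "fact n / complex_of_real (sqrt (fact n)) = complex_of_real (sqrt (fact n))"
    by (simp add: field_simps)
  moreover have "fact n * fock c (int n) = fact n / of_real (sqrt (fact n)) * c n"
    by (simp add: fock_def)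
  ultimately have "fact n * fock c (int n) = of_real (sqrt (fact n)) * c n"
    by (simp only:)
  then show "exp (\<i> * of_real (t * (2 * real_of_int (int n) + 1))) * (fact (nat (int n)) * fock c (int n) * of_real
      (psi (int n) x))
    = phase t c n * hermite_fun n x"
    by (simp add: phase_def hermite_fun_psi)
qed auto

lemma prod3_sum:
  fixes f g h :: "'a \<Rightarrow> 'b::comm_semiring_0"
  shows "(\<Sum>i\<in>A. f i) * (\<Sum>j\<in>A. g j) * (\<Sum>k\<in>A. h k) = (\<Sum>(i, j, k)\<in>A \<times> A \<times> A. f i * g j * h k)"
  by (simp only: sum.cartesian_product[symmetric] sum_distrib_left[symmetric] sum_distrib_right[symmetric])

abbreviation quarter :: "real set" where
  "quarter \<equiv> {- pi / 4..pi / 4}"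

text \<open>For even \<open>d\<close> the exponential has pi / 2, the length of the window, as a
  period. Odd frequencies do not integrate to zero here; they meet a vanishing kernel by
  \<open>hkernel_odd'\<close>. The value pi / 2 at \<open>d = 0\<close> cancels the factor 2 / pi in
  \<open>E6\<close>.\<close>

lemma integral_exp_quarter:
  assumes "even d"
  shows "(LBINT t. indicator quarter t *\<^sub>R exp (\<i> * of_real (t * (2 * real_of_int d)))) = (if d = 0 then of_real (pi
      / 2) else 0)"
proof (cases "d = 0")
  case True
  then show ?thesis by (simp add: scaleR_conv_of_real)
next
  case False
  define z where "z = \<i> * (2 * of_int d :: complex)"
  have z: "z \<noteq> 0" using False by (simp add: z_def)
  have "(LBINT t. indicator quarter t *\<^sub>R exp (z * of_real t)) = exp (z * of_real (pi / 4)) / z - exp (z * of_real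
      (- pi / 4)) / z"
  proof (rule integral_FTC_atLeastAtMost)
    show "((\<lambda>t. exp (z * of_real t) / z) has_vector_derivative exp (z * of_real t)) (at t within quarter)" for t
    proof -
      have "((\<lambda>w. exp (z * w) / z) has_field_derivative exp (z * of_real t)) (at (of_real t))"
        using z by (auto intro!: derivative_eq_intros)
      from has_vector_derivative_real_field[OF this] show ?thesis .
    qed
    show "continuous_on quarter (\<lambda>t. exp (z * complex_of_real t))" by (intro continuous_intros)
  qed simp
  also have "exp (z * of_real (pi / 4)) = exp (z * of_real (- pi / 4))"
  proof -
    obtain e where d: "d = 2 * e" using assms by blast
    have "exp (z * of_real (pi / 4)) = exp (z * of_real (- pi / 4) + (2 * of_int e * pi) * \<i>)"
      by (rule arg_cong[where f = exp]) (simp add: z_def d field_simps)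
    also have "\<dots> = exp (z * of_real (- pi / 4))"
      by (subst exp_eq, intro exI[of _ e]) simp
    finally show ?thesis .
  qed
  finally show ?thesis
    using False by (simp add: z_def mult_ac)
qed

lemma hkernel_odd': "odd (i + j + k - a - b - c) \<Longrightarrow> hkernel i j k a b c = 0"
proof -
  assume odd: "odd (i + j + k - a - b - c)"
  show ?thesis
  proof (cases "0 \<le> i \<and> 0 \<le> j \<and> 0 \<le> k \<and> 0 \<le> a \<and> 0 \<le> b \<and> 0 \<le> c")
    case True
    have "i + j + k - a - b - c = int (nat i + nat j + nat k + nat a + nat b + nat c) - 2 * (a + b + c)"
      using True by simp
    moreover have "odd (s - 2 * m) \<Longrightarrow> odd s" for s m :: int by presburger
    ultimately have "odd (int (nat i + nat j + nat k + nat a + nat b + nat c))"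
      using odd by metis
    then have "odd (nat i + nat j + nat k + nat a + nat b + nat c)" by (metis even_of_nat)
    from hkernel_odd[OF this] show ?thesis using True by simp
  next
    case False
    then show ?thesis using hkernel.neg hkernel.neg2 hkernel.neg3 hkernel.neg' by (meson not_le)
  qed
qed

lemma hkernel_integral_exp:
  "(LBINT t. indicator quarter t *\<^sub>R exp (\<i> * of_real (t * (2 * real_of_int (i + j + k - a - b - c))))) * of_real
      (hkernel i j k a b c)
   = (if i + j + k = a + b + c then of_real (pi / 2) * of_real (hkernel i j k a b c) else 0)"
  using hkernel_odd'[of i j k a b c] integral_exp_quarter[of "i + j + k - a - b - c"]
  by (cases "even (i + j + k - a - b - c)") auto

section \<open>The space-time integral of finite expansions\<close>

abbreviation box :: "nat \<Rightarrow> (int \<times> int \<times> int) set" where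
  "box N \<equiv> {0..<int N} \<times> {0..<int N} \<times> {0..<int N}"

definition E6_coeff :: "(nat \<Rightarrow> complex) \<Rightarrow> (nat \<Rightarrow> complex) \<Rightarrow> (nat \<Rightarrow> complex) \<Rightarrow> (nat \<Rightarrow> complex) \<Rightarrow> (nat \<Rightarrow> complex) \<Rightarrow>
    (nat \<Rightarrow> complex) \<Rightarrow>
    int \<times> int \<times> int \<Rightarrow> int \<times> int \<times> int \<Rightarrow> complex" where
  "E6_coeff c1 c2 c3 c4 c5 c6 = (\<lambda>(i, j, k) (a, b, c). of_real (weight i j k * weight a b c) * tens c1 c2 c3 i j k *
      cnj (tens c4 c5 c6 a b c))"

definition hprod :: "(nat \<Rightarrow> complex) \<Rightarrow> (nat \<Rightarrow> complex) \<Rightarrow> (nat \<Rightarrow> complex) \<Rightarrow> (nat \<Rightarrow> complex) \<Rightarrow> (nat \<Rightarrow> complex) \<Rightarrow> (nat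
    \<Rightarrow> complex) \<Rightarrow>
    nat \<Rightarrow> real \<Rightarrow> real \<Rightarrow> complex" where
  "hprod c1 c2 c3 c4 c5 c6 N t x = hsum (phase t c1) N x * hsum (phase t c2) N x * hsum (phase t c3) N x
     * cnj (hsum (phase t c4) N x * hsum (phase t c5) N x * hsum (phase t c6) N x)"

context
  fixes c1 c2 c3 c4 c5 c6 :: "nat \<Rightarrow> complex" and N :: nat
begin

lemma hprod_eq:
  "hprod c1 c2 c3 c4 c5 c6 N t x = (\<Sum>p\<in>box N. \<Sum>q\<in>box N. case p of (i, j, k) \<Rightarrow> case q of (a, b, c) \<Rightarrow>
     exp (\<i> * of_real (t * (2 * real_of_int (i + j + k - a - b - c))))
     * E6_coeff c1 c2 c3 c4 c5 c6 (i, j, k) (a, b, c) * of_real (psi_prod i j k a b c x))"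
proof -
  define e where "e i = exp (\<i> * of_real (t * (2 * real_of_int i + 1)))" for i
  have e: "e i * e j * e k * cnj (e a * e b * e c) = exp (\<i> * of_real (t * (2 * real_of_int (i + j + k - a - b -
      c))))" for i j k a b c
    unfolding e_def complex_cnj_mult exp_cnj exp_add[symmetric] by (simp add: algebra_simps)
  have "hprod c1 c2 c3 c4 c5 c6 N t x =
    (\<Sum>(i, j, k)\<in>box N. (e i * (fact (nat i) * fock c1 i * of_real (psi i x))) * (e j * (fact (nat j) * fock c2 j *
        of_real (psi j x)))
      * (e k * (fact (nat k) * fock c3 k * of_real (psi k x))))
  * cnj (\<Sum>(a, b, c)\<in>box N. (e a * (fact (nat a) * fock c4 a * of_real (psi a x))) * (e b * (fact (nat b) * fock c5 b
      * of_real (psi b x)))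
      * (e c * (fact (nat c) * fock c6 c * of_real (psi c x))))"
    unfolding hprod_def hsum_conv_fock e_def[symmetric] prod3_sum ..
  also have "\<dots> = (\<Sum>p\<in>box N. \<Sum>q\<in>box N. case p of (i, j, k) \<Rightarrow> case q of (a, b, c) \<Rightarrow>
     (e i * e j * e k * cnj (e a * e b * e c))
     * E6_coeff c1 c2 c3 c4 c5 c6 (i, j, k) (a, b, c) * of_real (psi_prod i j k a b c x))"
    unfolding cnj_sum sum_product
    by (intro sum.cong refl) (auto simp: E6_coeff_def tens_def weight_def psi_prod_def mult_ac)
  finally show ?thesis unfolding e .
qed

lemma integrable_hprod: "integrable lborel (hprod c1 c2 c3 c4 c5 c6 N t)"
  unfolding hprod_eq[abs_def]
  by (intro Bochner_Integration.integrable_sum) (auto intro!: integrable_mult_right integrable_of_real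
      integrable_psi_prod)

lemma integral_hprod:
  "(LBINT x. hprod c1 c2 c3 c4 c5 c6 N t x) = (\<Sum>p\<in>box N. \<Sum>q\<in>box N. case p of (i, j, k) \<Rightarrow> case q of (a, b, c) \<Rightarrow>
     exp (\<i> * of_real (t * (2 * real_of_int (i + j + k - a - b - c))))
     * (E6_coeff c1 c2 c3 c4 c5 c6 (i, j, k) (a, b, c) * of_real (hkernel i j k a b c / (pi * sqrt 3))))"
proof -
  have k: "(LBINT x. psi_prod i j k a b c x) = hkernel i j k a b c / (pi * sqrt 3)" for i j k a b c
    by (simp add: hkernel_def)
  have i: "integrable lborel (\<lambda>x. exp (\<i> * of_real (t * (2 * real_of_int (i + j + k - a - b - c))))
     * E6_coeff c1 c2 c3 c4 c5 c6 (i, j, k) (a, b, c) * of_real (psi_prod i j k a b c x))" for i j k a b c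
    by (intro integrable_mult_right integrable_of_real integrable_psi_prod)
  show ?thesis
    unfolding hprod_eq split_def
    by (subst Bochner_Integration.integral_sum, intro Bochner_Integration.integrable_sum i[unfolded split_def
        prod.collapse],
        intro sum.cong refl, subst Bochner_Integration.integral_sum, intro i[unfolded split_def prod.collapse],
        intro sum.cong refl)
      (simp only: integral_mult_right_zero integral_complex_of_real k mult.assoc)
qed

text \<open>The constant is pi / 2 from the time integral divided by \<open>pi * sqrt 3\<close> from
  the normalisation of \<open>hkernel\<close>.\<close>

lemma integral_integral_hprod:
  "integrable lborel (\<lambda>t. indicator quarter t *\<^sub>R (LBINT x. hprod c1 c2 c3 c4 c5 c6 N t x))"
  "(LBINT t. indicator quarter t *\<^sub>R (LBINT x. hprod c1 c2 c3 c4 c5 c6 N t x)) =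
    1 / (2 * sqrt 3) * (\<Sum>p\<in>box N. \<Sum>q\<in>box N. case p of (i, j, k) \<Rightarrow> case q of (a, b, c) \<Rightarrow>
     if i + j + k = a + b + c then E6_coeff c1 c2 c3 c4 c5 c6 (i, j, k) (a, b, c) * of_real (hkernel i j k a b c)
         else 0)"
proof -
  define \<tau> where "\<tau> d t = indicator quarter t *\<^sub>R exp (\<i> * of_real (t * (2 * real_of_int d)))" for d t
  have i: "integrable lborel (\<lambda>t. \<tau> d t * w)" for d w
    unfolding \<tau>_def
    by (intro integrable_mult_left borel_integrable_compact) (auto intro!: continuous_intros)
  have e: "indicator quarter t *\<^sub>R (LBINT x. hprod c1 c2 c3 c4 c5 c6 N t x) =
    (\<Sum>p\<in>box N. \<Sum>q\<in>box N. case p of (i, j, k) \<Rightarrow> case q of (a, b, c) \<Rightarrow>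
     \<tau> (i + j + k - a - b - c) t
     * (E6_coeff c1 c2 c3 c4 c5 c6 (i, j, k) (a, b, c) * of_real (hkernel i j k a b c / (pi * sqrt 3))))" for t
    unfolding integral_hprod scaleR_sum_right \<tau>_def by (intro sum.cong refl) (auto simp: scaleR_conv_of_real mult.assoc)
  show "integrable lborel (\<lambda>t. indicator quarter t *\<^sub>R (LBINT x. hprod c1 c2 c3 c4 c5 c6 N t x))"
    unfolding e by (intro Bochner_Integration.integrable_sum) (auto intro!: i)
  have "(LBINT t. indicator quarter t *\<^sub>R (LBINT x. hprod c1 c2 c3 c4 c5 c6 N t x)) =
    (\<Sum>p\<in>box N. \<Sum>q\<in>box N. case p of (i, j, k) \<Rightarrow> case q of (a, b, c) \<Rightarrow>
     (LBINT t. \<tau> (i + j + k - a - b - c) t)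
     * (E6_coeff c1 c2 c3 c4 c5 c6 (i, j, k) (a, b, c) * of_real (hkernel i j k a b c / (pi * sqrt 3))))"
    unfolding e split_def
    by (subst Bochner_Integration.integral_sum, intro Bochner_Integration.integrable_sum i,
        intro sum.cong refl, subst Bochner_Integration.integral_sum, intro i,
        intro sum.cong refl)
      (simp only: integral_mult_left_zero)
  also have "\<dots> = 1 / (2 * sqrt 3) * (\<Sum>p\<in>box N. \<Sum>q\<in>box N. case p of (i, j, k) \<Rightarrow> case q of (a, b, c) \<Rightarrow>
     if i + j + k = a + b + c then E6_coeff c1 c2 c3 c4 c5 c6 (i, j, k) (a, b, c) * of_real (hkernel i j k a b c)
         else 0)"
    unfolding sum_distrib_left
  proof (intro sum.cong refl)
    fix p q :: "int \<times> int \<times> int"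
    obtain i j k a b c where pq: "p = (i, j, k)" "q = (a, b, c)" by (cases p, cases q) auto
    let ?C = "E6_coeff c1 c2 c3 c4 c5 c6 (i, j, k) (a, b, c)"
    have "(LBINT t. \<tau> (i + j + k - a - b - c) t) * (?C * of_real (hkernel i j k a b c / (pi * sqrt 3)))
      = ((LBINT t. \<tau> (i + j + k - a - b - c) t) * of_real (hkernel i j k a b c)) * ?C / (pi * sqrt 3)"
      by simp
    also have "\<dots> = 1 / (2 * sqrt 3) * (if i + j + k = a + b + c then ?C * of_real (hkernel i j k a b c) else 0)"
      unfolding \<tau>_def hkernel_integral_exp by simp
    finally show "(case p of (i, j, k) \<Rightarrow> case q of (a, b, c) \<Rightarrow>
       (LBINT t. \<tau> (i + j + k - a - b - c) t) * (E6_coeff c1 c2 c3 c4 c5 c6 (i, j, k) (a, b, c) * of_real (hkernel i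
           j k a b c / (pi * sqrt 3)))) =
       1 / (2 * sqrt 3) * (case p of (i, j, k) \<Rightarrow> case q of (a, b, c) \<Rightarrow>
         if i + j + k = a + b + c then E6_coeff c1 c2 c3 c4 c5 c6 (i, j, k) (a, b, c) * of_real (hkernel i j k a b
             c) else 0)"
      unfolding pq by simp
  qed
  finally show "(LBINT t. indicator quarter t *\<^sub>R (LBINT x. hprod c1 c2 c3 c4 c5 c6 N t x)) =
    1 / (2 * sqrt 3) * (\<Sum>p\<in>box N. \<Sum>q\<in>box N. case p of (i, j, k) \<Rightarrow> case q of (a, b, c) \<Rightarrow>
     if i + j + k = a + b + c then E6_coeff c1 c2 c3 c4 c5 c6 (i, j, k) (a, b, c) * of_real (hkernel i j k a b c)
         else 0)" .
qed

end

lemma fock_truncate: "fock (truncate N c) n = (if n < int N then fock c n else 0)"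
  by (auto simp: fock_def truncate_def)

lemma tens_truncate_outside:
  "(i, j, k) \<notin> box N \<Longrightarrow> tens (truncate N a) (truncate N b) (truncate N c) i j k = 0"
  by (auto simp: tens_def fock_truncate) (auto simp: fock_def)

text \<open>The condition left by the time integral says that both triples lie on the same level.
  Grouping by level recovers the series of \<open>pairing\<close>, which is finite because levels in
  \<open>box N\<close> stay below \<open>3 * N\<close>.\<close>

lemma pairing_truncate:
  fixes c1 c2 c3 c4 c5 c6 :: "nat \<Rightarrow> complex" and N :: nat
  defines "d \<equiv> truncate N"
  shows "hkernel.pairing (tens (d c1) (d c2) (d c3)) (tens (d c4) (d c5) (d c6)) =
    (\<Sum>p\<in>box N. \<Sum>q\<in>box N. case p of (i, j, k) \<Rightarrow> case q of (a, b, c) \<Rightarrow>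
     if i + j + k = a + b + c then E6_coeff c1 c2 c3 c4 c5 c6 (i, j, k) (a, b, c) * of_real (hkernel i j k a b c)
         else 0)"
proof -
  let ?F = "tens (d c1) (d c2) (d c3)" and ?G = "tens (d c4) (d c5) (d c6)"
  define lev where "lev p = (case p of (i, j, k) \<Rightarrow> nat (i + j + k))" for p :: "int \<times> int \<times> int"
  define h where "h p q = (case p of (i, j, k) \<Rightarrow> case q of (a, b, c) \<Rightarrow>
     E6_coeff (d c1) (d c2) (d c3) (d c4) (d c5) (d c6) (i, j, k) (a, b, c) * of_real (hkernel i j k a b c))" for p q
  have h0: "h p q = 0" if "p \<notin> box N \<or> q \<notin> box N" for p q
  proof -
    obtain i j k a b c where pq: "p = (i, j, k)" "q = (a, b, c)" by (cases p, cases q) auto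
    from that have "tens (d c1) (d c2) (d c3) i j k = 0 \<or> tens (d c4) (d c5) (d c6) a b c = 0"
      unfolding pq d_def using tens_truncate_outside by blast
    then show ?thesis by (auto simp: pq h_def E6_coeff_def)
  qed
  have box_lev: "{p \<in> box N. lev p = L} = triples L \<inter> box N" for L
    by (auto simp: lev_def triples_def)
  have inner: "level_inner L (hkernel.proj L ?F) ?G = (\<Sum>p | p \<in> box N \<and> lev p = L. \<Sum>q | q \<in> box N \<and> lev q = L. h p
      q)" for L
  proof -
    have "level_inner L (hkernel.proj L ?F) ?G = (\<Sum>q\<in>triples L. \<Sum>p\<in>triples L. h p q)"
      unfolding level_inner_def hkernel.proj_def
      by (intro sum.cong refl) (auto simp: h_def E6_coeff_def sum_distrib_left sum_distrib_right hkernel.sym mult_ac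
          intro!: sum.cong)
    also have "\<dots> = (\<Sum>p\<in>triples L. \<Sum>q\<in>triples L. h p q)" by (rule sum.swap)
    also have "\<dots> = (\<Sum>p\<in>triples L \<inter> box N. \<Sum>q\<in>triples L. h p q)"
      by (intro sum.mono_neutral_right) (auto simp: h0)
    also have "\<dots> = (\<Sum>p\<in>triples L \<inter> box N. \<Sum>q\<in>triples L \<inter> box N. h p q)"
      by (intro sum.cong refl sum.mono_neutral_right) (auto simp: h0)
    finally show ?thesis unfolding box_lev .
  qed
  have "level_inner L (hkernel.proj L ?F) ?G = 0" if "L \<notin> {..<3 * N}" for L
    unfolding inner using that by (intro sum.neutral) (auto simp: lev_def)
  then have "hkernel.pairing ?F ?G = (\<Sum>L<3 * N. level_inner L (hkernel.proj L ?F) ?G)"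
    unfolding hkernel.pairing_def by (intro suminf_finite) auto
  also have "\<dots> = (\<Sum>L<3 * N. \<Sum>p | p \<in> box N \<and> lev p = L. \<Sum>q | q \<in> box N \<and> lev q = lev p. h p q)"
    unfolding inner by (intro sum.cong refl) auto
  also have "\<dots> = (\<Sum>p\<in>box N. \<Sum>q | q \<in> box N \<and> lev q = lev p. h p q)"
    by (intro sum.group) (auto simp: lev_def)
  also have "\<dots> = (\<Sum>p\<in>box N. \<Sum>q\<in>box N. if lev q = lev p then h p q else 0)"
    by (intro sum.cong refl sum.inter_filter) auto
  also have "\<dots> = (\<Sum>p\<in>box N. \<Sum>q\<in>box N. case p of (i, j, k) \<Rightarrow> case q of (a, b, c) \<Rightarrow>
     if i + j + k = a + b + c then E6_coeff c1 c2 c3 c4 c5 c6 (i, j, k) (a, b, c) * of_real (hkernel i j k a b c)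
         else 0)"
    by (intro sum.cong refl) (auto simp: h_def lev_def E6_coeff_def tens_def d_def fock_truncate)
  finally show ?thesis .
qed

lemma integral_hprod_pairing:
  fixes c1 c2 c3 c4 c5 c6 :: "nat \<Rightarrow> complex" and N :: nat
  defines "d \<equiv> truncate N"
  shows "(LBINT t. indicator quarter t *\<^sub>R (LBINT x. hprod c1 c2 c3 c4 c5 c6 N t x)) =
    1 / (2 * sqrt 3) * hkernel.pairing (tens (d c1) (d c2) (d c3)) (tens (d c4) (d c5) (d c6))"
  unfolding d_def pairing_truncate integral_integral_hprod ..

section \<open>Estimates in the sixth power norm\<close>

text \<open>The factorials in \<open>weight\<close> cancel those in \<open>fock\<close>, so the
  level sums are a threefold Cauchy product of the squared coefficients.\<close>

lemma tens_level_sqnorm_sums: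
  assumes "summable (\<lambda>n. (cmod (a n))\<^sup>2)" "summable (\<lambda>n. (cmod (b n))\<^sup>2)" "summable (\<lambda>n. (cmod (c n))\<^sup>2)"
  shows "(\<lambda>L. level_sqnorm L (tens a b c)) sums
    ((\<Sum>n. (cmod (a n))\<^sup>2) * (\<Sum>n. (cmod (b n))\<^sup>2) * (\<Sum>n. (cmod (c n))\<^sup>2))"
proof -
  define \<alpha> \<beta> \<gamma> where "\<alpha> n = (cmod (a n))\<^sup>2" and "\<beta> n = (cmod (b n))\<^sup>2" and "\<gamma> n = (cmod (c n))\<^sup>2" for n
  have nn: "norm (\<alpha> n) = \<alpha> n" "norm (\<beta> n) = \<beta> n" "norm (\<gamma> n) = \<gamma> n" for n
    by (auto simp: \<alpha>_def \<beta>_def \<gamma>_def)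
  define \<delta> where "\<delta> n = (\<Sum>i\<le>n. \<alpha> i * \<beta> (n - i))" for n
  have \<delta>: "\<delta> sums (suminf \<alpha> * suminf \<beta>)"
    unfolding \<delta>_def[abs_def]
    by (rule Cauchy_product_sums; simp only: nn; simp add: \<alpha>_def \<beta>_def assms)
  have "norm (\<delta> n) = \<delta> n" for n
    unfolding \<delta>_def real_norm_def by (intro abs_of_nonneg sum_nonneg) (simp add: \<alpha>_def \<beta>_def)
  then have "(\<lambda>L. \<Sum>n\<le>L. \<delta> n * \<gamma> (L - n)) sums (suminf \<delta> * suminf \<gamma>)"
    by (intro Cauchy_product_sums) (simp_all only: nn sums_summable[OF \<delta>], simp add: \<gamma>_def assms)
  moreover have "(\<Sum>n\<le>L. \<delta> n * \<gamma> (L - n)) = level_sqnorm L (tens a b c)" for L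
  proof -
    have f: "weight (int i) (int j) (int k) * (cmod (tens a b c (int i) (int j) (int k)))\<^sup>2 = \<alpha> i * \<beta> j * \<gamma> k" for i j k
      by (simp add: weight_def tens_def fock_def \<alpha>_def \<beta>_def \<gamma>_def norm_mult norm_divide power_mult_distrib
          power_divide)
    have f': "weight (int i) (int n - int i) (int L - int n) * (cmod (tens a b c (int i) (int n - int i) (int L -
        int n)))\<^sup>2
        = \<alpha> i * \<beta> (n - i) * \<gamma> (L - n)" if "i \<le> n" "n \<le> L" for i n
      using f[of i "n - i" "L - n"] that by (simp add: of_nat_diff)
    have "(\<Sum>n\<le>L. \<delta> n * \<gamma> (L - n)) = (\<Sum>n\<le>L. \<Sum>i\<le>n. \<alpha> i * \<beta> (n - i) * \<gamma> (L - n))"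
      by (simp add: \<delta>_def sum_distrib_right)
    also have "\<dots> = (\<Sum>(n, i)\<in>(SIGMA n:{..L}. {..n}). \<alpha> i * \<beta> (n - i) * \<gamma> (L - n))"
      by (rule sum.Sigma) auto
    also have "\<dots> = level_sqnorm L (tens a b c)"
      unfolding level_sqnorm_def
      by (rule sum.reindex_bij_witness[where j = "\<lambda>(n, i). (int i, int (n - i), int (L - n))"
            and i = "\<lambda>(i, j, k). (nat (i + j), nat i)"])
        (auto simp: triples_def f' nat_add_distrib)
    finally show ?thesis .
  qed
  ultimately show ?thesis
    using sums_unique[OF \<delta>] by (simp add: \<alpha>_def[abs_def] \<beta>_def[abs_def] \<gamma>_def[abs_def])
qed

lemma sums_truncate:
  "(\<lambda>n. (cmod (truncate N c n))\<^sup>2) sums (\<Sum>n<N. (cmod (c n))\<^sup>2)"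
proof -
  have "(\<lambda>n. (cmod (truncate N c n))\<^sup>2) sums (\<Sum>n<N. (cmod (truncate N c n))\<^sup>2)"
    by (rule sums_finite) (auto simp: truncate_def)
  then show ?thesis by (simp add: truncate_def)
qed

lemma hprod_diag: "hprod c c c c c c N t x = of_real (cmod (hsum (phase t c) N x) ^ 6)"
proof -
  have "hprod c c c c c c N t x = (hsum (phase t c) N x * cnj (hsum (phase t c) N x)) ^ 3"
    by (simp add: hprod_def power3_eq_cube mult_ac)
  also have "\<dots> = of_real (((cmod (hsum (phase t c) N x))\<^sup>2) ^ 3)"
    unfolding complex_norm_square[symmetric] by simp
  finally show ?thesis by (simp add: power_mult[symmetric])
qed

text \<open>A Strichartz estimate: with all six arguments equal the integrand is a sixth power, and
  the multilinear identity together with \<open>norm_pairing_le\<close> bounds its integral.\<close>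

lemma nn_integral_hsum_6:
  "(\<integral>\<^sup>+t. indicator quarter t * (\<integral>\<^sup>+x. ennreal (cmod (hsum (phase t c) N x) ^ 6) \<partial>lborel) \<partial>lborel)
    \<le> ennreal (1 / (2 * sqrt 3) * (\<Sum>n<N. (cmod (c n))\<^sup>2) ^ 3)"
proof -
  let ?g = "\<lambda>t. LBINT x. cmod (hsum (phase t c) N x) ^ 6"
  let ?T = "tens (truncate N c) (truncate N c) (truncate N c)"
  let ?A = "(\<Sum>n<N. (cmod (c n))\<^sup>2)"
  have ix: "integrable lborel (\<lambda>x. cmod (hsum (phase t c) N x) ^ 6)" for t
    using integrable_Re[OF integrable_hprod[of c c c c c c N t]] by (simp add: hprod_diag del: of_real_power)
  have gx: "(LBINT x. hprod c c c c c c N t x) = of_real (?g t)" for t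
    unfolding hprod_diag integral_complex_of_real ..
  have it: "integrable lborel (\<lambda>t. indicator quarter t * ?g t)"
    using integrable_Re[OF integral_integral_hprod(1)[of c c c c c c N]] by (simp add: gx del: of_real_power)
  have "complex_of_real (LBINT t. indicator quarter t * ?g t)
    = (LBINT t. indicator quarter t *\<^sub>R (LBINT x. hprod c c c c c c N t x))"
    unfolding gx scaleR_conv_of_real of_real_mult[symmetric] integral_complex_of_real ..
  also have "\<dots> = 1 / (2 * sqrt 3) * hkernel.pairing ?T ?T"
    by (rule integral_hprod_pairing)
  finally have "cmod (complex_of_real (LBINT t. indicator quarter t * ?g t)) = cmod (1 / (2 * sqrt 3) *
      hkernel.pairing ?T ?T)"
    by (rule arg_cong)
  then have "\<bar>LBINT t. indicator quarter t * ?g t\<bar> = 1 / (2 * sqrt 3) * cmod (hkernel.pairing ?T ?T)"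
    by (simp add: norm_mult norm_divide)
  moreover have "cmod (hkernel.pairing ?T ?T) \<le> ?A ^ 3"
  proof (rule power2_le_imp_le)
    have "(\<lambda>L. level_sqnorm L ?T) sums (?A * ?A * ?A)"
      using tens_level_sqnorm_sums[OF sums_truncate[THEN sums_summable] sums_truncate[THEN sums_summable]
          sums_truncate[THEN sums_summable], of N c N c N c]
      unfolding sums_truncate[THEN sums_unique, symmetric] .
    from hkernel.norm_pairing_le[OF this this]
    show "(cmod (hkernel.pairing ?T ?T))\<^sup>2 \<le> (?A ^ 3)\<^sup>2"
      by (simp add: power2_eq_square power3_eq_cube)
  qed (simp add: sum_nonneg)
  then have "1 / (2 * sqrt 3) * cmod (hkernel.pairing ?T ?T) \<le> 1 / (2 * sqrt 3) * ?A ^ 3"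
    by (intro mult_left_mono) auto
  ultimately have "(LBINT t. indicator quarter t * ?g t) \<le> 1 / (2 * sqrt 3) * ?A ^ 3"
    by linarith
  moreover have "(\<integral>\<^sup>+t. indicator quarter t * (\<integral>\<^sup>+x. ennreal (cmod (hsum (phase t c) N x) ^ 6) \<partial>lborel) \<partial>lborel)
    = (\<integral>\<^sup>+t. ennreal (indicator quarter t * ?g t) \<partial>lborel)"
    by (intro nn_integral_cong) (auto simp: nn_integral_eq_integral[OF ix] split: split_indicator)
  moreover have "(\<integral>\<^sup>+t. ennreal (indicator quarter t * ?g t) \<partial>lborel) = ennreal (LBINT t. indicator quarter t * ?g t)"
    by (intro nn_integral_eq_integral it) (auto intro!: mult_nonneg_nonneg integral_nonneg)
  ultimately show ?thesis by (simp add: ennreal_leI)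
qed

lemma nn_integral_hsum_diff_6:
  assumes s: "summable (\<lambda>n. (cmod (c n))\<^sup>2)" and "M \<le> N"
  shows "(\<integral>\<^sup>+t. indicator quarter t * (\<integral>\<^sup>+x. ennreal (cmod (hsum (phase t c) N x - hsum (phase t c) M x) ^ 6)
      \<partial>lborel) \<partial>lborel)
    \<le> ennreal (1 / (2 * sqrt 3) * tail_sum (\<lambda>n. cmod (c n)) M ^ 3)"
proof -
  \<comment> \<open>With the coefficients below \<open>M\<close> deleted, the difference is itself a
    partial sum to which the Strichartz estimate applies.\<close>
  define d where "d n = (if n < M then 0 else c n)" for n
  have "hsum (phase t c) N x - hsum (phase t c) M x = hsum (phase t d) N x" for t x
  proof -
    have "hsum (phase t d) N x = (\<Sum>n\<in>{M..<N}. phase t c n * hermite_fun n x)"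
      unfolding hsum_def by (rule sum.mono_neutral_cong_right) (auto simp: phase_def d_def)
    also have "\<dots> = hsum (phase t c) N x - hsum (phase t c) M x"
      using assms(2) unfolding hsum_def lessThan_atLeast0 by (simp add: sum_diff_nat_ivl)
    finally show ?thesis ..
  qed
  then have "(\<integral>\<^sup>+t. indicator quarter t * (\<integral>\<^sup>+x. ennreal (cmod (hsum (phase t c) N x - hsum (phase t c) M x) ^ 6)
      \<partial>lborel) \<partial>lborel)
    \<le> ennreal (1 / (2 * sqrt 3) * (\<Sum>n<N. (cmod (d n))\<^sup>2) ^ 3)"
    by (simp only: nn_integral_hsum_6)
  also have "(\<Sum>n<N. (cmod (d n))\<^sup>2) = (\<Sum>n\<in>{M..<N}. (cmod (c n))\<^sup>2)"
    by (rule sum.mono_neutral_cong_right) (auto simp: d_def)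
  also have "ennreal (1 / (2 * sqrt 3) * (\<Sum>n\<in>{M..<N}. (cmod (c n))\<^sup>2) ^ 3) \<le> ennreal (1 / (2 * sqrt 3) * tail_sum
      (\<lambda>n. cmod (c n)) M ^ 3)"
    by (intro ennreal_leI mult_left_mono power_mono sum_le_tail_sum[OF s] sum_nonneg) auto
  finally show ?thesis .
qed

lemma borel_measurable_hsum_phase [measurable]:
  "(\<lambda>p. hsum (phase (fst p) c) N (snd p)) \<in> borel_measurable (lborel \<Otimes>\<^sub>M lborel)"
  unfolding hsum_def phase_def by measurable

lemma hlim_phase: "hlim (phase t c) x = lim (\<lambda>j. hsum (phase t c) (fast_index (\<lambda>n. cmod (c n)) j) x)"
  by (simp add: hlim_def)

lemma borel_measurable_hlim_phase [measurable]:
  "(\<lambda>p. hlim (phase (fst p) c) (snd p)) \<in> borel_measurable (lborel \<Otimes>\<^sub>M lborel)"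
  unfolding hlim_phase by measurable

text \<open>Fatou twice, first in space and then in time. The second use requires that the
  subsequence is the same for all times.\<close>

lemma nn_integral_hlim_diff_6:
  assumes s: "summable (\<lambda>n. (cmod (c n))\<^sup>2)"
  shows "(\<integral>\<^sup>+t. indicator quarter t * (\<integral>\<^sup>+x. ennreal (cmod (hlim (phase t c) x - hsum (phase t c) N x) ^ 6) \<partial>lborel)
      \<partial>lborel)
    \<le> ennreal (1 / (2 * sqrt 3) * tail_sum (\<lambda>n. cmod (c n)) N ^ 3)" (is "_ \<le> ?B")
proof -
  let ?r = "fast_index (\<lambda>n. cmod (c n))"
  define C where "C j t = (\<integral>\<^sup>+x. ennreal (cmod (hsum (phase t c) (?r j) x - hsum (phase t c) N x) ^ 6) \<partial>lborel)" for j t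
  have [measurable]: "C j \<in> borel_measurable borel" for j
  proof -
    have "(\<lambda>t. \<integral>\<^sup>+x. (\<lambda>p. ennreal (cmod (hsum (phase (fst p) c) (?r j) (snd p) - hsum (phase (fst p) c) N (snd p)) ^
        6)) (t, x) \<partial>lborel) \<in> borel_measurable lborel"
      by (rule lborel.borel_measurable_nn_integral_fst) measurable
    then show ?thesis by (simp add: C_def[abs_def])
  qed
  have "(\<integral>\<^sup>+t. indicator quarter t * (\<integral>\<^sup>+x. ennreal (cmod (hlim (phase t c) x - hsum (phase t c) N x) ^ 6) \<partial>lborel)
      \<partial>lborel)
    \<le> (\<integral>\<^sup>+t. liminf (\<lambda>j. indicator quarter t * C j t) \<partial>lborel)"
  proof (intro nn_integral_mono)
    fix t
    have "(\<integral>\<^sup>+x. ennreal (cmod (hlim (phase t c) x - hsum (phase t c) N x) ^ 6) \<partial>lborel) \<le> liminf (\<lambda>j. C j t)"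
      by (rule nn_integral_hlim_diff_le[where \<beta> = "\<lambda>n. cmod (c n)"]) (simp_all add: s C_def)
    then show "indicator quarter t * (\<integral>\<^sup>+x. ennreal (cmod (hlim (phase t c) x - hsum (phase t c) N x) ^ 6) \<partial>lborel)
      \<le> liminf (\<lambda>j. indicator quarter t * C j t)"
      by (simp split: split_indicator)
  qed
  also have "\<dots> \<le> liminf (\<lambda>j. \<integral>\<^sup>+t. indicator quarter t * C j t \<partial>lborel)"
    by (intro nn_integral_liminf) measurable
  also have "\<dots> \<le> liminf (\<lambda>j::nat. ?B)"
  proof (rule Liminf_mono)
    show "\<forall>\<^sub>F j in sequentially. (\<integral>\<^sup>+t. indicator quarter t * C j t \<partial>lborel) \<le> ?B"
      using eventually_ge_at_top[of N]
    proof eventually_elim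
      case (elim j)
      then have "N \<le> ?r j"
        using strict_mono_imp_increasing[OF fast_index(1)[OF s], of j] by simp
      then show ?case
        unfolding C_def by (rule nn_integral_hsum_diff_6[OF s])
    qed
  qed
  finally show ?thesis by (simp add: Liminf_const)
qed

text \<open>A pointwise stand-in for the generalised Hoelder inequality, with only n-th powers on
  the right. Dividing all factors by the common bound \<open>m\<close> puts them in the unit disc,
  where products are Lipschitz; this gives \<open>m ^ l * \<epsilon>\<close>.\<close>

lemma norm_prod_diff_le:
  fixes a b :: "'i \<Rightarrow> complex"
  assumes fin: "finite K" and \<delta>: "0 < \<delta>" "\<delta> \<le> 1"
  defines "n \<equiv> card K" and "\<alpha> \<equiv> \<Sum>k\<in>K. cmod (a k)" and "\<epsilon> \<equiv> \<Sum>k\<in>K. cmod (a k - b k)"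
  assumes n: "n = Suc l"
  shows "cmod ((\<Prod>k\<in>K. a k) - (\<Prod>k\<in>K. b k)) \<le> 3 ^ l * (\<delta> * \<alpha> ^ n + \<epsilon> ^ n / \<delta> ^ l)"
proof -
  define m where "m = 2 * \<alpha> + \<epsilon>"
  have nn: "0 \<le> \<alpha>" "0 \<le> \<epsilon>" by (auto simp: \<alpha>_def \<epsilon>_def intro: sum_nonneg)
  have a: "cmod (a k) \<le> \<alpha>" and e: "cmod (a k - b k) \<le> \<epsilon>" if "k \<in> K" for k
    unfolding \<alpha>_def \<epsilon>_def using that fin by (auto intro: member_le_sum)
  have b: "cmod (b k) \<le> m" if "k \<in> K" for k
    using a[OF that] e[OF that] norm_triangle_ineq4[of "a k" "a k - b k"] nn by (simp add: m_def)
  have am: "cmod (a k) \<le> m" if "k \<in> K" for k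
    using a[OF that] nn by (simp add: m_def)
  have "cmod ((\<Prod>k\<in>K. a k) - (\<Prod>k\<in>K. b k)) \<le> m ^ l * \<epsilon>"
  proof (cases "m = 0")
    case True
    then have "a k = 0" "b k = 0" if "k \<in> K" for k using am[OF that] b[OF that] by auto
    moreover obtain k where "k \<in> K" using n unfolding n_def by (metis card.empty ex_in_conv nat.distinct(1))
    ultimately have "(\<Prod>k\<in>K. a k) = 0" "(\<Prod>k\<in>K. b k) = 0"
      using fin by (auto simp: card_gt_0_iff)
    then show ?thesis using nn True by simp
  next
    case False
    then have m: "0 < m" using nn by (simp add: m_def)
    have "cmod ((\<Prod>k\<in>K. a k / m) - (\<Prod>k\<in>K. b k / m)) \<le> (\<Sum>k\<in>K. cmod (a k / m - b k / m))"
      by (rule norm_prod_diff) (use am b m in \<open>auto simp: norm_divide\<close>)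
    also have "\<dots> = \<epsilon> / m"
      using m by (simp add: \<epsilon>_def diff_divide_distrib[symmetric] norm_divide sum_divide_distrib)
    finally have "cmod ((\<Prod>k\<in>K. a k) - (\<Prod>k\<in>K. b k)) / m ^ n \<le> \<epsilon> / m"
      using m by (simp add: prod_dividef n_def diff_divide_distrib[symmetric] norm_divide norm_power)
    then show ?thesis
      using m by (simp add: n field_simps)
  qed
  also have "\<dots> \<le> 3 ^ l * (\<delta> * \<alpha> ^ n + \<epsilon> ^ n / \<delta> ^ l)"
  \<comment> \<open>The larger of the two quantities controls \<open>m\<close>: it is at most
    \<open>3 * \<alpha>\<close> in the first case and at most
    \<open>3 * (\<epsilon> / \<delta>)\<close> in the second.\<close>
  proof (cases "\<epsilon> \<le> \<delta> * \<alpha>")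
    case True
    have "\<delta> * \<alpha> \<le> \<alpha>" using \<delta> nn by (simp add: mult_left_le_one_le)
    with True have "m \<le> 3 * \<alpha>" by (simp add: m_def)
    then have "m ^ l * \<epsilon> \<le> (3 * \<alpha>) ^ l * (\<delta> * \<alpha>)"
      using True nn \<delta> by (intro mult_mono power_mono) (auto simp: m_def)
    also have "\<dots> = 3 ^ l * (\<delta> * \<alpha> ^ n)" by (simp add: n power_mult_distrib)
    finally show ?thesis
      using nn \<delta> by (simp add: distrib_left add_increasing2)
  next
    case False
    then have "\<alpha> \<le> \<epsilon> / \<delta>" using \<delta> by (simp add: field_simps)
    moreover have "\<epsilon> \<le> \<epsilon> / \<delta>" using \<delta> nn by (simp add: field_simps mult_left_le_one_le)
    ultimately have "m \<le> 3 * (\<epsilon> / \<delta>)" by (simp add: m_def)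
    then have "m ^ l * \<epsilon> \<le> (3 * (\<epsilon> / \<delta>)) ^ l * \<epsilon>"
      using nn by (intro mult_right_mono power_mono) (auto simp: m_def)
    also have "\<dots> = 3 ^ l * (\<epsilon> ^ n / \<delta> ^ l)" by (simp add: n power_mult_distrib power_divide)
    finally show ?thesis
      using nn \<delta> by (simp add: distrib_left add_increasing)
  qed
  finally show ?thesis .
qed

lemma sum_power_le:
  fixes x :: "'i \<Rightarrow> real"
  assumes "finite K" "\<And>k. k \<in> K \<Longrightarrow> 0 \<le> x k"
  assumes "0 < n"
  shows "(\<Sum>k\<in>K. x k) ^ n \<le> real (card K) ^ n * (\<Sum>k\<in>K. x k ^ n)"
proof (cases "K = {}")
  case False
  define m where "m = Max (x ` K)"
  have "m \<in> x ` K" unfolding m_def by (rule Max_in) (use assms(1) False in auto)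
  then obtain j where j: "j \<in> K" "x j = m" by auto
  have "(\<Sum>k\<in>K. x k) \<le> real (card K) * m"
    using assms(1) by (intro sum_bounded_above) (auto simp: m_def)
  then have "(\<Sum>k\<in>K. x k) ^ n \<le> (real (card K) * m) ^ n"
    by (intro power_mono sum_nonneg assms)
  also have "\<dots> = real (card K) ^ n * x j ^ n" by (simp add: power_mult_distrib j)
  also have "\<dots> \<le> real (card K) ^ n * (\<Sum>k\<in>K. x k ^ n)"
    using assms j(1) by (intro mult_left_mono member_le_sum) auto
  finally show ?thesis .
qed (use \<open>0 < n\<close> in \<open>simp add: zero_power\<close>)

text \<open>Integrating the pointwise bound separates a term proportional to \<open>\<delta>\<close>
  from one that tends to zero with \<open>N\<close> for fixed \<open>\<delta>\<close>.\<close>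

lemma prod_Lp_convergence:
  fixes A :: "'i \<Rightarrow> 'a \<Rightarrow> complex" and B :: "nat \<Rightarrow> 'i \<Rightarrow> 'a \<Rightarrow> complex"
  assumes fin: "finite K" and card: "card K = Suc l"
    and meas [measurable]: "\<And>k. A k \<in> borel_measurable M" "\<And>N k. B N k \<in> borel_measurable M"
    and A: "\<And>k. k \<in> K \<Longrightarrow> integrable M (\<lambda>x. cmod (A k x) ^ Suc l)"
    and AB: "\<And>N k. k \<in> K \<Longrightarrow> integrable M (\<lambda>x. cmod (A k x - B N k x) ^ Suc l)"
    and lim: "\<And>k. k \<in> K \<Longrightarrow> (\<lambda>N. \<integral>x. cmod (A k x - B N k x) ^ Suc l \<partial>M) \<longlonglongrightarrow> 0"
  shows "integrable M (\<lambda>x. \<Prod>k\<in>K. A k x)"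
    and "\<And>N. integrable M (\<lambda>x. \<Prod>k\<in>K. B N k x)"
    and "(\<lambda>N. \<integral>x. (\<Prod>k\<in>K. B N k x) \<partial>M) \<longlonglongrightarrow> (\<integral>x. (\<Prod>k\<in>K. A k x) \<partial>M)"
proof -
  define C where "C = (3::real) ^ l * real (Suc l) ^ Suc l"
  define a where "a x = (\<Sum>k\<in>K. cmod (A k x) ^ Suc l)" for x
  define e where "e N x = (\<Sum>k\<in>K. cmod (A k x - B N k x) ^ Suc l)" for N x
  have ia: "integrable M a" unfolding a_def[abs_def] by (intro Bochner_Integration.integrable_sum A)
  have ie: "integrable M (e N)" for N unfolding e_def[abs_def] by (intro Bochner_Integration.integrable_sum AB)
  have a0: "0 \<le> a x" and e0: "0 \<le> e N x" for N x
    unfolding a_def e_def by (auto intro!: sum_nonneg)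
  have bound: "cmod ((\<Prod>k\<in>K. A k x) - (\<Prod>k\<in>K. B N k x)) \<le> C * (\<delta> * a x + e N x / \<delta> ^ l)" if \<delta>: "0 < \<delta>" "\<delta> \<le> 1" for \<delta> x N
  proof -
    have "cmod ((\<Prod>k\<in>K. A k x) - (\<Prod>k\<in>K. B N k x))
      \<le> 3 ^ l * (\<delta> * (\<Sum>k\<in>K. cmod (A k x)) ^ Suc l + (\<Sum>k\<in>K. cmod (A k x - B N k x)) ^ Suc l / \<delta> ^ l)"
      using norm_prod_diff_le[OF fin \<delta> card, of "\<lambda>k. A k x" "\<lambda>k. B N k x"] by (simp only: card)
    also have "\<dots> \<le> 3 ^ l * (\<delta> * (real (Suc l) ^ Suc l * a x) + (real (Suc l) ^ Suc l * e N x) / \<delta> ^ l)"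
      unfolding a_def e_def card[symmetric] using \<delta>
      by (intro mult_left_mono add_mono divide_right_mono sum_power_le fin zero_less_Suc) (auto simp: card)
    also have "\<dots> = C * (\<delta> * a x + e N x / \<delta> ^ l)"
      by (simp add: C_def algebra_simps add_divide_distrib)
    finally show ?thesis .
  qed
  have Abound: "cmod (\<Prod>k\<in>K. A k x) \<le> C * a x" for x
  proof -
    have "cmod (\<Prod>k\<in>K. A k x) = (\<Prod>k\<in>K. cmod (A k x))" by (rule prod_norm[symmetric])
    also have "\<dots> \<le> (\<Prod>k\<in>K. (\<Sum>k\<in>K. cmod (A k x)))"
      using fin by (intro prod_mono) (auto intro: member_le_sum)
    also have "\<dots> = (\<Sum>k\<in>K. cmod (A k x)) ^ Suc l" by (simp add: card)
    also have "\<dots> \<le> real (Suc l) ^ Suc l * a x"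
      unfolding a_def card[symmetric] by (intro sum_power_le fin) (auto simp: card)
    also have "\<dots> \<le> 3 ^ l * (real (Suc l) ^ Suc l * a x)"
      using mult_right_mono[of 1 "3 ^ l" "real (Suc l) ^ Suc l * a x"] a0[of x] by (simp del: power_Suc of_nat_Suc)
    finally show ?thesis by (simp add: C_def mult.assoc)
  qed
  show iA: "integrable M (\<lambda>x. \<Prod>k\<in>K. A k x)"
  proof (rule Bochner_Integration.integrable_bound)
    show "integrable M (\<lambda>x. C * a x)" using ia by simp
    show "AE x in M. norm (\<Prod>k\<in>K. A k x) \<le> norm (C * a x)"
      by (intro AE_I2 order.trans[OF Abound]) simp
  qed measurable
  have idiff: "integrable M (\<lambda>x. (\<Prod>k\<in>K. A k x) - (\<Prod>k\<in>K. B N k x))" for N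
  proof (rule Bochner_Integration.integrable_bound)
    show "integrable M (\<lambda>x. C * (1 * a x + e N x / 1 ^ l))" using ia ie[of N] by simp
    show "AE x in M. norm ((\<Prod>k\<in>K. A k x) - (\<Prod>k\<in>K. B N k x)) \<le> norm (C * (1 * a x + e N x / 1 ^ l))"
      by (intro AE_I2 order.trans[OF bound[of 1]]) simp_all
  qed measurable
  show iB: "integrable M (\<lambda>x. \<Prod>k\<in>K. B N k x)" for N
    using Bochner_Integration.integrable_diff[OF iA idiff[of N]] by simp
  have est: "cmod ((\<integral>x. (\<Prod>k\<in>K. B N k x) \<partial>M) - (\<integral>x. (\<Prod>k\<in>K. A k x) \<partial>M))
    \<le> C * (\<delta> * integral\<^sup>L M a + integral\<^sup>L M (e N) / \<delta> ^ l)" if \<delta>: "0 < \<delta>" "\<delta> \<le> 1" for \<delta> N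
  proof -
    have "cmod ((\<integral>x. (\<Prod>k\<in>K. B N k x) \<partial>M) - (\<integral>x. (\<Prod>k\<in>K. A k x) \<partial>M))
      = cmod (\<integral>x. (\<Prod>k\<in>K. A k x) - (\<Prod>k\<in>K. B N k x) \<partial>M)"
      by (simp add: Bochner_Integration.integral_diff[OF iA iB] norm_minus_commute)
    also have "\<dots> \<le> (\<integral>x. cmod ((\<Prod>k\<in>K. A k x) - (\<Prod>k\<in>K. B N k x)) \<partial>M)"
      by (rule integral_norm_bound)
    also have "\<dots> \<le> (\<integral>x. C * (\<delta> * a x + e N x / \<delta> ^ l) \<partial>M)"
      using ia ie bound[OF \<delta>] by (intro integral_mono integrable_norm idiff) auto
    also have "\<dots> = C * (\<delta> * integral\<^sup>L M a + integral\<^sup>L M (e N) / \<delta> ^ l)"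
      using ia ie by simp
    finally show ?thesis .
  qed
  have elim: "(\<lambda>N. integral\<^sup>L M (e N)) \<longlonglongrightarrow> 0"
  proof -
    have "(\<lambda>N. \<Sum>k\<in>K. \<integral>x. cmod (A k x - B N k x) ^ Suc l \<partial>M) \<longlonglongrightarrow> (\<Sum>k\<in>K. 0)"
      by (intro tendsto_sum lim)
    then show ?thesis
      unfolding e_def[abs_def] by (subst Bochner_Integration.integral_sum) (simp_all only: AB, simp)
  qed
  have C: "0 < C" by (simp add: C_def)
  have ia0: "0 \<le> integral\<^sup>L M a" by (simp add: a0)
  show "(\<lambda>N. \<integral>x. (\<Prod>k\<in>K. B N k x) \<partial>M) \<longlonglongrightarrow> (\<integral>x. (\<Prod>k\<in>K. A k x) \<partial>M)"
  proof (rule tendstoI)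
    fix r :: real assume "0 < r"
    \<comment> \<open>Chosen so that the term independent of \<open>N\<close> stays below
      \<open>r / 2\<close>. The summand 1 guards against a vanishing integral of
      \<open>a\<close>.\<close>
    define \<delta> where "\<delta> = min 1 (r / (2 * C * (integral\<^sup>L M a + 1)))"
    have \<delta>: "0 < \<delta>" "\<delta> \<le> 1" using \<open>0 < r\<close> C ia0 by (auto simp: \<delta>_def)
    have "\<delta> * (2 * C * (integral\<^sup>L M a + 1)) \<le> r"
      using C ia0 by (subst pos_le_divide_eq[symmetric]) (auto simp: \<delta>_def)
    moreover have "\<delta> * (2 * C * (integral\<^sup>L M a + 1)) = 2 * (C * (\<delta> * integral\<^sup>L M a)) + 2 * (C * \<delta>)"
      by (simp add: algebra_simps)
    moreover have "0 < C * \<delta>" using C \<delta> by simp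
    ultimately have 1: "C * (\<delta> * integral\<^sup>L M a) < r / 2" by linarith
    have "(\<lambda>N. C * (\<delta> * integral\<^sup>L M a + integral\<^sup>L M (e N) / \<delta> ^ l)) \<longlonglongrightarrow> C * (\<delta> * integral\<^sup>L M a + 0 / \<delta> ^ l)"
      using \<delta> by (intro tendsto_intros elim) auto
    then have "\<forall>\<^sub>F N in sequentially. C * (\<delta> * integral\<^sup>L M a + integral\<^sup>L M (e N) / \<delta> ^ l) < r"
      by (rule order_tendstoD(2)) (use 1 \<open>0 < r\<close> in simp)
    then show "\<forall>\<^sub>F N in sequentially. dist (\<integral>x. (\<Prod>k\<in>K. B N k x) \<partial>M) (\<integral>x. (\<Prod>k\<in>K. A k x) \<partial>M) < r"
      by eventually_elim (use est[OF \<delta>] in \<open>auto simp: dist_norm intro: le_less_trans\<close>)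
  qed
qed

section \<open>The functional on square integrable functions\<close>

abbreviation plane :: "(real \<times> real) measure" where
  "plane \<equiv> lborel \<Otimes>\<^sub>M lborel"

text \<open>The cutoff to \<open>quarter\<close> is part of the function, so that all norms and
  integrals are over the whole plane and Fubini applies directly.\<close>

definition wave :: "(nat \<Rightarrow> complex) \<Rightarrow> nat \<Rightarrow> real \<times> real \<Rightarrow> complex" where
  "wave c N p = indicator quarter (fst p) * hsum (phase (fst p) c) N (snd p)"

definition wave_lim :: "(nat \<Rightarrow> complex) \<Rightarrow> real \<times> real \<Rightarrow> complex" where
  "wave_lim c p = indicator quarter (fst p) * hlim (phase (fst p) c) (snd p)"

lemma borel_measurable_wave [measurable]:
  "wave c N \<in> borel_measurable plane" "wave_lim c \<in> borel_measurable plane"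
  unfolding wave_def[abs_def] wave_lim_def[abs_def] by measurable

lemma wave_diff_6:
  assumes s: "summable (\<lambda>n. (cmod (c n))\<^sup>2)"
  shows "integrable plane (\<lambda>p. cmod (wave_lim c p - wave c N p) ^ 6)"
    and "(\<integral>p. cmod (wave_lim c p - wave c N p) ^ 6 \<partial>plane) \<le> 1 / (2 * sqrt 3) * tail_sum (\<lambda>n. cmod (c n)) N ^ 3"
proof -
  have "(\<integral>\<^sup>+p. ennreal (cmod (wave_lim c p - wave c N p) ^ 6) \<partial>plane)
    = (\<integral>\<^sup>+t. \<integral>\<^sup>+x. ennreal (cmod (wave_lim c (t, x) - wave c N (t, x)) ^ 6) \<partial>lborel \<partial>lborel)"
    by (rule lborel.nn_integral_fst[symmetric]) measurable
  also have "\<dots> = (\<integral>\<^sup>+t. indicator quarter t * (\<integral>\<^sup>+x. ennreal (cmod (hlim (phase t c) x - hsum (phase t c) N x) ^ 6)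
      \<partial>lborel) \<partial>lborel)"
    by (intro nn_integral_cong) (auto simp: wave_def wave_lim_def split: split_indicator)
  also have "\<dots> \<le> ennreal (1 / (2 * sqrt 3) * tail_sum (\<lambda>n. cmod (c n)) N ^ 3)"
    by (rule nn_integral_hlim_diff_6[OF s])
  finally have le: "(\<integral>\<^sup>+p. ennreal (cmod (wave_lim c p - wave c N p) ^ 6) \<partial>plane) \<le> ennreal (1 / (2 * sqrt 3) *
      tail_sum (\<lambda>n. cmod (c n)) N ^ 3)" .
  show i: "integrable plane (\<lambda>p. cmod (wave_lim c p - wave c N p) ^ 6)"
    by (intro integrableI_bounded) (measurable, use le in \<open>auto intro: le_less_trans\<close>)
  show "(\<integral>p. cmod (wave_lim c p - wave c N p) ^ 6 \<partial>plane) \<le> 1 / (2 * sqrt 3) * tail_sum (\<lambda>n. cmod (c n)) N ^ 3"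
    using le tail_sum_nonneg[OF s, of N] by (subst (asm) nn_integral_eq_integral[OF i]) auto
qed

lemma wave_lim_6:
  assumes s: "summable (\<lambda>n. (cmod (c n))\<^sup>2)"
  shows "integrable plane (\<lambda>p. cmod (wave_lim c p) ^ 6)"
  using wave_diff_6(1)[OF s, of 0] by (simp add: wave_def hsum_def)

lemma wave_diff_6_tendsto:
  assumes s: "summable (\<lambda>n. (cmod (c n))\<^sup>2)"
  shows "(\<lambda>N. \<integral>p. cmod (wave_lim c p - wave c N p) ^ 6 \<partial>plane) \<longlonglongrightarrow> 0"
proof (rule tendsto_sandwich[OF always_eventually always_eventually tendsto_const])
  show "\<forall>N. (\<integral>p. cmod (wave_lim c p - wave c N p) ^ 6 \<partial>plane) \<le> 1 / (2 * sqrt 3) * tail_sum (\<lambda>n. cmod (c n)) N ^ 3"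
    using wave_diff_6(2)[OF s] by blast
  have "(\<lambda>N. 1 / (2 * sqrt 3) * tail_sum (\<lambda>n. cmod (c n)) N ^ 3) \<longlonglongrightarrow> 1 / (2 * sqrt 3) * 0 ^ 3"
    by (intro tendsto_intros tail_sum_tendsto_0[OF s])
  then show "(\<lambda>N. 1 / (2 * sqrt 3) * tail_sum (\<lambda>n. cmod (c n)) N ^ 3) \<longlonglongrightarrow> 0" by simp
qed simp

lemma prod_upto_6:
  fixes f :: "nat \<Rightarrow> 'a::comm_monoid_mult"
  shows "(\<Prod>k\<in>{1..6}. f k) = f 1 * (f 2 * (f 3 * (f 4 * (f 5 * f 6))))"
proof -
  have "{1..6::nat} = {1, 2, 3, 4, 5, 6}" by auto
  then show ?thesis by simp
qed

text \<open>Tannery's theorem: the term at level \<open>L\<close> is constant once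
  \<open>N > L\<close>, and truncation does not increase \<open>level_sqnorm\<close>, which yields a
  summable majorant independent of \<open>N\<close>.\<close>

lemma pairing_truncate_tendsto:
  fixes c :: "nat \<Rightarrow> nat \<Rightarrow> complex"
  assumes s: "\<And>k. k \<in> {1..6} \<Longrightarrow> summable (\<lambda>n. (cmod (c k n))\<^sup>2)"
  shows "(\<lambda>N. hkernel.pairing (tens (truncate N (c 1)) (truncate N (c 2)) (truncate N (c 3)))
      (tens (truncate N (c 4)) (truncate N (c 5)) (truncate N (c 6)))) \<longlonglongrightarrow>
    hkernel.pairing (tens (c 1) (c 2) (c 3)) (tens (c 4) (c 5) (c 6))"
proof -
  let ?F = "\<lambda>N. tens (truncate N (c 1)) (truncate N (c 2)) (truncate N (c 3))"
  let ?G = "\<lambda>N. tens (truncate N (c 4)) (truncate N (c 5)) (truncate N (c 6))"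
  let ?f = "tens (c 1) (c 2) (c 3)" and ?g = "tens (c 4) (c 5) (c 6)"
  have le: "cmod (tens (truncate N a) (truncate N b) (truncate N d) i j k) \<le> cmod (tens a b d i j k)" for a b d N i j k
    by (auto simp: tens_def fock_truncate)
  have nle: "level_sqnorm L (tens (truncate N a) (truncate N b) (truncate N d)) \<le> level_sqnorm L (tens a b d)" for a
      b d N L
    unfolding level_sqnorm_def by (intro sum_mono) (auto intro!: mult_left_mono power_mono le simp: less_imp_le)
  have eq: "tens (truncate N a) (truncate N b) (truncate N d) i j k = tens a b d i j k"
    if "(i, j, k) \<in> triples L" "L < N" for a b d N L i j k
    using that by (auto simp: tens_def fock_truncate triples_def)
  have "(\<lambda>N. \<Sum>L. level_inner L (hkernel.proj L (?F N)) (?G N)) \<longlonglongrightarrow> (\<Sum>L. level_inner L (hkernel.proj L ?f) ?g)"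
  proof (rule tannerys_theorem[THEN conjunct2, THEN conjunct2])
    show "(\<lambda>N. level_inner L (hkernel.proj L (?F N)) (?G N)) \<longlonglongrightarrow> level_inner L (hkernel.proj L ?f) ?g" for L
    proof (rule tendsto_eventually)
      show "\<forall>\<^sub>F N in sequentially. level_inner L (hkernel.proj L (?F N)) (?G N) = level_inner L (hkernel.proj L ?f) ?g"
        using eventually_gt_at_top[of L]
      proof eventually_elim
        case (elim N)
        have "hkernel.proj L (?F N) i j k = hkernel.proj L ?f i j k" for i j k
          using eq elim by (intro hkernel.proj_cong) blast
        then show ?case
          using eq elim unfolding level_inner_def by (intro sum.cong) auto
      qed
    qed
    show "\<forall>\<^sub>F (L, N) in at_top \<times>\<^sub>F sequentially. norm (level_inner L (hkernel.proj L (?F N)) (?G N)) \<le> level_sqnorm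
        L ?f + level_sqnorm L ?g"
    proof (intro always_eventually allI, clarify)
      fix L N
      show "norm (level_inner L (hkernel.proj L (?F N)) (?G N)) \<le> level_sqnorm L ?f + level_sqnorm L ?g"
        using hkernel.norm_level_inner_proj_le[of L "?F N" "?G N"] nle[of L N "c 1" "c 2" "c 3"] nle[of L N "c 4" "c
            5" "c 6"]
        by linarith
    qed
    show "summable (\<lambda>L. level_sqnorm L ?f + level_sqnorm L ?g)"
      using s by (intro summable_add tens_level_sqnorm_sums[THEN sums_summable]) auto
  qed simp
  then show ?thesis unfolding hkernel.pairing_def .
qed

definition wave_prod :: "(nat \<Rightarrow> nat \<Rightarrow> complex) \<Rightarrow> real \<times> real \<Rightarrow> complex" where
  "wave_prod c p = wave_lim (c 1) p * wave_lim (c 2) p * wave_lim (c 3) p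
     * cnj (wave_lim (c 4) p * wave_lim (c 5) p * wave_lim (c 6) p)"

lemma wave_prod:
  fixes c :: "nat \<Rightarrow> nat \<Rightarrow> complex"
  assumes s: "\<And>k. k \<in> {1..6} \<Longrightarrow> summable (\<lambda>n. (cmod (c k n))\<^sup>2)"
  shows "integrable plane (wave_prod c)"
    and "integral\<^sup>L plane (wave_prod c) =
      1 / (2 * sqrt 3) * hkernel.pairing (tens (c 1) (c 2) (c 3)) (tens (c 4) (c 5) (c 6))"
proof -
  \<comment> \<open>Conjugation is moved into the factors, so that the convergence lemma for plain
    products over \<open>{1..6}\<close> applies with \<open>l = 5\<close>.\<close>
  define A where "A k p = (if k \<le> 3 then wave_lim (c k) p else cnj (wave_lim (c k) p))" for k p
  define B where "B N k p = (if k \<le> 3 then wave (c k) N p else cnj (wave (c k) N p))" for N k p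
  have [measurable]: "A k \<in> borel_measurable plane" "B N k \<in> borel_measurable plane" for k N
    unfolding A_def[abs_def] B_def[abs_def] by measurable
  have nA: "cmod (A k p) = cmod (wave_lim (c k) p)" "cmod (A k p - B N k p) = cmod (wave_lim (c k) p - wave (c k) N
      p)" for k N p
    by (auto simp: A_def B_def complex_cnj_diff[symmetric] simp del: complex_cnj_diff)
  have prodA: "(\<Prod>k\<in>{1..6}. A k p) = wave_prod c p" for p
    unfolding prod_upto_6 by (simp add: A_def wave_prod_def mult.assoc)
  have prodB: "(\<Prod>k\<in>{1..6}. B N k (t, x)) = indicator quarter t *\<^sub>R hprod (c 1) (c 2) (c 3) (c 4) (c 5) (c 6) N t x"
      for N t x
    unfolding prod_upto_6 by (simp add: B_def wave_def hprod_def mult.assoc split: split_indicator)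
  have mA: "\<And>k. A k \<in> borel_measurable plane" and mB: "\<And>N k. B N k \<in> borel_measurable plane"
    by measurable
  have PA: "integrable plane (\<lambda>p. cmod (A k p) ^ Suc 5)" if "k \<in> {1..6}" for k
    using wave_lim_6[OF s[OF that]] by (simp add: nA)
  have PAB: "integrable plane (\<lambda>p. cmod (A k p - B N k p) ^ Suc 5)" if "k \<in> {1..6}" for k N
    using wave_diff_6(1)[OF s[OF that]] by (simp add: nA)
  have Plim: "(\<lambda>N. \<integral>p. cmod (A k p - B N k p) ^ Suc 5 \<partial>plane) \<longlonglongrightarrow> 0" if "k \<in> {1..6}" for k
    using wave_diff_6_tendsto[OF s[OF that]] by (simp add: nA)
  have iA: "integrable plane (\<lambda>p. \<Prod>k\<in>{1..6}. A k p)"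
    and iB: "\<And>N. integrable plane (\<lambda>p. \<Prod>k\<in>{1..6}. B N k p)"
    and lim: "(\<lambda>N. \<integral>p. (\<Prod>k\<in>{1..6}. B N k p) \<partial>plane) \<longlonglongrightarrow> (\<integral>p. (\<Prod>k\<in>{1..6}. A k p) \<partial>plane)"
    by (rule prod_Lp_convergence[OF _ _ mA mB PA PAB Plim]; simp)+
  show "integrable plane (wave_prod c)"
    using iA unfolding prodA .
  have "(\<integral>p. (\<Prod>k\<in>{1..6}. B N k p) \<partial>plane) = 1 / (2 * sqrt 3) * hkernel.pairing (tens (truncate N (c 1)) (truncate N
      (c 2)) (truncate N (c 3)))
      (tens (truncate N (c 4)) (truncate N (c 5)) (truncate N (c 6)))" for N
  proof -
    have "(\<integral>p. (\<Prod>k\<in>{1..6}. B N k p) \<partial>plane) = (LBINT t. LBINT x. (\<Prod>k\<in>{1..6}. B N k (t, x)))"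
      by (rule lborel_pair.integral_fst'[OF iB, symmetric])
    also have "\<dots> = (LBINT t. indicator quarter t *\<^sub>R (LBINT x. hprod (c 1) (c 2) (c 3) (c 4) (c 5) (c 6) N t x))"
      unfolding prodB by simp
    finally show ?thesis unfolding integral_hprod_pairing .
  qed
  moreover have "(\<lambda>N. 1 / (2 * sqrt 3) * hkernel.pairing (tens (truncate N (c 1)) (truncate N (c 2)) (truncate N (c 3)))
      (tens (truncate N (c 4)) (truncate N (c 5)) (truncate N (c 6)))) \<longlonglongrightarrow>
    1 / (2 * sqrt 3) * hkernel.pairing (tens (c 1) (c 2) (c 3)) (tens (c 4) (c 5) (c 6))"
    by (intro tendsto_intros pairing_truncate_tendsto s)
  ultimately show "integral\<^sup>L plane (wave_prod c) =
      1 / (2 * sqrt 3) * hkernel.pairing (tens (c 1) (c 2) (c 3)) (tens (c 4) (c 5) (c 6))"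
    using lim unfolding prodA by (simp add: LIMSEQ_unique)
qed

definition hermite_coeffs :: "(real \<Rightarrow> complex) \<Rightarrow> nat \<Rightarrow> complex" where
  "hermite_coeffs f n = L2_inner f (hermite_fun n)"

context
  fixes f :: "nat \<Rightarrow> real \<Rightarrow> complex"
  assumes f: "\<And>k. k \<in> {1..6} \<Longrightarrow> f k \<in> L2"
begin

abbreviation coeffs :: "nat \<Rightarrow> nat \<Rightarrow> complex" where
  "coeffs k \<equiv> hermite_coeffs (f k)"

lemma summable_coeffs: "k \<in> {1..6} \<Longrightarrow> summable (\<lambda>n. (cmod (coeffs k n))\<^sup>2)"
  unfolding hermite_coeffs_def by (intro bessel_summable f)

lemma E6_integrand_AE:
  "AE x in lebesgue. E6_integrand (f 1) (f 2) (f 3) (f 4) (f 5) (f 6) t x =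
    (let u = (\<lambda>k. hlim (phase t (coeffs k)) x) in u 1 * u 2 * u 3 * cnj (u 4 * u 5 * u 6))"
proof -
  have "AE x in lebesgue. \<forall>k\<in>{1..6}. propagator t (f k) x = hlim (phase t (coeffs k)) x"
    using propagator_AE[OF f, of _ t] unfolding hcoef_conv_phase hermite_coeffs_def[symmetric]
    by (intro AE_finite_allI) auto
  then show ?thesis
    by eventually_elim (simp add: E6_integrand_def)
qed

lemma E6_integrand_measurable: "E6_integrand (f 1) (f 2) (f 3) (f 4) (f 5) (f 6) t \<in> borel_measurable lebesgue"
proof -
  have [measurable]: "propagator t (f k) \<in> borel_measurable lebesgue" if "k \<in> {1..6}" for k
    using propagator_L2[OF f[OF that]] by (simp add: L2_def)
  show ?thesis
    unfolding E6_integrand_def[abs_def] by measurable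
qed

lemma wave_prod_AE:
  assumes "t \<in> quarter"
  shows "AE x in lebesgue. E6_integrand (f 1) (f 2) (f 3) (f 4) (f 5) (f 6) t x = wave_prod (\<lambda>k. coeffs k) (t, x)"
  using E6_integrand_AE[of t] by eventually_elim (use assms in \<open>simp add: wave_prod_def wave_lim_def Let_def\<close>)

lemma borel_measurable_wave_prod [measurable]: "wave_prod (\<lambda>k. coeffs k) \<in> borel_measurable plane"
  unfolding wave_prod_def[abs_def] by measurable

lemma wave_prod_outside: "t \<notin> quarter \<Longrightarrow> wave_prod c (t, x) = 0"
  by (simp add: wave_prod_def wave_lim_def)

lemma borel_measurable_wave_prod_section: "(\<lambda>x. wave_prod (\<lambda>k. coeffs k) (t, x)) \<in> borel_measurable borel"
  using measurable_Pair2[OF borel_measurable_wave_prod, of t] by simp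

text \<open>At each fixed time in the window the inner integral does not see the choice of
  representative, so it equals that of \<open>wave_prod\<close>, to which Fubini applies. The
  constant is 2 / pi times the one in \<open>wave_prod\<close>.\<close>

lemma E6_eq_pairing:
  "E6_converges (f 1) (f 2) (f 3) (f 4) (f 5) (f 6)"
  "E6 (f 1) (f 2) (f 3) (f 4) (f 5) (f 6) = 1 / (pi * sqrt 3) *
    hkernel.pairing (tens (coeffs 1) (coeffs 2) (coeffs 3)) (tens (coeffs 4) (coeffs 5) (coeffs 6))"
proof -
  let ?E = "E6_integrand (f 1) (f 2) (f 3) (f 4) (f 5) (f 6)"
  let ?W = "wave_prod (\<lambda>k. coeffs k)"
  have iW: "integrable plane ?W"
    and W: "integral\<^sup>L plane ?W = 1 / (2 * sqrt 3) *
      hkernel.pairing (tens (coeffs 1) (coeffs 2) (coeffs 3)) (tens (coeffs 4) (coeffs 5) (coeffs 6))"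
    by (rule wave_prod, rule summable_coeffs, assumption)+
  note [measurable] = E6_integrand_measurable borel_measurable_wave_prod_section
  have s: "t \<in> quarter \<Longrightarrow> (LINT x|lebesgue. ?E t x) = (LBINT x. ?W (t, x))" for t
  proof -
    assume "t \<in> quarter"
    then have "(LINT x|lebesgue. ?E t x) = (LINT x|lebesgue. ?W (t, x))"
      by (intro integral_cong_AE E6_integrand_measurable wave_prod_AE measurable_completion) measurable
    then show ?thesis by (simp add: integral_completion)
  qed
  have sn: "t \<in> quarter \<Longrightarrow> (LINT x|lebesgue. cmod (?E t x)) = (LBINT x. cmod (?W (t, x)))" for t
  proof -
    assume "t \<in> quarter"
    from wave_prod_AE[OF this] have "AE x in lebesgue. cmod (?E t x) = cmod (?W (t, x))"
      by eventually_elim simp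
    then have "(LINT x|lebesgue. cmod (?E t x)) = (LINT x|lebesgue. cmod (?W (t, x)))"
      by (intro integral_cong_AE measurable_compose[OF E6_integrand_measurable] measurable_completion) measurable
    then show ?thesis by (simp add: integral_completion)
  qed
  show "E6_converges (f 1) (f 2) (f 3) (f 4) (f 5) (f 6)"
    unfolding E6_converges_def
  proof
    have "AE t in lborel. integrable lborel (\<lambda>x. ?W (t, x))"
      by (rule lborel_pair.AE_integrable_fst'[OF iW])
    from AE_completion[OF this] show "AE t in lebesgue. t \<in> quarter \<longrightarrow> integrable lebesgue (?E t)"
    proof eventually_elim
      case (elim t)
      then have "integrable lebesgue (\<lambda>x. ?W (t, x))" by (simp add: integrable_completion)
      then show ?case
        using integrable_cong_AE[OF E6_integrand_measurable measurable_completion wave_prod_AE] by simp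
    qed
    have i: "integrable lborel (\<lambda>t. LBINT x. cmod (?W (t, x)))"
      by (rule lborel_pair.integrable_fst'[OF integrable_norm[OF iW]])
    \<comment> \<open>An equality at every \<open>t\<close>, not only almost every one: it makes the
      left side measurable in \<open>t\<close> although nothing is known about how
      \<open>propagator\<close> depends on time.\<close>
    have "(\<lambda>t. indicator quarter t *\<^sub>R (LINT x|lebesgue. cmod (?E t x))) = (\<lambda>t. LBINT x. cmod (?W (t, x)))"
      by (intro ext) (auto simp: sn wave_prod_outside simp del: One_nat_def split: split_indicator)
    then show "set_integrable lebesgue quarter (\<lambda>t. LINT x|lebesgue. cmod (?E t x))"
      unfolding set_integrable_def using i by (simp add: integrable_completion borel_measurable_integrable)
  qed
  have "(\<lambda>t. indicator quarter t *\<^sub>R (LINT x|lebesgue. ?E t x)) = (\<lambda>t. LBINT x. ?W (t, x))"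
    by (intro ext) (auto simp: s wave_prod_outside simp del: One_nat_def split: split_indicator)
  then have "set_lebesgue_integral lebesgue quarter (\<lambda>t. LINT x|lebesgue. ?E t x) = (LINT t|lebesgue. (LBINT x. ?W
      (t, x)))"
    unfolding set_lebesgue_integral_def by simp
  also have "\<dots> = (LBINT t. LBINT x. ?W (t, x))"
    using lborel_pair.integrable_fst'[OF iW] by (intro integral_completion) auto
  also have "\<dots> = integral\<^sup>L plane ?W"
    by (rule lborel_pair.integral_fst'[OF iW])
  finally have *: "set_lebesgue_integral lebesgue quarter (\<lambda>t. LINT x|lebesgue. ?E t x) = integral\<^sup>L plane ?W" .
  show "E6 (f 1) (f 2) (f 3) (f 4) (f 5) (f 6) = 1 / (pi * sqrt 3) *
    hkernel.pairing (tens (coeffs 1) (coeffs 2) (coeffs 3)) (tens (coeffs 4) (coeffs 5) (coeffs 6))"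
    unfolding E6_def * W by simp
qed

end

section \<open>Factorised rotation invariants\<close>

text \<open>The equation F' = (p + q z) F for the coefficients of a power series F.\<close>

definition gauss_rec :: "complex \<Rightarrow> complex \<Rightarrow> (int \<Rightarrow> complex) \<Rightarrow> bool" where
  "gauss_rec p q u \<longleftrightarrow> (\<forall>n. of_int (n + 1) * u (n + 1) = p * u n + q * u (n - 1))"

lemma gauss_recD: "gauss_rec p q u \<Longrightarrow> of_int (n + 1) * u (n + 1) = p * u n + q * u (n - 1)"
  unfolding gauss_rec_def by blast

text \<open>A product of three functions exp (p z + q z^2 / 2) in separate variables depends only on
  the sum and the sum of squares of the variables, and both are invariant.\<close>

lemma gauss_rec_rot:
  assumes "gauss_rec p q u" "gauss_rec p q v" "gauss_rec p q w"
  shows "rot (\<lambda>i j k. u i * v j * w k) i j k = 0"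
proof -
  have "rot (\<lambda>i j k. u i * v j * w k) i j k =
      (of_int (i + 1) * u (i + 1)) * (v (j - 1) * w k - v j * w (k - 1))
    + (of_int (j + 1) * v (j + 1)) * (u i * w (k - 1) - u (i - 1) * w k)
    + (of_int (k + 1) * w (k + 1)) * (u (i - 1) * v j - u i * v (j - 1))"
    by (simp add: rot_def algebra_simps)
  also have "\<dots> = 0"
    unfolding assms[THEN gauss_recD] by (simp add: algebra_simps)
  finally show ?thesis .
qed

lemma gauss_rec_0: "gauss_rec p q u \<Longrightarrow> u (-1) = 0 \<Longrightarrow> u 1 = p * u 0"
  unfolding gauss_rec_def by (metis add_0 diff_0 mult_1 mult_zero_right add.right_neutral of_int_1)

lemma gauss_rec_1: "gauss_rec p q u \<Longrightarrow> 2 * u 2 = p * u 1 + q * u 0"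
  unfolding gauss_rec_def by (drule spec[of _ 1]) simp

text \<open>Solutions supported on the nonnegative indices are fixed by their value at 0. Cross
  multiplication keeps the statement valid when one of these values is zero.\<close>

lemma gauss_rec_unique:
  assumes "gauss_rec p q u" "gauss_rec p q v" "\<And>n. n < 0 \<Longrightarrow> u n = 0" "\<And>n. n < 0 \<Longrightarrow> v n = 0"
  shows "u 0 * v n = v 0 * u n"
proof -
  have "u 0 * v (int n) = v 0 * u (int n)" for n
  proof (induction n rule: less_induct)
    case (less n)
    show ?case
    proof (cases n)
      case (Suc m)
      have m: "u 0 * v (int m) = v 0 * u (int m)" using less Suc by simp
      have m1: "u 0 * v (int m - 1) = v 0 * u (int m - 1)"
      proof (cases m)
        case (Suc l)
        then show ?thesis using less[of l] \<open>n = Suc m\<close> by simp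
      qed (simp add: assms)
      have e: "int n = int m + 1" using Suc by simp
      have "of_int (int m + 1) * (u 0 * v (int m + 1)) = u 0 * (p * v (int m) + q * v (int m - 1))"
        unfolding gauss_recD[OF assms(2), symmetric] by (rule mult.left_commute)
      also have "\<dots> = p * (u 0 * v (int m)) + q * (u 0 * v (int m - 1))" by (simp add: algebra_simps)
      also have "\<dots> = v 0 * (p * u (int m) + q * u (int m - 1))" unfolding m m1 by (simp add: algebra_simps)
      also have "\<dots> = of_int (int m + 1) * (v 0 * u (int m + 1))"
        unfolding gauss_recD[OF assms(1), symmetric] by (rule mult.left_commute)
      finally have "(of_int (int m + 1) :: complex) = 0 \<or> u 0 * v (int m + 1) = v 0 * u (int m + 1)"
        by (simp only: mult_cancel_left)
      then show ?thesis
        unfolding e by (metis of_int_eq_0_iff of_nat_Suc of_nat_eq_0_iff nat.distinct(1) add.commute)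
    qed simp
  qed
  from this[of "nat n"] show ?thesis
    using assms(3,4)[of n] by (cases "n < 0") auto
qed

text \<open>Testing the rotation equation at the corner of the support of a product shows that this
  corner is the origin; its values next to the coordinate axes are then the recurrence.\<close>

lemma product_rotation_invariant:
  fixes u v w :: "int \<Rightarrow> complex"
  assumes rot: "\<And>i j k. rot (\<lambda>i j k. u i * v j * w k) i j k = 0"
    and neg: "\<And>n. n < 0 \<Longrightarrow> u n = 0" "\<And>n. n < 0 \<Longrightarrow> v n = 0" "\<And>n. n < 0 \<Longrightarrow> w n = 0"
    and nz: "\<exists>n. u n \<noteq> 0" "\<exists>n. v n \<noteq> 0" "\<exists>n. w n \<noteq> 0"
  obtains p q where "u 0 \<noteq> 0" "v 0 \<noteq> 0" "w 0 \<noteq> 0" "gauss_rec p q u" "gauss_rec p q v" "gauss_rec p q w"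
proof -
  have least: "\<exists>i\<ge>0. u i \<noteq> 0 \<and> (\<forall>n<i. u n = 0)" if neg: "\<And>n. n < 0 \<Longrightarrow> u n = 0" and nz: "\<exists>n. u n \<noteq> 0" for u :: "int \<Rightarrow>
      complex"
  proof -
    obtain n where "u n \<noteq> 0" using nz by blast
    then have n: "u (int (nat n)) \<noteq> 0" using neg[of n] by (cases "n < 0") auto
    define m where "m = (LEAST m. u (int m) \<noteq> 0)"
    have "u (int m) \<noteq> 0" unfolding m_def by (rule LeastI[of "\<lambda>m. u (int m) \<noteq> 0"]) (rule n)
    moreover have "u n = 0" if "n < int m" for n
    proof (cases "n < 0")
      case False
      then have "nat n < m" using that by simp
      from not_less_Least[OF this[unfolded m_def]] False show ?thesis by simp
    qed (rule neg)
    ultimately show ?thesis by (intro exI[of _ "int m"]) auto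
  qed
  obtain i where i: "0 \<le> i" "u i \<noteq> 0" "\<And>n. n < i \<Longrightarrow> u n = 0" using least[OF neg(1) nz(1)] by blast
  obtain j where j: "0 \<le> j" "v j \<noteq> 0" "\<And>n. n < j \<Longrightarrow> v n = 0" using least[OF neg(2) nz(2)] by blast
  obtain k where k: "0 \<le> k" "w k \<noteq> 0" "\<And>n. n < k \<Longrightarrow> w n = 0" using least[OF neg(3) nz(3)] by blast
  \<comment> \<open>At a point one step off the corner, five of the six terms of \<open>rot\<close>
    contain a value below the corner. The surviving factor \<open>i\<close>, and likewise
    \<open>j\<close> and \<open>k\<close>, must then be zero.\<close>
  have "of_int i * (u i * v j * w k) = 0"
    using rot[of "i - 1" "j + 1" k] by (simp add: rot_def i j k)
  moreover have "of_int j * (u i * v j * w k) = 0"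
    using rot[of i "j - 1" "k + 1"] by (simp add: rot_def i j k)
  moreover have "of_int k * (u i * v j * w k) = 0"
    using rot[of "i + 1" j "k - 1"] by (simp add: rot_def i j k)
  ultimately have "i = 0" "j = 0" "k = 0" using i(2) j(2) k(2) by auto
  with i j k have nz: "u 0 \<noteq> 0" "v 0 \<noteq> 0" "w 0 \<noteq> 0" by auto
  \<comment> \<open>Read off from the equations at \<open>(n, 1, 0)\<close>,
    \<open>(0, n, 1)\<close> and \<open>(1, 0, n)\<close>, each of which is a recurrence for one
    factor with parameters taken from the other two.\<close>
  define qu where "qu = 2 * v 2 / v 0 - v 1 * w 1 / (v 0 * w 0)"
  define qv where "qv = 2 * w 2 / w 0 - u 1 * w 1 / (u 0 * w 0)"
  define qw where "qw = 2 * u 2 / u 0 - u 1 * v 1 / (u 0 * v 0)"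
  have u: "gauss_rec (w 1 / w 0) qu u"
    unfolding gauss_rec_def
  proof
    fix n
    have "(of_int (n + 1) * u (n + 1)) * (v 0 * w 0) = w 1 * v 0 * u n + (2 * v 2 * w 0 - v 1 * w 1) * u (n - 1)"
      using rot[of n 1 0] by (simp add: rot_def neg algebra_simps)
    then show "of_int (n + 1) * u (n + 1) = w 1 / w 0 * u n + qu * u (n - 1)"
      using nz unfolding qu_def by (simp add: field_simps del: of_int_add)
  qed
  have v: "gauss_rec (u 1 / u 0) qv v"
    unfolding gauss_rec_def
  proof
    fix n
    have "(of_int (n + 1) * v (n + 1)) * (u 0 * w 0) = u 1 * w 0 * v n + (2 * w 2 * u 0 - u 1 * w 1) * v (n - 1)"
      using rot[of 0 n 1] by (simp add: rot_def neg algebra_simps)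
    then show "of_int (n + 1) * v (n + 1) = u 1 / u 0 * v n + qv * v (n - 1)"
      using nz unfolding qv_def by (simp add: field_simps del: of_int_add)
  qed
  have w: "gauss_rec (v 1 / v 0) qw w"
    unfolding gauss_rec_def
  proof
    fix n
    have "(of_int (n + 1) * w (n + 1)) * (u 0 * v 0) = v 1 * u 0 * w n + (2 * u 2 * v 0 - u 1 * v 1) * w (n - 1)"
      using rot[of 1 0 n] by (simp add: rot_def neg algebra_simps)
    then show "of_int (n + 1) * w (n + 1) = v 1 / v 0 * w n + qw * w (n - 1)"
      using nz unfolding qw_def by (simp add: field_simps del: of_int_add)
  qed
  \<comment> \<open>The three recurrences have the same parameters: at index 0 they force equal
    ratios of the first two values, and at index 1 they identify the three constants
    \<open>q\<close>.\<close>
  define p where "p = u 1 / u 0"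
  have p1: "w 1 = p * w 0" "v 1 = p * v 0" "u 1 = p * u 0"
    using gauss_rec_0[OF u neg(1)] gauss_rec_0[OF v neg(2)] nz by (auto simp: p_def field_simps)
  then have pp: "w 1 / w 0 = p" "v 1 / v 0 = p" "u 1 / u 0 = p" using nz by auto
  have q: "qu = 2 * v 2 / v 0 - p\<^sup>2" "qv = 2 * w 2 / w 0 - p\<^sup>2" "qw = 2 * u 2 / u 0 - p\<^sup>2"
    unfolding qu_def qv_def qw_def p1 using nz by (auto simp: power2_eq_square)
  have "2 * u 2 / u 0 = p\<^sup>2 + qu" "2 * v 2 / v 0 = p\<^sup>2 + qv"
    using gauss_rec_1[OF u] gauss_rec_1[OF v] nz unfolding pp p1 by (auto simp: field_simps power2_eq_square)
  with q have "qv = qu" "qw = qu" by simp_all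
  with u v w nz that[of p qu] show ?thesis unfolding pp by simp
qed

section \<open>Square summable solutions of the recurrence\<close>

lemma fock_neg: "n < 0 \<Longrightarrow> fock c n = 0"
  by (simp add: fock_def)

lemma fock_nat: "fock c (int n) = c n / of_real (sqrt (fact n))"
  by (simp add: fock_def)

text \<open>The series \<open>\<Sum> b\<^sub>n z\<^sup>n\<close> of a function in Fock space is \<open>o(exp (|z|\<^sup>2 / 2))\<close>, while for
  the recurrence it is \<open>b\<^sub>0 exp (p z + q z\<^sup>2 / 2)\<close>. Comparing the values at \<open>z\<close> and \<open>- z\<close>
  in the direction where \<open>q z\<^sup>2 > 0\<close> eliminates \<open>p\<close>.\<close>

lemma gauss_rec_norm_less_1:
  assumes s: "summable (\<lambda>n. (cmod (c n))\<^sup>2)" and rec: "gauss_rec p q (fock c)" and nz: "fock c 0 \<noteq> 0"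
  shows "cmod q < 1"
proof (rule ccontr)
  assume "\<not> cmod q < 1"
  then have q: "1 \<le> cmod q" by simp
  define b where "b n = fock c (int n)" for n
  \<comment> \<open>Arithmetic and geometric means with a free weight \<open>l\<close>: the first
    part sums to a tail of the squared coefficients and the second to at most an exponential of
    \<open>\<rho>\<^sup>2\<close>.\<close>
  have b_norm: "cmod (b n) * \<rho> ^ n \<le> (l * (cmod (c n))\<^sup>2 + ((\<rho>\<^sup>2) ^ n /\<^sub>R fact n) / l) / 2" if "0 < l" for l \<rho> n
  proof -
    have f: "sqrt (fact n) * sqrt (fact n) = (fact n :: real)" by simp
    have "0 \<le> (sqrt l * cmod (c n) - \<rho> ^ n / sqrt (fact n) / sqrt l)\<^sup>2" by simp
    also have "\<dots> = l * (cmod (c n))\<^sup>2 + (\<rho> ^ n)\<^sup>2 / fact n / l - 2 * (cmod (c n) * \<rho> ^ n / sqrt (fact n))"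
      using that by (simp add: power2_diff power_mult_distrib power_divide)
    finally show ?thesis
      by (simp add: b_def fock_nat norm_divide power_mult[symmetric] mult.commute divide_inverse[of _ "fact n"])
  qed
  have e: "(\<lambda>n. (\<rho>\<^sup>2) ^ n /\<^sub>R fact n) sums exp (\<rho>\<^sup>2)" for \<rho> :: real by (rule exp_converges)
  have sb: "summable (\<lambda>n. cmod (b n) * \<rho> ^ n)" if "0 \<le> \<rho>" for \<rho>
  proof (rule summable_comparison_test')
    show "summable (\<lambda>n. (1 * (cmod (c n))\<^sup>2 + ((\<rho>\<^sup>2) ^ n /\<^sub>R fact n) / 1) / 2)"
      by (intro summable_divide summable_add summable_mult s sums_summable[OF e])
    show "norm (cmod (b n) * \<rho> ^ n) \<le> (1 * (cmod (c n))\<^sup>2 + ((\<rho>\<^sup>2) ^ n /\<^sub>R fact n) / 1) / 2" for n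
      using b_norm[of 1 n \<rho>] that by simp
  qed
  define F where "F z = (\<Sum>n. b n * z ^ n)" for z
  have sz: "summable (\<lambda>n. b n * z ^ n)" for z
    by (rule summable_norm_cancel) (use sb[of "cmod z"] in \<open>simp add: norm_mult norm_power\<close>)
  \<comment> \<open>The recurrence as a differential equation, which identifies \<open>F\<close>
    with an exponential once the quotient is seen to be constant.\<close>
  have "(F has_field_derivative (p + q * z) * F z) (at z)" for z
  proof -
    have "(\<lambda>n. p * (b n * z ^ n)) sums (p * F z)"
      unfolding F_def by (intro sums_mult summable_sums sz)
    moreover have "(\<lambda>n. q * z * (b n * z ^ n)) sums (q * z * F z)"
      unfolding F_def by (intro sums_mult summable_sums sz)
    then have "(\<lambda>n. if n = 0 then 0 else q * b (n - 1) * z ^ n) sums (q * z * F z)"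
      by (subst sums_Suc_iff[symmetric, where f = "\<lambda>n. if n = 0 then 0 else q * b (n - 1) * z ^ n", simplified])
          (simp add: mult_ac)
    ultimately have "(\<lambda>n. p * (b n * z ^ n) + (if n = 0 then 0 else q * b (n - 1) * z ^ n)) sums (p * F z + q * z *
        F z)"
      by (rule sums_add)
    moreover have "diffs b n * z ^ n = p * (b n * z ^ n) + (if n = 0 then 0 else q * b (n - 1) * z ^ n)" for n
    proof -
      have "of_int (int n + 1) * fock c (int n + 1) = p * fock c (int n) + q * fock c (int n - 1)"
        by (rule gauss_recD[OF rec])
      then have "diffs b n = p * b n + (if n = 0 then 0 else q * b (n - 1))"
        by (auto simp: diffs_def b_def fock_neg of_nat_diff add.commute)
      then show ?thesis by (simp add: algebra_simps)
    qed
    ultimately have "(\<Sum>n. diffs b n * z ^ n) = (p + q * z) * F z"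
      by (simp add: sums_iff algebra_simps)
    then show ?thesis
      using termdiffs_strong_converges_everywhere[OF sz, of z] by (simp add: F_def[abs_def])
  qed
  then have "((\<lambda>z. F z * exp (- (p * z + q * z\<^sup>2 / 2))) has_field_derivative 0) (at z)" for z
    by (auto intro!: derivative_eq_intros simp: algebra_simps power2_eq_square)
  then obtain C where C: "\<And>z. F z * exp (- (p * z + q * z\<^sup>2 / 2)) = C"
    using has_field_derivative_zero_constant[of UNIV "\<lambda>z. F z * exp (- (p * z + q * z\<^sup>2 / 2))"] by auto
  have F0: "F 0 = b 0" unfolding F_def by (rule powser_zero[unfolded power_0_left, simplified] | simp add: powser_zero)+
  then have "C = b 0" using C[of 0] by simp
  then have F: "F z = b 0 * exp (p * z + q * z\<^sup>2 / 2)" for z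
    using C[of z] by (simp add: exp_minus field_simps)
  have b0: "0 < cmod (b 0)" using nz by (simp add: b_def)
  \<comment> \<open>One half of \<open>cmod (b 0)\<close> pays for the tail of the series; the other
    half remains as the lower bound in \<open>key\<close>.\<close>
  define \<epsilon> where "\<epsilon> = cmod (b 0) / 2"
  have \<epsilon>: "0 < \<epsilon>" using b0 by (simp add: \<epsilon>_def)
  obtain N where N: "tail_sum (\<lambda>n. cmod (c n)) N < \<epsilon>\<^sup>2"
    using order_tendstoD(2)[OF tail_sum_tendsto_0[OF s], of "\<epsilon>\<^sup>2"] \<epsilon> by (auto simp: eventually_sequentially)
  define P where "P \<rho> = (\<Sum>n<N. cmod (b n) * \<rho> ^ n)" for \<rho>
  have bound: "cmod (F z) \<le> P (cmod z) + \<epsilon> * exp ((cmod z)\<^sup>2 / 2)" for z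
  proof -
    define \<rho> where "\<rho> = cmod z"
    have \<rho>: "0 \<le> \<rho>" by (simp add: \<rho>_def)
    \<comment> \<open>The weight that makes both parts of the tail estimate equal to
      \<open>\<epsilon> * exp (\<rho>\<^sup>2 / 2)\<close>.\<close>
    define l where "l = exp (\<rho>\<^sup>2 / 2) / \<epsilon>"
    have l: "0 < l" using \<epsilon> by (simp add: l_def)
    have "cmod (F z) \<le> (\<Sum>n. cmod (b n) * \<rho> ^ n)"
      unfolding F_def using sb[OF \<rho>] by (intro order.trans[OF summable_norm]) (simp_all add: norm_mult norm_power \<rho>_def)
    also have "\<dots> = (\<Sum>n. cmod (b (n + N)) * \<rho> ^ (n + N)) + P \<rho>"
      unfolding P_def by (rule suminf_split_initial_segment[OF sb[OF \<rho>]])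
    also have "(\<Sum>n. cmod (b (n + N)) * \<rho> ^ (n + N)) \<le> (\<Sum>n. (l * (cmod (c (n + N)))\<^sup>2 + ((\<rho>\<^sup>2) ^ (n + N) /\<^sub>R fact (n
        + N)) / l) / 2)"
    proof (rule suminf_le[OF b_norm[OF l]])
      show "summable (\<lambda>n. cmod (b (n + N)) * \<rho> ^ (n + N))"
        using summable_ignore_initial_segment[OF sb[OF \<rho>], of N] .
      show "summable (\<lambda>n. (l * (cmod (c (n + N)))\<^sup>2 + ((\<rho>\<^sup>2) ^ (n + N) /\<^sub>R fact (n + N)) / l) / 2)"
        by (intro summable_divide summable_add summable_mult summable_ignore_initial_segment[OF s]
            summable_ignore_initial_segment[OF sums_summable[OF e]])
    qed
    also have "\<dots> = (l * tail_sum (\<lambda>n. cmod (c n)) N + (\<Sum>n. (\<rho>\<^sup>2) ^ (n + N) /\<^sub>R fact (n + N)) / l) / 2"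
      unfolding tail_sum_def
      by (intro sums_unique[symmetric] sums_divide sums_add sums_mult summable_sums
          summable_ignore_initial_segment[OF s] summable_ignore_initial_segment[OF sums_summable[OF e]])
    also have "\<dots> \<le> (l * \<epsilon>\<^sup>2 + exp (\<rho>\<^sup>2) / l) / 2"
    proof -
      have "(\<Sum>n. (\<rho>\<^sup>2) ^ (n + N) /\<^sub>R fact (n + N)) \<le> exp (\<rho>\<^sup>2)"
        using suminf_split_initial_segment[OF sums_summable[OF e[of \<rho>]], of N] sums_unique[OF e[of \<rho>]]
        by (auto intro!: sum_nonneg)
      then show ?thesis
        using N l by (intro divide_right_mono add_mono mult_left_mono) auto
    qed
    also have "\<dots> = \<epsilon> * exp (\<rho>\<^sup>2 / 2)"
    proof -
      have "exp (\<rho>\<^sup>2) = exp (\<rho>\<^sup>2 / 2) * exp (\<rho>\<^sup>2 / 2)" by (simp add: exp_add[symmetric])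
      then show ?thesis using \<epsilon> by (simp add: l_def field_simps power2_eq_square)
    qed
    finally show ?thesis by (simp add: \<rho>_def)
  qed
  \<comment> \<open>The unit direction in which \<open>q * z\<^sup>2\<close> is positive.\<close>
  define \<omega> where "\<omega> = csqrt (of_real (cmod q) / q)"
  have q0: "q \<noteq> 0" using q by auto
  have \<omega>: "q * \<omega>\<^sup>2 = of_real (cmod q)" using q0 by (simp add: \<omega>_def)
  have "(cmod \<omega>)\<^sup>2 = 1"
    using arg_cong[OF \<omega>, of cmod] q0 by (simp add: norm_mult norm_power)
  then have \<omega>1: "cmod \<omega> = 1" by (simp add: power2_eq_1_iff) (smt (verit) norm_ge_zero)
  \<comment> \<open>The product of the values at opposite points is
    \<open>(b 0)\<^sup>2 * exp (q * z\<^sup>2)\<close>. As \<open>cmod q\<close> is at least 1, one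
    of the two values must be as large as \<open>cmod (b 0) * exp (\<rho>\<^sup>2 / 2)\<close>,
    which leaves a lower bound for the polynomial \<open>P\<close>.\<close>
  have key: "\<epsilon> * exp (\<rho>\<^sup>2 / 2) \<le> P \<rho>" if \<rho>: "0 \<le> \<rho>" for \<rho>
  proof -
    have P0: "0 \<le> P \<rho>" unfolding P_def using \<rho> by (intro sum_nonneg) simp
    have z: "cmod (of_real \<rho> * \<omega>) = \<rho>" "cmod (- (of_real \<rho> * \<omega>)) = \<rho>" using \<rho> \<omega>1 by (simp_all add: norm_mult)
    have "F (of_real \<rho> * \<omega>) * F (- (of_real \<rho> * \<omega>)) = (b 0)\<^sup>2 * exp (q * \<omega>\<^sup>2 * of_real (\<rho>\<^sup>2))"
      unfolding F by (simp add: power2_eq_square exp_add[symmetric] algebra_simps)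
    then have "cmod (F (of_real \<rho> * \<omega>)) * cmod (F (- (of_real \<rho> * \<omega>))) = (cmod (b 0))\<^sup>2 * exp (cmod q * \<rho>\<^sup>2)"
      unfolding \<omega> of_real_mult[symmetric] exp_of_real norm_mult[symmetric] by (simp add: norm_mult norm_power)
    moreover have "(cmod (b 0))\<^sup>2 * exp (\<rho>\<^sup>2) \<le> (cmod (b 0))\<^sup>2 * exp (cmod q * \<rho>\<^sup>2)"
      using q by (intro mult_left_mono) (auto simp: mult_le_cancel_right1)
    moreover have "cmod (F (of_real \<rho> * \<omega>)) * cmod (F (- (of_real \<rho> * \<omega>))) \<le> (P \<rho> + \<epsilon> * exp (\<rho>\<^sup>2 / 2)) * (P \<rho> + \<epsilon> *
        exp (\<rho>\<^sup>2 / 2))"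
      using bound[of "of_real \<rho> * \<omega>"] bound[of "- (of_real \<rho> * \<omega>)"] P0 \<epsilon> unfolding z by (intro mult_mono) auto
    moreover have "(cmod (b 0))\<^sup>2 * exp (\<rho>\<^sup>2) = (cmod (b 0) * exp (\<rho>\<^sup>2 / 2))\<^sup>2"
      by (simp add: power_mult_distrib exp_double[symmetric])
    ultimately have "(cmod (b 0) * exp (\<rho>\<^sup>2 / 2))\<^sup>2 \<le> (P \<rho> + \<epsilon> * exp (\<rho>\<^sup>2 / 2))\<^sup>2"
      unfolding power2_eq_square by linarith
    then have "cmod (b 0) * exp (\<rho>\<^sup>2 / 2) \<le> P \<rho> + \<epsilon> * exp (\<rho>\<^sup>2 / 2)"
      by (rule power2_le_imp_le) (use P0 \<epsilon> in auto)
    then show ?thesis by (simp add: \<epsilon>_def)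
  qed
  obtain D where D: "0 \<le> D" "\<And>\<rho>. \<bar>P \<rho>\<bar> \<le> D * exp (1 / 4 * \<rho>\<^sup>2)"
    using poly_le_exp_sq[of "1 / 4" "\<Sum>n<N. monom (cmod (b n)) n"] by (auto simp: P_def poly_sum poly_monom)
  \<comment> \<open>Chosen so that \<open>\<epsilon> * (1 + \<rho>\<^sup>2 / 4)\<close> equals
    \<open>\<epsilon> + D\<close>, which exceeds the bound \<open>D\<close> derived next.\<close>
  define \<rho> where "\<rho> = sqrt (4 * (D / \<epsilon>))"
  have \<rho>: "0 \<le> \<rho>" "\<rho>\<^sup>2 = 4 * (D / \<epsilon>)" using D \<epsilon> by (simp_all add: \<rho>_def)
  have "\<epsilon> * exp (\<rho>\<^sup>2 / 4) * exp (\<rho>\<^sup>2 / 4) = \<epsilon> * exp (\<rho>\<^sup>2 / 2)" by (simp add: mult.assoc exp_add[symmetric])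
  also have "\<dots> \<le> D * exp (\<rho>\<^sup>2 / 4)" using key[OF \<rho>(1)] D(2)[of \<rho>] by simp
  finally have "\<epsilon> * exp (\<rho>\<^sup>2 / 4) \<le> D" by simp
  moreover have "\<epsilon> * (1 + \<rho>\<^sup>2 / 4) \<le> \<epsilon> * exp (\<rho>\<^sup>2 / 4)" using \<epsilon> by (intro mult_left_mono) auto
  moreover have "\<epsilon> * (1 + \<rho>\<^sup>2 / 4) = \<epsilon> + D" unfolding \<rho>(2) using \<epsilon> by (simp add: field_simps)
  ultimately show False using \<epsilon> by linarith
qed

section \<open>Hermite coefficients of Gaussians\<close>

lemma hermite_coeffs_cong_AE:
  assumes "f \<in> L2" "g \<in> L2" "AE x in lebesgue. f x = g x"
  shows "hermite_coeffs f n = hermite_coeffs g n"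
proof -
  have "L2_inner (\<lambda>x. f x - g x) (hermite_fun n) = 0"
    using norm_L2_inner_hermite_fun_le[OF L2_diff[OF assms(1,2)], of n] L2_norm_eq_0_iff[OF L2_diff[OF assms(1,2)]]
        assms(3)
    by simp
  then show ?thesis
    by (simp add: hermite_coeffs_def L2_inner_diff_left assms)
qed

lemma hermite_coeffs_cmult: "hermite_coeffs (\<lambda>x. c * f x) n = c * hermite_coeffs f n"
  by (simp add: hermite_coeffs_def L2_inner_def mult.assoc)

lemma hermite_coeffs_inject_AE:
  assumes "f \<in> L2" "g \<in> L2" "\<And>n. hermite_coeffs f n = hermite_coeffs g n"
  shows "AE x in lebesgue. f x = g x"
proof -
  have "AE x in lebesgue. f x - g x = 0"
    using assms by (intro hermite_fun_complete) (auto simp: L2_diff L2_inner_diff_left hermite_coeffs_def)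
  then show ?thesis by simp
qed

lemma gauss_bounded_gaussian:
  assumes "0 < Re \<alpha>" shows "gauss_bounded (gaussian \<alpha> \<beta> \<gamma>)"
proof -
  define a b where "a = Re \<alpha>" and "b = Re \<beta>"
  have a: "0 < a" using assms by (simp add: a_def)
  have "norm (gaussian \<alpha> \<beta> \<gamma> x) \<le> (cmod \<gamma> * exp (b\<^sup>2 / (2 * a))) * exp (- (a / 2) * x\<^sup>2)" for x
  proof -
    have "0 \<le> (a * x - b)\<^sup>2 / (2 * a)" using a by simp
    also have "\<dots> = a / 2 * x\<^sup>2 - b * x + b\<^sup>2 / (2 * a)"
      using a by (simp add: power2_eq_square field_simps)
    finally have "- a * x\<^sup>2 + b * x \<le> b\<^sup>2 / (2 * a) + (- (a / 2) * x\<^sup>2)" by simp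
    then have "exp (- a * x\<^sup>2 + b * x) \<le> exp (b\<^sup>2 / (2 * a)) * exp (- (a / 2) * x\<^sup>2)"
      unfolding exp_add[symmetric] by simp
    from mult_left_mono[OF this norm_ge_zero[of \<gamma>]] show ?thesis
      by (simp add: gaussian_def norm_mult a_def b_def mult.assoc power2_eq_square)
  qed
  moreover have "continuous_on UNIV (gaussian \<alpha> \<beta> \<gamma>)"
    unfolding gaussian_def[abs_def] by (intro continuous_intros)
  moreover have "0 < a / 2" using a by simp
  ultimately show ?thesis unfolding gauss_bounded_def by blast
qed

lemma gaussian_cmult: "gaussian \<alpha> \<beta> \<gamma> = (\<lambda>x. \<gamma> * gaussian \<alpha> \<beta> 1 x)"
  by (simp add: fun_eq_iff gaussian_def)

text \<open>The Bargmann transform of a Gaussian is again the exponential of a quadratic polynomial.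
  The recurrence for its coefficients is an integration by parts against
  \<open>psi n\<close>.\<close>

lemma fock_gaussian:
  fixes \<alpha> \<beta> :: complex
  assumes "0 < Re \<alpha>"
  shows "gauss_rec (sqrt 2 * \<beta> / (1 + 2 * \<alpha>)) ((1 - 2 * \<alpha>) / (1 + 2 * \<alpha>)) (fock (hermite_coeffs (gaussian \<alpha> \<beta> 1)))"
proof -
  define g where "g = gaussian \<alpha> \<beta> 1"
  have gb: "gauss_bounded g" unfolding g_def by (rule gauss_bounded_gaussian[OF assms])
  define G where "G n = (LBINT x. g x * of_real (psi n x))" for n
  have gpsi: "gauss_bounded (\<lambda>x. g x * of_real (psi n x))" for n
    by (intro gauss_bounded_mult gb gauss_bounded_of_real gauss_bounded_psi)
  note int = gauss_bounded_integrable[OF gpsi]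
  have fock_G: "fock (hermite_coeffs g) n = G n" for n
  proof (cases "n < 0")
    case False
    then obtain m where n: "n = int m" by (metis nonneg_int_cases not_less)
    have [measurable]: "g \<in> borel_measurable borel" using gauss_bounded_integrable[OF gb] by auto
    have "hermite_coeffs g m = (LBINT x. g x * hermite_fun m x)"
      by (simp add: hermite_coeffs_def L2_inner_def integral_completion)
    also have "\<dots> = of_real (sqrt (fact m)) * G n"
      unfolding G_def n hermite_fun_psi Bochner_Integration.integral_mult_right_zero[symmetric] by (simp add: mult_ac)
    finally show ?thesis by (simp add: n fock_nat)
  qed (simp add: G_def psi_neg fock_neg)
  have s: "complex_of_real (sqrt 2) * complex_of_real (sqrt 2) = 2"
    unfolding of_real_mult[symmetric] by simp
  have nz: "1 + 2 * \<alpha> \<noteq> 0"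
    using assms by (auto simp: complex_eq_iff)
  have "of_int (n + 1) * G (n + 1) = (sqrt 2 * \<beta> / (1 + 2 * \<alpha>)) * G n + ((1 - 2 * \<alpha>) / (1 + 2 * \<alpha>)) * G (n - 1)" for n
  proof -
    \<comment> \<open>The derivative of \<open>sqrt 2\<close> times the product of the Gaussian and
      \<open>psi n\<close>. Each occurrence of \<open>sqrt 2 * x * psi n x\<close> is expanded by
      \<open>psi_rec\<close>, which produces the coefficients 1 + 2 \<alpha> and 1 - 2
      \<alpha>.\<close>
    define h where "h x = - (1 + 2 * \<alpha>) * of_int (n + 1) * (g x * of_real (psi (n + 1) x))
        + of_real (sqrt 2) * \<beta> * (g x * of_real (psi n x)) + (1 - 2 * \<alpha>) * (g x * of_real (psi (n - 1) x))" for x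
    have "(LBINT x. h x) = 0"
    proof (rule integral_derivative_eq_0)
      show "gauss_bounded (\<lambda>x. of_real (sqrt 2) * (g x * of_real (psi n x)))" by (intro gauss_bounded_cmult gpsi)
      show "gauss_bounded h"
        unfolding h_def[abs_def] by (intro gauss_bounded_add gauss_bounded_cmult gpsi)
      show "((\<lambda>x. of_real (sqrt 2) * (g x * of_real (psi n x))) has_vector_derivative h x) (at x)" for x
      proof -
        have 1: "(g has_vector_derivative ((- 2 * \<alpha> * of_real x + \<beta>) * g x)) (at x)"
        proof -
          have "((\<lambda>z. exp (- \<alpha> * z\<^sup>2 + \<beta> * z)) has_field_derivative ((- 2 * \<alpha> * of_real x + \<beta>) * g x)) (at (of_real x))"
            by (auto intro!: derivative_eq_intros simp: g_def gaussian_def)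
          from has_vector_derivative_real_field[OF this] show ?thesis
            by (simp add: g_def gaussian_def[abs_def])
        qed
        have 2: "((\<lambda>x. complex_of_real (psi n x)) has_vector_derivative of_real (sqrt 2 * psi (n - 1) x - x * psi n
            x)) (at x)"
          by (intro has_vector_derivative_of_real psi_has_derivative)
        have x: "of_real (sqrt 2) * (of_real x * complex_of_real (psi n x)) = of_int (n + 1) * of_real (psi (n + 1)
            x) + of_real (psi (n - 1) x)"
        proof -
          have "sqrt 2 * (x * psi n x) = of_int (n + 1) * psi (n + 1) x + psi (n - 1) x"
            using psi_rec[of n x] by simp
          from arg_cong[OF this, of complex_of_real] show ?thesis by (simp only: of_real_mult of_real_add
              of_real_of_int_eq)
        qed
        have "h x = of_real (sqrt 2) * (g x * of_real (sqrt 2 * psi (n - 1) x - x * psi n x) + (- 2 * \<alpha> * of_real x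
            + \<beta>) * g x * of_real (psi n x))"
        proof -
          have "of_real (sqrt 2) * (g x * of_real (sqrt 2 * psi (n - 1) x - x * psi n x) + (- 2 * \<alpha> * of_real x + \<beta>)
              * g x * of_real (psi n x))
            = (of_real (sqrt 2) * of_real (sqrt 2)) * g x * of_real (psi (n - 1) x)
             - (1 + 2 * \<alpha>) * g x * (of_real (sqrt 2) * (of_real x * of_real (psi n x)))
             + of_real (sqrt 2) * \<beta> * (g x * of_real (psi n x))"
            by (simp add: algebra_simps)
          also have "\<dots> = h x"
            unfolding x s h_def by (simp add: algebra_simps)
          finally show ?thesis ..
        qed
        then show ?thesis
          using has_vector_derivative_mult_right[OF has_vector_derivative_mult[OF 1 2]] by simp
      qed
    qed
    then have "- (1 + 2 * \<alpha>) * of_int (n + 1) * G (n + 1) + of_real (sqrt 2) * \<beta> * G n + (1 - 2 * \<alpha>) * G (n - 1) = 0"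
      unfolding h_def[abs_def] G_def by (simp add: int)
    then have "(1 + 2 * \<alpha>) * (of_int (n + 1) * G (n + 1)) = of_real (sqrt 2) * \<beta> * G n + (1 - 2 * \<alpha>) * G (n - 1)"
      by (simp add: algebra_simps)
    then have "of_int (n + 1) * G (n + 1) = (of_real (sqrt 2) * \<beta> * G n + (1 - 2 * \<alpha>) * G (n - 1)) / (1 + 2 * \<alpha>)"
      by (subst nonzero_eq_divide_eq[OF nz]) (simp only: mult.commute[of _ "1 + 2 * \<alpha>"])
    then show ?thesis by (simp add: add_divide_distrib)
  qed
  then show ?thesis
    unfolding gauss_rec_def g_def[symmetric] fock_G by blast
qed

lemma gaussian_not_AE_0: "\<not> (AE x in lebesgue. gaussian \<alpha> \<beta> 1 x = 0)"
proof
  assume "AE x in lebesgue. gaussian \<alpha> \<beta> 1 x = 0"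
  then have "AE x in (lebesgue :: real measure). False" by (simp add: gaussian_def)
  then have "emeasure lebesgue (space (lebesgue :: real measure)) = 0"
    unfolding ae_filter_eq_bot_iff[symmetric] by (rule eventually_False[THEN iffD1])
  then show False by simp
qed

text \<open>The parameter map of \<open>fock_gaussian\<close> is inverted: the Cayley transform
  takes the unit disc of \<open>q\<close> to the half-plane of \<open>\<alpha>\<close> with positive
  real part. Since \<open>\<alpha>\<close> and \<open>\<beta>\<close> are obtained before
  \<open>f\<close>, one pair serves all six functions.\<close>

lemma gauss_rec_imp_gaussian:
  assumes "cmod q < 1"
  obtains \<alpha> \<beta> where "0 < Re \<alpha>"
    "\<And>f. f \<in> L2 \<Longrightarrow> gauss_rec p q (fock (hermite_coeffs f)) \<Longrightarrow> \<exists>\<gamma>. AE x in lebesgue. f x = gaussian \<alpha> \<beta> \<gamma> x"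
proof -
  define \<alpha> where "\<alpha> = (1 - q) / (2 * (1 + q))"
  define \<beta> where "\<beta> = sqrt 2 * p / (1 + q)"
  have nz: "1 + q \<noteq> 0"
  proof
    assume "1 + q = 0"
    then have "q = -1" by (simp add: add_eq_0_iff)
    with assms show False by simp
  qed
  have s: "complex_of_real (sqrt 2) * complex_of_real (sqrt 2) = 2"
    unfolding of_real_mult[symmetric] by simp
  have a0: "2 * \<alpha> = (1 - q) / (1 + q)"
    unfolding \<alpha>_def by (simp only: times_divide_eq_right mult_divide_mult_cancel_left_if) simp
  then have a: "1 + 2 * \<alpha> = 2 / (1 + q)" "1 - 2 * \<alpha> = 2 * q / (1 + q)"
    using nz by (simp_all add: nonzero_eq_divide_eq distrib_right left_diff_distrib)
  have pq: "(1 - 2 * \<alpha>) / (1 + 2 * \<alpha>) = q" "sqrt 2 * \<beta> / (1 + 2 * \<alpha>) = p"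
    unfolding a \<beta>_def using nz s by (simp_all add: mult.assoc[symmetric])
  have \<alpha>: "0 < Re \<alpha>"
  proof -
    have "2 * Re \<alpha> = Re ((1 - q) / (1 + q))" unfolding a0[symmetric] by simp
    also have "\<dots> = (1 - (cmod q)\<^sup>2) / (cmod (1 + q))\<^sup>2"
      unfolding Re_divide cmod_power2 by (simp add: power2_eq_square algebra_simps)
    also have "\<dots> > 0" using assms nz by (simp add: power_less_one_iff abs_square_less_1)
    finally show ?thesis by simp
  qed
  define g where "g = gaussian \<alpha> \<beta> 1"
  have g: "g \<in> L2" unfolding g_def by (intro gauss_bounded_L2 gauss_bounded_gaussian \<alpha>)
  have rec: "gauss_rec p q (fock (hermite_coeffs g))"
    using fock_gaussian[OF \<alpha>, of \<beta>] unfolding pq g_def .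
  have coeff: "hermite_coeffs f n = of_real (sqrt (fact n)) * fock (hermite_coeffs f) (int n)" for f n
    by (simp add: fock_nat)
  \<comment> \<open>If this value were zero, the recurrence would annihilate every coefficient, and
    by completeness the Gaussian would vanish.\<close>
  have "fock (hermite_coeffs g) 0 \<noteq> 0"
  proof
    assume 0: "fock (hermite_coeffs g) 0 = 0"
    have "fock (hermite_coeffs g) (int n) = 0" for n
    proof (induction n rule: less_induct)
      case (less n)
      show ?case
      proof (cases n)
        case (Suc m)
        have "fock (hermite_coeffs g) (int m - 1) = 0"
          using less[of "m - 1"] Suc by (cases m) (auto simp: fock_neg)
        moreover have "fock (hermite_coeffs g) (int m) = 0" using less[of m] Suc by simp
        ultimately have "of_int (int m + 1) * fock (hermite_coeffs g) (int m + 1) = 0"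
          using gauss_recD[OF rec, of "int m"] by simp
        moreover have "(of_int (int m + 1) :: complex) \<noteq> 0" unfolding of_int_eq_0_iff by simp
        ultimately show ?thesis using Suc by (simp add: add.commute)
      qed (simp add: 0)
    qed
    then have "AE x in lebesgue. g x = 0"
      using g coeff[of g] by (intro hermite_fun_complete) (auto simp: hermite_coeffs_def)
    then show False using gaussian_not_AE_0 unfolding g_def by blast
  qed
  note g0 = this
  show ?thesis
  proof (rule that[OF \<alpha>])
    fix f assume f: "f \<in> L2" and fr: "gauss_rec p q (fock (hermite_coeffs f))"
    define \<gamma> where "\<gamma> = fock (hermite_coeffs f) 0 / fock (hermite_coeffs g) 0"
    have "hermite_coeffs f n = hermite_coeffs (\<lambda>x. \<gamma> * g x) n" for n
    proof -
      have "fock (hermite_coeffs f) (int n) = \<gamma> * fock (hermite_coeffs g) (int n)"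
        using gauss_rec_unique[OF rec fr fock_neg fock_neg, of "int n"] g0 by (simp add: \<gamma>_def field_simps)
      then show ?thesis
        unfolding hermite_coeffs_cmult coeff[of f n] coeff[of g n] by simp
    qed
    then have "AE x in lebesgue. f x = \<gamma> * g x"
      by (intro hermite_coeffs_inject_AE f L2_cmult g)
    then show "\<exists>\<gamma>. AE x in lebesgue. f x = gaussian \<alpha> \<beta> \<gamma> x"
      unfolding g_def gaussian_cmult[of \<alpha> \<beta> \<gamma>, symmetric, THEN fun_cong] by blast
  qed
qed

section \<open>Symmetry of the pairing and invariance of extremals\<close>

lemma (in rotation_kernel) pairing_commute: "pairing G F = cnj (pairing F G)"
  if "(\<lambda>L. level_sqnorm L F) sums A" "(\<lambda>L. level_sqnorm L G) sums D"
proof -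
  have "(\<lambda>L. cnj (level_inner L (proj L F) G)) sums cnj (pairing F G)"
    using pairing_sums[OF that] by (simp add: sums_cnj)
  moreover have "cnj (level_inner L (proj L F) G) = level_inner L (proj L G) F" for L
    by (simp add: level_inner_cnj level_inner_proj)
  ultimately show ?thesis
    using pairing_sums[OF that(2,1)] by (simp add: sums_unique2)
qed

text \<open>On each level \<open>F\<close> is a multiple of a projected array, which
  \<open>rot\<close> annihilates. Indices of negative total degree need separate care, since they
  belong to no level.\<close>

lemma (in rotation_kernel) extremal_rotation_invariant:
  assumes F: "\<And>L i j k. (i, j, k) \<in> triples L \<Longrightarrow> F i j k = \<mu> * proj L G i j k"
    and neg: "\<And>i j k. i < 0 \<or> j < 0 \<or> k < 0 \<Longrightarrow> F i j k = 0"
  shows "rot F i j k = 0"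
proof (cases "i + j + k < 0")
  case True
  then have "F i' j' k' = 0" if "i' + j' + k' = i + j + k" for i' j' k'
    using that by (intro neg) linarith
  then show ?thesis by (simp add: rot_def)
next
  case False
  define L where "L = nat (i + j + k)"
  have "F i' j' k' = \<mu> * proj L G i' j' k'" if "i' + j' + k' = i + j + k" for i' j' k'
  proof (cases "i' < 0 \<or> j' < 0 \<or> k' < 0")
    case True
    then show ?thesis by (simp add: neg proj_neg)
  next
    case nn: False
    then show ?thesis using F[of i' j' k' L] False that by (simp add: triples_def L_def)
  qed
  then have "rot F i j k = \<mu> * rot (proj L G) i j k"
    by (simp add: rot_def algebra_simps)
  then show ?thesis by (simp add: rot_proj)
qed

section \<open>The sharp bound and its extremals\<close>

lemma tens_coeffs_sums:
  assumes "f \<in> L2" "g \<in> L2" "h \<in> L2"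
  shows "(\<lambda>L. level_sqnorm L (tens (hermite_coeffs f) (hermite_coeffs g) (hermite_coeffs h))) sums
    (L2_norm f * L2_norm g * L2_norm h)\<^sup>2"
proof -
  note p = parseval[folded hermite_coeffs_def]
  show ?thesis
    using tens_level_sqnorm_sums[OF p[THEN sums_summable] p[THEN sums_summable] p[THEN sums_summable], OF assms]
    by (simp add: p[THEN sums_unique, symmetric] assms power_mult_distrib)
qed

lemma fock_coeffs_nonzero:
  assumes "f \<in> L2" "\<not> (AE x in lebesgue. f x = 0)"
  shows "\<exists>n. fock (hermite_coeffs f) n \<noteq> 0"
proof (rule ccontr)
  assume "\<not> ?thesis"
  then have "fock (hermite_coeffs f) (int n) = 0" for n by blast
  then have "hermite_coeffs f n = 0" for n by (simp add: fock_nat)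
  then show False
    using assms hermite_fun_complete[OF assms(1)] by (simp add: hermite_coeffs_def)
qed

context
  fixes f :: "nat \<Rightarrow> real \<Rightarrow> complex"
  assumes f: "\<And>k. k \<in> {1..6} \<Longrightarrow> f k \<in> L2"
begin

private abbreviation "c k \<equiv> hermite_coeffs (f k)"
private abbreviation "F \<equiv> tens (c 1) (c 2) (c 3)"
private abbreviation "G \<equiv> tens (c 4) (c 5) (c 6)"
private abbreviation "A \<equiv> (L2_norm (f 1) * L2_norm (f 2) * L2_norm (f 3))\<^sup>2"
private abbreviation "D \<equiv> (L2_norm (f 4) * L2_norm (f 5) * L2_norm (f 6))\<^sup>2"

lemma F_sums: "(\<lambda>L. level_sqnorm L F) sums A" and G_sums: "(\<lambda>L. level_sqnorm L G) sums D"
  by (rule tens_coeffs_sums; rule f; simp)+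

lemma A_D: "A * D = (\<Prod>k\<in>{1..6}. L2_norm (f k))\<^sup>2"
  unfolding prod_upto_6 by (simp add: power_mult_distrib)

lemma prod_norm_nonneg: "0 \<le> (\<Prod>k\<in>{1..6}. L2_norm (f k))"
  by (intro prod_nonneg) (simp add: L2_norm_nonneg)

lemma norm_E6: "cmod (E6 (f 1) (f 2) (f 3) (f 4) (f 5) (f 6)) = 1 / (pi * sqrt 3) * cmod (hkernel.pairing F G)"
proof -
  have "E6 (f 1) (f 2) (f 3) (f 4) (f 5) (f 6) = 1 / (pi * sqrt 3) * hkernel.pairing F G"
    by (rule E6_eq_pairing(2)) (rule f)
  then show ?thesis by (simp only: norm_mult norm_divide norm_of_real norm_one) simp
qed

lemma norm_E6_le:
  "cmod (E6 (f 1) (f 2) (f 3) (f 4) (f 5) (f 6)) \<le> 1 / (pi * sqrt 3) * (\<Prod>k\<in>{1..6}. L2_norm (f k))"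
  unfolding norm_E6
proof (intro mult_left_mono)
  show "cmod (hkernel.pairing F G) \<le> (\<Prod>k\<in>{1..6}. L2_norm (f k))"
    using hkernel.norm_pairing_le[OF F_sums G_sums] unfolding A_D
    by (rule power2_le_imp_le[OF _ prod_norm_nonneg])
qed simp

lemma norm_E6_eq_iff:
  "cmod (E6 (f 1) (f 2) (f 3) (f 4) (f 5) (f 6)) = 1 / (pi * sqrt 3) * (\<Prod>k\<in>{1..6}. L2_norm (f k))
    \<longleftrightarrow> (cmod (hkernel.pairing F G))\<^sup>2 = A * D"
  unfolding norm_E6 A_D using prod_norm_nonneg
  by (simp add: power2_eq_iff_nonneg)

lemma extremal_imp_gaussian:
  assumes attained: "cmod (E6 (f 1) (f 2) (f 3) (f 4) (f 5) (f 6)) = 1 / (pi * sqrt 3) * (\<Prod>k\<in>{1..6}. L2_norm (f k))"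
    and nz: "\<And>k. k \<in> {1..6} \<Longrightarrow> \<not> (AE x in lebesgue. f k x = 0)"
  shows "\<exists>\<alpha> \<beta> \<gamma>. Re \<alpha> > 0 \<and> (\<forall>k\<in>{1..6}. AE x in lebesgue. f k x = gaussian \<alpha> \<beta> (\<gamma> k) x)"
proof -
  have eq: "(cmod (hkernel.pairing F G))\<^sup>2 = A * D"
    using attained by (simp only: norm_E6_eq_iff)
  have "L2_norm (f k) \<noteq> 0" if "k \<in> {1..6}" for k
    using nz[OF that] L2_norm_eq_0_iff[OF f[OF that]] by blast
  then have pos: "0 < L2_norm (f k)" if "k \<in> {1..6}" for k
    using L2_norm_nonneg[of "f k"] that by (simp add: less_le)
  have AD: "0 < A" "0 < D"
    by (intro zero_less_power mult_pos_pos pos; simp)+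
  obtain \<mu> where \<mu>: "\<And>L i j k. (i, j, k) \<in> triples L \<Longrightarrow> F i j k = \<mu> * hkernel.proj L G i j k"
    using hkernel.pairing_extremal[OF F_sums G_sums eq AD(2)] by blast
  \<comment> \<open>The equality case describes only the first argument as a projected array, so it
    is used a second time with the roles exchanged to obtain the invariance of
    \<open>G\<close>.\<close>
  have eq': "(cmod (hkernel.pairing G F))\<^sup>2 = D * A"
    using eq unfolding hkernel.pairing_commute[OF F_sums G_sums] by (simp add: mult.commute)
  obtain \<nu> where \<nu>: "\<And>L i j k. (i, j, k) \<in> triples L \<Longrightarrow> G i j k = \<nu> * hkernel.proj L F i j k"
    using hkernel.pairing_extremal[OF G_sums F_sums eq' AD(1)] by blast
  have rotF: "rot F i j k = 0" for i j k
    using \<mu> tens_neg by (rule hkernel.extremal_rotation_invariant)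
  have rotG: "rot G i j k = 0" for i j k
    using \<nu> tens_neg by (rule hkernel.extremal_rotation_invariant)
  \<comment> \<open>The projection fixes the invariant \<open>F\<close>, so the second description
    of the equality case becomes proportionality.\<close>
  have GF: "G i j k = \<nu> * F i j k" if "(i, j, k) \<in> triples L" for i j k L
    unfolding \<nu>[OF that] using hkernel.proj_rotation_invariant'[OF rotF tens_neg that] by simp
  have cnz: "\<exists>n. fock (c k) n \<noteq> 0" if "k \<in> {1..6}" for k
    using fock_coeffs_nonzero[OF f[OF that] nz[OF that]] .
  have rF: "rot (\<lambda>i j k. fock (c 1) i * fock (c 2) j * fock (c 3) k) i j k = 0" for i j k
    using rotF[of i j k] by (simp add: tens_def[abs_def])
  have rG: "rot (\<lambda>i j k. fock (c 4) i * fock (c 5) j * fock (c 6) k) i j k = 0" for i j k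
    using rotG[of i j k] by (simp add: tens_def[abs_def])
  obtain p q where F0: "fock (c 1) 0 \<noteq> 0" "fock (c 2) 0 \<noteq> 0" "fock (c 3) 0 \<noteq> 0"
    and rec: "gauss_rec p q (fock (c 1))" "gauss_rec p q (fock (c 2))" "gauss_rec p q (fock (c 3))"
    by (rule product_rotation_invariant[OF rF fock_neg fock_neg fock_neg cnz cnz cnz]) auto
  obtain p' q' where G0: "fock (c 4) 0 \<noteq> 0" "fock (c 5) 0 \<noteq> 0" "fock (c 6) 0 \<noteq> 0"
    and rec': "gauss_rec p' q' (fock (c 4))" "gauss_rec p' q' (fock (c 5))" "gauss_rec p' q' (fock (c 6))"
    by (rule product_rotation_invariant[OF rG fock_neg fock_neg fock_neg cnz cnz cnz]) auto
  \<comment> \<open>Proportionality of the products along the axis \<open>(i, 0, 0)\<close> gives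
    proportionality of the first factors. This carries \<open>p\<close> and \<open>q\<close> from
    one half of the six functions to the other.\<close>
  define \<kappa> where "\<kappa> = \<nu> * fock (c 2) 0 * fock (c 3) 0 / (fock (c 5) 0 * fock (c 6) 0)"
  have scale: "fock (c 4) i = \<kappa> * fock (c 1) i" if "0 \<le> i" for i
  proof -
    have "(i, 0, 0) \<in> triples (nat i)" using that by (simp add: triples_def)
    from GF[OF this] show ?thesis
      using G0 by (simp add: tens_def \<kappa>_def field_simps)
  qed
  have \<kappa>: "\<kappa> \<noteq> 0" using scale[of 0] G0 by auto
  have p: "p' = p"
    using gauss_rec_0[OF rec(1) fock_neg] gauss_rec_0[OF rec'(1) fock_neg] scale[of 0] scale[of 1] F0 \<kappa> by simp
  have q: "q' = q"
  proof -
    have "p * (\<kappa> * fock (c 1) 1) + q' * (\<kappa> * fock (c 1) 0) = 2 * (\<kappa> * fock (c 1) 2)"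
      using gauss_rec_1[OF rec'(1)] scale[of 0] scale[of 1] scale[of 2] by (simp add: p)
    also have "\<dots> = \<kappa> * (2 * fock (c 1) 2)" by (rule mult.left_commute)
    also have "\<dots> = p * (\<kappa> * fock (c 1) 1) + q * (\<kappa> * fock (c 1) 0)"
      unfolding gauss_rec_1[OF rec(1)] by (simp only: distrib_left mult.left_commute)
    finally show ?thesis using \<kappa> F0 by simp
  qed
  have rec_all: "gauss_rec p q (fock (c k))" if "k \<in> {1..6}" for k
  proof -
    have "k = 1 \<or> k = 2 \<or> k = 3 \<or> k = 4 \<or> k = 5 \<or> k = 6" using that by auto
    then show ?thesis using rec rec' unfolding p q by auto
  qed
  have "cmod q < 1"
    by (rule gauss_rec_norm_less_1[OF _ rec(1) F0(1)]) (simp add: hermite_coeffs_def bessel_summable f)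
  then obtain \<alpha> \<beta> where \<alpha>: "0 < Re \<alpha>" and g: "\<And>f. f \<in> L2 \<Longrightarrow> gauss_rec p q (fock (hermite_coeffs f)) \<Longrightarrow> \<exists>\<gamma>. AE x in
      lebesgue. f x = gaussian \<alpha> \<beta> \<gamma> x"
    by (rule gauss_rec_imp_gaussian) blast
  have "\<forall>k\<in>{1..6}. \<exists>\<gamma>. AE x in lebesgue. f k x = gaussian \<alpha> \<beta> \<gamma> x"
    using g f rec_all by blast
  then obtain \<gamma> where "\<forall>k\<in>{1..6}. AE x in lebesgue. f k x = gaussian \<alpha> \<beta> (\<gamma> k) x"
    by (rule bchoice[THEN exE])
  with \<alpha> show ?thesis by blast
qed

text \<open>All six coefficient sequences are multiples of one solution of the recurrence, so both
  products are invariant and proportional, which is equality in Cauchy-Schwarz with nothing lost by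
  the projection.\<close>

lemma gaussian_imp_extremal:
  assumes \<alpha>: "Re \<alpha> > 0" and g: "\<And>k. k \<in> {1..6} \<Longrightarrow> AE x in lebesgue. f k x = gaussian \<alpha> \<beta> (\<gamma> k) x"
    and nz: "\<And>k. k \<in> {1..6} \<Longrightarrow> \<not> (AE x in lebesgue. f k x = 0)"
  shows "cmod (E6 (f 1) (f 2) (f 3) (f 4) (f 5) (f 6)) = 1 / (pi * sqrt 3) * (\<Prod>k\<in>{1..6}. L2_norm (f k))"
proof -
  define a where "a = hermite_coeffs (gaussian \<alpha> \<beta> 1)"
  have ga: "gaussian \<alpha> \<beta> \<gamma>' \<in> L2" for \<gamma>' by (intro gauss_bounded_L2 gauss_bounded_gaussian \<alpha>)
  have c: "fock (c k) i = \<gamma> k * fock a i" if "k \<in> {1..6}" for k i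
  proof -
    have "c k n = \<gamma> k * a n" for n
      using hermite_coeffs_cong_AE[OF f[OF that] ga g[OF that], of n]
      unfolding gaussian_cmult[of \<alpha> \<beta> "\<gamma> k"] hermite_coeffs_cmult a_def .
    then show ?thesis by (simp add: fock_def)
  qed
  have \<gamma>: "\<gamma> k \<noteq> 0" if "k \<in> {1..6}" for k
    using g[OF that] nz[OF that] by (auto simp: gaussian_def)
  define \<mu> where "\<mu> = \<gamma> 4 * \<gamma> 5 * \<gamma> 6 / (\<gamma> 1 * \<gamma> 2 * \<gamma> 3)"
  have FG: "G = (\<lambda>i j k. \<mu> * F i j k)"
    using \<gamma>[of 1] \<gamma>[of 2] \<gamma>[of 3] by (intro ext) (simp add: tens_def c \<mu>_def field_simps del: One_nat_def)
  have rec: "gauss_rec (sqrt 2 * \<beta> / (1 + 2 * \<alpha>)) ((1 - 2 * \<alpha>) / (1 + 2 * \<alpha>)) (fock a)"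
    unfolding a_def by (rule fock_gaussian[OF \<alpha>])
  have "rot F i j k = \<gamma> 1 * \<gamma> 2 * \<gamma> 3 * rot (\<lambda>i j k. fock a i * fock a j * fock a k) i j k" for i j k
    by (simp add: rot_def tens_def c algebra_simps del: One_nat_def)
  then have rot: "rot F i j k = 0" for i j k
    by (simp add: gauss_rec_rot[OF rec rec rec])
  have "(\<lambda>L. level_sqnorm L G) sums ((cmod \<mu>)\<^sup>2 * A)"
  proof -
    have "level_sqnorm L G = (cmod \<mu>)\<^sup>2 * level_sqnorm L F" for L
      unfolding FG by (simp add: level_sqnorm_def norm_mult power_mult_distrib sum_distrib_left split_def mult_ac
          del: One_nat_def)
    then show ?thesis using sums_mult[OF F_sums] by simp
  qed
  with G_sums have D: "D = (cmod \<mu>)\<^sup>2 * A" by (rule sums_unique2)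
  have "hkernel.pairing F G = cnj \<mu> * of_real A"
    unfolding FG by (rule hkernel.pairing_rotation_invariant[OF rot tens_neg F_sums])
  then have "cmod (hkernel.pairing F G) = cmod (cnj \<mu> * of_real A)" by (rule arg_cong)
  also have "\<dots> = cmod \<mu> * A" by (simp only: norm_mult norm_of_real complex_mod_cnj abs_power2)
  finally have "cmod (hkernel.pairing F G) = cmod \<mu> * A" .
  then show ?thesis unfolding norm_E6_eq_iff D by (simp add: power_mult_distrib power2_eq_square)
qed

end

text \<open>Equality is preserved when each function is scaled separately, so the Gaussians share
  \<open>\<alpha>\<close> and \<open>\<beta>\<close> while each has its own
  \<open>\<gamma> k\<close>. If one function vanishes, both sides are zero whatever the other
  functions are, which accounts for the first alternative.\<close>

theorem theorem3p10:
  fixes f :: "nat \<Rightarrow> real \<Rightarrow> complex"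
  assumes "\<And>k. k \<in> {1..6} \<Longrightarrow> f k \<in> L2"
  shows "E6_converges (f 1) (f 2) (f 3) (f 4) (f 5) (f 6)
    \<and> cmod (E6 (f 1) (f 2) (f 3) (f 4) (f 5) (f 6))
        \<le> 1 / (pi * sqrt 3) * (\<Prod>k\<in>{1..6}. L2_norm (f k))
    \<and> (\<forall>g\<in>L2. H6 g \<in> \<real> \<and> 0 \<le> Re (H6 g) \<and> Re (H6 g) \<le> 1 / (pi * sqrt 3) * L2_norm g ^ 6)
    \<and> (cmod (E6 (f 1) (f 2) (f 3) (f 4) (f 5) (f 6))
          = 1 / (pi * sqrt 3) * (\<Prod>k\<in>{1..6}. L2_norm (f k))
       \<longleftrightarrow> (\<exists>k\<in>{1..6}. AE x in lebesgue. f k x = 0) \<or>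
           (\<exists>\<alpha> \<beta> \<gamma>. Re \<alpha> > 0 \<and>
              (\<forall>k\<in>{1..6}. AE x in lebesgue. f k x = gaussian \<alpha> \<beta> (\<gamma> k) x)))"
proof -
  have le: "cmod (E6 (f 1) (f 2) (f 3) (f 4) (f 5) (f 6)) \<le> 1 / (pi * sqrt 3) * (\<Prod>k\<in>{1..6}. L2_norm (f k))"
    by (rule norm_E6_le) (rule assms)
  show ?thesis
  proof (intro conjI ballI)
    show "E6_converges (f 1) (f 2) (f 3) (f 4) (f 5) (f 6)"
      by (rule E6_eq_pairing(1)[of f, OF assms])
    show "cmod (E6 (f 1) (f 2) (f 3) (f 4) (f 5) (f 6)) \<le> 1 / (pi * sqrt 3) * (\<Prod>k\<in>{1..6}. L2_norm (f k))"
      by (rule le)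
    fix g assume g: "g \<in> L2"
    let ?T = "tens (hermite_coeffs g) (hermite_coeffs g) (hermite_coeffs g)"
    have H6: "H6 g = of_real (1 / (pi * sqrt 3)) * hkernel.pairing ?T ?T"
      using E6_eq_pairing(2)[of "\<lambda>_. g"] g by (simp add: H6_def)
    note T = hkernel.pairing_self[OF tens_coeffs_sums[OF g g g]]
    show "H6 g \<in> \<real>" unfolding H6 by (intro Reals_mult Reals_of_real T)
    show "0 \<le> Re (H6 g)" unfolding H6 using T(2) by simp
    show "Re (H6 g) \<le> 1 / (pi * sqrt 3) * L2_norm g ^ 6"
      using norm_E6_le[of "\<lambda>_. g"] g complex_Re_le_cmod[of "H6 g"] by (simp add: H6_def)
  next
    let ?Z = "\<exists>k\<in>{1..6}. AE x in lebesgue. f k x = 0"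
    show "cmod (E6 (f 1) (f 2) (f 3) (f 4) (f 5) (f 6)) = 1 / (pi * sqrt 3) * (\<Prod>k\<in>{1..6}. L2_norm (f k))
      \<longleftrightarrow> ?Z \<or> (\<exists>\<alpha> \<beta> \<gamma>. Re \<alpha> > 0 \<and> (\<forall>k\<in>{1..6}. AE x in lebesgue. f k x = gaussian \<alpha> \<beta> (\<gamma> k) x))"
    proof (cases ?Z)
      \<comment> \<open>The product of norms is zero, and the bound itself then forces
        \<open>E6\<close> to vanish.\<close>
      case True
      then have z: "(\<Prod>k\<in>{1..6}. L2_norm (f k)) = 0"
        using L2_norm_eq_0_iff[OF assms] by (intro prod_zero) auto
      from le have "E6 (f 1) (f 2) (f 3) (f 4) (f 5) (f 6) = 0" unfolding z by simp
      with True show ?thesis unfolding z by simp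
    next
      case False
      then have nz: "\<not> (AE x in lebesgue. f k x = 0)" if "k \<in> {1..6}" for k
        using that by blast
      show ?thesis
      proof
        assume "cmod (E6 (f 1) (f 2) (f 3) (f 4) (f 5) (f 6)) = 1 / (pi * sqrt 3) * (\<Prod>k\<in>{1..6}. L2_norm (f k))"
        from extremal_imp_gaussian[OF assms this nz]
        show "?Z \<or> (\<exists>\<alpha> \<beta> \<gamma>. Re \<alpha> > 0 \<and> (\<forall>k\<in>{1..6}. AE x in lebesgue. f k x = gaussian \<alpha> \<beta> (\<gamma> k) x))"
          by (rule disjI2)
      next
        assume "?Z \<or> (\<exists>\<alpha> \<beta> \<gamma>. Re \<alpha> > 0 \<and> (\<forall>k\<in>{1..6}. AE x in lebesgue. f k x = gaussian \<alpha> \<beta> (\<gamma> k) x))"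
        with False obtain \<alpha> \<beta> \<gamma> where \<alpha>: "Re \<alpha> > 0"
          and g: "\<forall>k\<in>{1..6}. AE x in lebesgue. f k x = gaussian \<alpha> \<beta> (\<gamma> k) x"
          by blast
        show "cmod (E6 (f 1) (f 2) (f 3) (f 4) (f 5) (f 6)) = 1 / (pi * sqrt 3) * (\<Prod>k\<in>{1..6}. L2_norm (f k))"
          by (rule gaussian_imp_extremal[OF assms \<alpha> bspec[OF g] nz])
      qed
    qed
  qed
qed

end
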